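(* Let $\theta=0$ and $\theta_1,\theta_2\in\mathbb R$. Consider the system $\partial_tu+A_0u+B_0(u,u)=g$, $u(0)=u_0$. Assume: (i) $b_0(w,v,Nv)=0$ for all $v,w\in V^{-\theta_2}$; (ii) $b_0:V^{\bar\sigma_1}\times V^{\bar\sigma_2}\times V^{\bar\gamma}\to\mathbb R$ is bounded for some $\bar\sigma_1,\bar\sigma_2<-\theta_2$ and $\bar\gamma\in\mathbb R$; (iii) $b_0:V^{\sigma_1}\times V^{-\theta_2}\times V^{\sigma_2}\to\mathbb R$ is bounded for some $\sigma_1\le-\theta_2$ and $\sigma_2\le\theta_2$ with $\sigma_1+\sigma_2\le0$; (iv) $\langle A_0v,Nv\rangle\ge c_{A_0}\|v\|_{-\theta_2}^2$ for all $v\in V^{-\theta_2}$, with a constant $c_{A_0}>0$; and, for some $\beta>-\theta_2$, (v) $\langle A_0v,\Lambda^{2\beta}v\rangle\ge c_{A_0}\|v\|_\beta^2$ for all $v\in V^\beta$, for some $c_{A_0}>0$; (vi) $b_0:V^{-\theta_2}\times V^{-\theta_2}\times V^{-\beta}\to\mathbb R$ is bounded; (vii) $g\in V^\beta$ is time independent. Then the global attractor $\mathcal A_{reg}$ of the semigroup $S_{NS}$ on $V^{-\theta_2}$ is bounded in $V^\beta$ and has finite fractal dimension.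
   Context: Setting. Let $\Omega$ be an $n$-dimensional ($n=2,3$) smooth compact Riemannian manifold with or without boundary, equipped with a volume form; $E\to\Omega$ is a vector bundle with a Riemannian metric. Fix a linear subspace $\mathcal V\subseteq C^\infty(E)$; for $s\in\mathbb R$ let $V^s$ be its closure in $H^s$, with norm $\|\cdot\|_s$; $\langle\cdot,\cdot\rangle$ is the $L^2$ inner product and its continuous extension to the duality $V^s,V^{-s}$. There is a self-adjoint positive operator $\Lambda$ such that $\Lambda^s:V^s\to V^0$ is an isometry for all $s\in\mathbb R$ and $\Lambda^{-1}$ is compact. Linear operators $A_0,M,N$ on $\mathcal V$ extend to bounded operators $A_0:V^s\to V^s$ (i.e. $\theta=0$), $M:V^s\to V^{s+2\theta_1}$, $N:V^s\to V^{s+2\theta_2}$ for every $s$; $A_0$ and $N$ are self-adjoint, and $\langle Nv,v\rangle\ge c_N\|v\|_{-\theta_2}^2$ for $v\in V^{-\theta_2}$ with $c_N>0$. $B_0(v,w)=\bar B_0(Mv,Nw)$ with $\bar B_0:\mathcal V\times\mathcal V\to\mathcal V$ bilinear, and $b_0(u,v,w)=\langle B_0(u,v),w\rangle$; "$b_0:V^a\times V^b\times V^c\to\mathbb R$ is bounded" means that $b_0$ extends to a bounded trilinear form there. Weak solution on $(0,T)$: $u\in L^\infty(0,T;V^{-\theta_2})$ with $\partial_tu\in L^p(0,T;V^{-\gamma})$ for some $p>1$, $\gamma\ge0$, $u(0)=u_0\in V^{-\theta_2}$, and $\int_0^T(-\langle u,w'\rangle+\langle A_0u,w\rangle+b_0(u,u,w))dt=\int_0^T\langle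 g,w\rangle dt$ for all $w\in C_0^\infty(0,T;\mathcal V)$. Conditions (i)–(iv) ensure that weak solutions generate a continuous semigroup $S_{NS}(t):V^{-\theta_2}\to V^{-\theta_2}$, $u_0\mapsto u(t)$, $t\ge0$. The global attractor $\mathcal A_{reg}$ is the compact set in $V^{-\theta_2}$ with $S_{NS}(t)\mathcal A_{reg}=\mathcal A_{reg}$ for all $t\ge0$ which attracts every bounded subset of $V^{-\theta_2}$ (it exists under these hypotheses). *)

theory Defs
  imports "HOL-Analysis.Analysis"
begin

text \<open>
  Smoothness is meant for sets with unique derivatives (relatively open subsets of a closed
  half-space): all iterated directional derivatives exist and are differentiable on the set,
  one-sidedly at boundary points.
\<close>

coinductive smooth_on :: "'a::real_normed_vector set \<Rightarrow> ('a \<Rightarrow> 'b::real_normed_vector) \<Rightarrow> bool"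
  for S where
  "\<lbrakk>\<And>x. x \<in> S \<Longrightarrow> f differentiable (at x within S);
    \<And>v. smooth_on S (\<lambda>x. frechet_derivative f (at x within S) v)\<rbrakk> \<Longrightarrow> smooth_on S f"

definition lin_on :: "'a::real_vector set \<Rightarrow> ('a \<Rightarrow> 'b::real_vector) \<Rightarrow> bool" where
  "lin_on A f \<longleftrightarrow>
     (\<forall>u\<in>A. \<forall>v\<in>A. f (u + v) = f u + f v) \<and> (\<forall>a. \<forall>u\<in>A. f (a *\<^sub>R u) = a *\<^sub>R f u)"


section \<open>The manifold, the vector bundle and its sections\<close>

text \<open>
  A chart consists of a domain \<open>dmn\<close>, coordinates \<open>crd\<close> on it, and a trivialization
  \<open>triv\<close> of the bundle over it.  The fibres of the bundle are subspaces \<open>Eb p\<close> of one universe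
  \<open>'f\<close>, so that sections are ordinary functions and are added pointwise.  This is no
  embedding into a trivial bundle: \<open>'f\<close> carries no topology, and the smooth structure comes from
  the trivializations alone.
\<close>

record ('p, 'f, 'n, 'r) bchart =
  dmn :: "'p set"
  crd :: "'p \<Rightarrow> real ^ 'n"
  triv :: "'p \<Rightarrow> 'f \<Rightarrow> real ^ 'r"

definition img :: "('p, 'f, 'n::finite, 'r::finite) bchart \<Rightarrow> (real ^ 'n) set" where
  "img c = crd c ` dmn c"

definition pt :: "('p, 'f, 'n::finite, 'r::finite) bchart \<Rightarrow> real ^ 'n \<Rightarrow> 'p" where
  "pt c = inv_into (dmn c) (crd c)"

definition overlap ::
  "('p, 'f, 'n::finite, 'r::finite) bchart \<Rightarrow> ('p, 'f, 'n, 'r) bchart \<Rightarrow> (real ^ 'n) set" where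
  "overlap c c' = crd c ` (dmn c \<inter> dmn c')"

definition transition ::
  "('p, 'f, 'n::finite, 'r::finite) bchart \<Rightarrow> ('p, 'f, 'n, 'r) bchart \<Rightarrow> real ^ 'n \<Rightarrow> real ^ 'n" where
  "transition c c' = (\<lambda>x. crd c' (pt c x))"

definition transition_deriv ::
  "('p, 'f, 'n::finite, 'r::finite) bchart \<Rightarrow> ('p, 'f, 'n, 'r) bchart \<Rightarrow>
     real ^ 'n \<Rightarrow> real ^ 'n \<Rightarrow> real ^ 'n" where
  "transition_deriv c c' x = frechet_derivative (transition c c') (at x within overlap c c')"

definition lift :: "('p \<Rightarrow> 'f set) \<Rightarrow> ('p, 'f, 'n::finite, 'r::finite) bchart \<Rightarrow> real ^ 'r \<Rightarrow> 'p \<Rightarrow> 'f" where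
  "lift Eb c \<xi> p = inv_into (Eb p) (triv c p) \<xi>"

text \<open>
  \<open>G\<close> and \<open>om\<close> are the local coordinate expressions of the Riemannian metric and of the
  volume form of \<open>Om\<close>, \<open>h\<close> is the fibre metric of the bundle, and \<open>vol\<close> is the measure on \<open>Om\<close>
  that the volume form induces.
\<close>

locale riemannian_bundle =
  fixes Om :: "'p::t2_space set"
    and C :: "('p, 'f::real_vector, 'n::finite, 'r::finite) bchart set"
    and G :: "('p, 'f, 'n, 'r) bchart \<Rightarrow> real ^ 'n \<Rightarrow> real ^ 'n ^ 'n"
    and om :: "('p, 'f, 'n, 'r) bchart \<Rightarrow> real ^ 'n \<Rightarrow> real"
    and vol :: "'p measure"
    and Eb :: "'p \<Rightarrow> 'f set"
    and h :: "'p \<Rightarrow> 'f \<Rightarrow> 'f \<Rightarrow> real"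
  assumes dim: "CARD('n) = 2 \<or> CARD('n) = 3"
    and compact_Om: "compact Om"
    and charts_cover: "(\<Union>c\<in>C. dmn c) = Om"
    and chart_dmn: "c \<in> C \<Longrightarrow> openin (top_of_set Om) (dmn c)"
    and chart_img: "c \<in> C \<Longrightarrow> \<exists>k. openin (top_of_set {x. 0 \<le> x $ k}) (img c)"
    and chart_homeo: "c \<in> C \<Longrightarrow> homeomorphism (dmn c) (img c) (crd c) (pt c)"
    and chart_smooth: "\<lbrakk>c \<in> C; c' \<in> C\<rbrakk> \<Longrightarrow> smooth_on (overlap c c') (transition c c')"
    and G_smooth: "c \<in> C \<Longrightarrow> smooth_on (img c) (G c)"
    and G_sym: "\<lbrakk>c \<in> C; x \<in> img c\<rbrakk> \<Longrightarrow> transpose (G c x) = G c x"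
    and G_pos: "\<lbrakk>c \<in> C; x \<in> img c; a \<noteq> 0\<rbrakk> \<Longrightarrow> 0 < a \<bullet> (G c x *v a)"
    and G_compat: "\<lbrakk>c \<in> C; c' \<in> C; x \<in> overlap c c'\<rbrakk> \<Longrightarrow>
          a \<bullet> (G c x *v b) = transition_deriv c c' x a \<bullet>
            (G c' (transition c c' x) *v transition_deriv c c' x b)"
    and om_smooth: "c \<in> C \<Longrightarrow> smooth_on (img c) (om c)"
    and om_nonzero: "\<lbrakk>c \<in> C; x \<in> img c\<rbrakk> \<Longrightarrow> om c x \<noteq> 0"
    and om_compat: "\<lbrakk>c \<in> C; c' \<in> C; x \<in> overlap c c'\<rbrakk> \<Longrightarrow>
          om c x = det (matrix (transition_deriv c c' x)) * om c' (transition c c' x)"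
    and sets_vol: "sets vol = sets (restrict_space borel Om)"
    and emeasure_vol: "\<lbrakk>c \<in> C; B \<in> sets vol; B \<subseteq> dmn c\<rbrakk> \<Longrightarrow>
          emeasure vol B = (\<integral>\<^sup>+x\<in>crd c ` B. ennreal \<bar>om c x\<bar> \<partial>lborel)"
    and fibre: "p \<in> Om \<Longrightarrow> subspace (Eb p)"
    and triv_lin: "\<lbrakk>c \<in> C; p \<in> dmn c\<rbrakk> \<Longrightarrow> lin_on (Eb p) (triv c p)"
    and triv_bij: "\<lbrakk>c \<in> C; p \<in> dmn c\<rbrakk> \<Longrightarrow> bij_betw (triv c p) (Eb p) UNIV"
    and triv_smooth: "\<lbrakk>c \<in> C; c' \<in> C\<rbrakk> \<Longrightarrow>
          smooth_on (overlap c c') (\<lambda>x. triv c' (pt c x) (lift Eb c \<xi> (pt c x)))"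
    and h_sym: "\<lbrakk>p \<in> Om; e \<in> Eb p; e' \<in> Eb p\<rbrakk> \<Longrightarrow> h p e e' = h p e' e"
    and h_lin: "\<lbrakk>p \<in> Om; e' \<in> Eb p\<rbrakk> \<Longrightarrow> lin_on (Eb p) (\<lambda>e. h p e e')"
    and h_pos: "\<lbrakk>p \<in> Om; e \<in> Eb p; e \<noteq> 0\<rbrakk> \<Longrightarrow> 0 < h p e e"
    and h_smooth: "c \<in> C \<Longrightarrow>
          smooth_on (img c) (\<lambda>x. h (pt c x) (lift Eb c \<xi> (pt c x)) (lift Eb c \<eta> (pt c x)))"

definition loc_rep ::
  "('p, 'f, 'n::finite, 'r::finite) bchart \<Rightarrow> ('p \<Rightarrow> 'f) \<Rightarrow> real ^ 'n \<Rightarrow> real ^ 'r" where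
  "loc_rep c u x = triv c (pt c x) (u (pt c x))"

text \<open>Sections are extended by \<open>0\<close> outside \<open>Om\<close>, so that equal sections are equal functions.\<close>

definition smooth_sections ::
  "'p set \<Rightarrow> ('p, 'f::real_vector, 'n::finite, 'r::finite) bchart set \<Rightarrow> ('p \<Rightarrow> 'f set) \<Rightarrow> ('p \<Rightarrow> 'f) set" where
  "smooth_sections Om C Eb =
     {u. (\<forall>p\<in>Om. u p \<in> Eb p) \<and> (\<forall>p. p \<notin> Om \<longrightarrow> u p = 0) \<and> (\<forall>c\<in>C. smooth_on (img c) (loc_rep c u))}"

primrec partial_deriv :: "(real ^ 'n::finite) set \<Rightarrow> 'n list \<Rightarrow> (real ^ 'n \<Rightarrow> 'b::real_normed_vector) \<Rightarrow> real ^ 'n \<Rightarrow> 'b" where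
  "partial_deriv S [] f = f"
| "partial_deriv S (i # is) f =
     (\<lambda>x. frechet_derivative (partial_deriv S is f) (at x within S) (axis i 1))"

text \<open>
  The classical Sobolev norm of integer order \<open>k\<close> of a smooth section, computed from finitely many
  compact sets, each inside a chart domain, that together cover the manifold; different choices
  give equivalent norms.
\<close>

definition chart_cover ::
  "'p::topological_space set \<Rightarrow> ('p, 'f, 'n::finite, 'r::finite) bchart set \<Rightarrow>
     (('p, 'f, 'n, 'r) bchart \<times> 'p set) set \<Rightarrow> bool" where
  "chart_cover Om C F \<longleftrightarrow> finite F \<and>
     (\<forall>(c, L)\<in>F. c \<in> C \<and> compact L \<and> L \<subseteq> dmn c) \<and> (\<Union>(c, L)\<in>F. L) = Om"

definition Hk_norm ::
  "(('p, 'f, 'n::finite, 'r::finite) bchart \<times> 'p set) set \<Rightarrow> nat \<Rightarrow> ('p \<Rightarrow> 'f) \<Rightarrow> real" where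
  "Hk_norm F k u = sqrt (\<Sum>(c, L)\<in>F. \<Sum>\<alpha>\<in>{\<alpha>. length \<alpha> \<le> k}.
     LINT x:crd c ` L|lborel. (norm (partial_deriv (img c) \<alpha> (loc_rep c u) x))\<^sup>2)"


section \<open>The scale of spaces\<close>

abbreviation scale_top :: "(real \<Rightarrow> 'd::real_vector set) \<Rightarrow> (real \<Rightarrow> 'd \<Rightarrow> real) \<Rightarrow> real \<Rightarrow> 'd topology" where
  "scale_top V nrm s \<equiv> Metric_space.mtopology (V s) (\<lambda>u v. nrm s (u - v))"

text \<open>
  The spaces \<open>V s\<close> are realized inside one vector space \<open>'d\<close> of generalized sections; \<open>emb\<close> is the
  inclusion of the smooth sections \<open>VV\<close>, and \<open>V s\<close> is the completion of \<open>VV\<close> under \<open>nrm s\<close>.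

  The norm \<open>nrm s\<close> is the one for which \<open>\<Lambda>\<^sup>s\<close> is isometric.  It is required to be
  a norm of the classical Sobolev space for \<open>s = 0, 1, 2, \<dots>\<close>.  On a manifold with boundary the
  Sobolev spaces of the remaining orders depend on conventions (interpolation, duality); no condition is
  imposed for these beyond those coming from \<open>\<Lambda>\<close> and the duality.

  The value of \<open>nrm s\<close> outside \<open>V s\<close> is irrelevant; it is fixed to \<open>0\<close> because the locale
  \<open>Metric_space\<close> wants a distance that is symmetric and nonnegative on the whole type.

  \<open>pr\<close> is the \<open>L\<^sup>2\<close> inner product and its extension to the duality between \<open>V s\<close> and \<open>V (- s)\<close>.
  \<open>Lam s\<close> is the power \<open>\<Lambda>\<^sup>s\<close>, and \<open>\<Lambda>\<close> itself is \<open>Lam 1\<close>.  As \<open>\<Lambda>\<close> has compact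
  inverse, its eigenvectors span, and \<open>Lam_eigen\<close> is the functional calculus.
\<close>

locale sobolev_scale = riemannian_bundle Om C G om vol Eb h
  for Om :: "'p::t2_space set"
    and C :: "('p, 'f::real_vector, 'n::finite, 'r::finite) bchart set"
    and G om vol Eb h +
  fixes VV :: "('p \<Rightarrow> 'f) set"
    and emb :: "('p \<Rightarrow> 'f) \<Rightarrow> 'd::real_vector"
    and V :: "real \<Rightarrow> 'd set"
    and nrm :: "real \<Rightarrow> 'd \<Rightarrow> real"
    and pr :: "'d \<Rightarrow> 'd \<Rightarrow> real"
    and Lam :: "real \<Rightarrow> 'd \<Rightarrow> 'd"
  assumes VV_sections: "VV \<subseteq> smooth_sections Om C Eb"
    and VV_zero: "(\<lambda>p. 0) \<in> VV"
    and VV_add: "\<lbrakk>u \<in> VV; v \<in> VV\<rbrakk> \<Longrightarrow> (\<lambda>p. u p + v p) \<in> VV"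
    and VV_scale: "u \<in> VV \<Longrightarrow> (\<lambda>p. a *\<^sub>R u p) \<in> VV"
    and emb_add: "\<lbrakk>u \<in> VV; v \<in> VV\<rbrakk> \<Longrightarrow> emb (\<lambda>p. u p + v p) = emb u + emb v"
    and emb_scale: "u \<in> VV \<Longrightarrow> emb (\<lambda>p. a *\<^sub>R u p) = a *\<^sub>R emb u"
    and V_subspace: "subspace (V s)"
    and nrm_nonneg: "x \<in> V s \<Longrightarrow> 0 \<le> nrm s x"
    and nrm_zero: "x \<in> V s \<Longrightarrow> nrm s x = 0 \<longleftrightarrow> x = 0"
    and nrm_outside: "x \<notin> V s \<Longrightarrow> nrm s x = 0"
    and nrm_triangle: "\<lbrakk>x \<in> V s; y \<in> V s\<rbrakk> \<Longrightarrow> nrm s (x + y) \<le> nrm s x + nrm s y"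
    and nrm_scale: "x \<in> V s \<Longrightarrow> nrm s (a *\<^sub>R x) = \<bar>a\<bar> * nrm s x"
    and V_complete: "Metric_space.mcomplete (V s) (\<lambda>u v. nrm s (u - v))"
    and VV_in_V: "emb ` VV \<subseteq> V s"
    and VV_dense: "scale_top V nrm s closure_of (emb ` VV) = V s"
    and V_mono: "s \<le> t \<Longrightarrow> V t \<subseteq> V s"
    and V_mono_bound: "s \<le> t \<Longrightarrow> \<exists>K. \<forall>x\<in>V t. nrm s x \<le> K * nrm t x"
    and nrm_Hk: "\<exists>F K. chart_cover Om C F \<and>
          (\<forall>u\<in>VV. nrm (real k) (emb u) \<le> K * Hk_norm F k u \<and> Hk_norm F k u \<le> K * nrm (real k) (emb u))"
    and pr_L2: "\<lbrakk>u \<in> VV; v \<in> VV\<rbrakk> \<Longrightarrow> pr (emb u) (emb v) = (LINT p|vol. h p (u p) (v p))"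
    and nrm_L2: "u \<in> VV \<Longrightarrow> (nrm 0 (emb u))\<^sup>2 = pr (emb u) (emb u)"
    and pr_lin1: "y \<in> V (- s) \<Longrightarrow> lin_on (V s) (\<lambda>x. pr x y)"
    and pr_lin2: "x \<in> V s \<Longrightarrow> lin_on (V (- s)) (\<lambda>y. pr x y)"
    and pr_bound: "\<exists>K. \<forall>u\<in>V s. \<forall>v\<in>V (- s). \<bar>pr u v\<bar> \<le> K * nrm s u * nrm (- s) v"
    and Lam_lin: "lin_on (V t) (Lam s)"
    and Lam_maps: "x \<in> V t \<Longrightarrow> Lam s x \<in> V (t - s)"
    and Lam_zero: "x \<in> V t \<Longrightarrow> Lam 0 x = x"
    and Lam_add: "x \<in> V t \<Longrightarrow> Lam (r + s) x = Lam r (Lam s x)"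
    and Lam_eigen: "\<lbrakk>x \<in> V 1; x \<noteq> 0; Lam 1 x = \<mu> *\<^sub>R x\<rbrakk> \<Longrightarrow> Lam s x = (\<mu> powr s) *\<^sub>R x"
    and Lam_isometry: "x \<in> V s \<Longrightarrow> nrm 0 (Lam s x) = nrm s x"
    and Lam_self_adjoint: "\<lbrakk>x \<in> V t; y \<in> V (s - t)\<rbrakk> \<Longrightarrow> pr (Lam s x) y = pr x (Lam s y)"
    and Lam_pos: "\<lbrakk>x \<in> V 1; x \<noteq> 0\<rbrakk> \<Longrightarrow> 0 < pr (Lam 1 x) x"
    and Lam_inverse_compact:
      "compactin (scale_top V nrm 0) (scale_top V nrm 0 closure_of (Lam (- 1) ` {u \<in> V 0. nrm 0 u \<le> 1}))"

lemma (in sobolev_scale) metric_V: "Metric_space (V s) (\<lambda>x y. nrm s (x - y))"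
proof
  fix x y
  show "0 \<le> nrm s (x - y)"
    by (cases "x - y \<in> V s") (auto simp: nrm_nonneg nrm_outside)
  show "nrm s (x - y) = nrm s (y - x)"
  proof (cases "x - y \<in> V s")
    case True
    then show ?thesis
      using nrm_scale[of "x - y" s "-1"] by simp
  next
    case False
    then have "y - x \<notin> V s"
      using subspace_neg[OF V_subspace, of "y - x" s] by auto
    with False show ?thesis
      by (simp add: nrm_outside)
  qed
next
  fix x y assume "x \<in> V s" "y \<in> V s"
  then show "nrm s (x - y) = 0 \<longleftrightarrow> x = y"
    by (simp add: nrm_zero subspace_diff[OF V_subspace])
next
  fix x y z assume "x \<in> V s" "y \<in> V s" "z \<in> V s"
  then show "nrm s (x - z) \<le> nrm s (x - y) + nrm s (y - z)"
    using nrm_triangle[of "x - y" s "y - z"] by (simp add: subspace_diff[OF V_subspace])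
qed

definition bounded_op ::
  "(real \<Rightarrow> 'd::real_vector set) \<Rightarrow> (real \<Rightarrow> 'd \<Rightarrow> real) \<Rightarrow> real \<Rightarrow> real \<Rightarrow> ('d \<Rightarrow> 'd) \<Rightarrow> bool" where
  "bounded_op V nrm s t T \<longleftrightarrow>
     T ` V s \<subseteq> V t \<and> lin_on (V s) T \<and> (\<exists>K. \<forall>u\<in>V s. nrm t (T u) \<le> K * nrm s u)"

definition bounded_trilinear ::
  "(real \<Rightarrow> 'd::real_vector set) \<Rightarrow> (real \<Rightarrow> 'd \<Rightarrow> real) \<Rightarrow> real \<Rightarrow> real \<Rightarrow> real \<Rightarrow>
     ('d \<Rightarrow> 'd \<Rightarrow> 'd \<Rightarrow> real) \<Rightarrow> bool" where
  "bounded_trilinear V nrm a b c f \<longleftrightarrow>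
     (\<forall>v\<in>V b. \<forall>w\<in>V c. lin_on (V a) (\<lambda>u. f u v w)) \<and>
     (\<forall>u\<in>V a. \<forall>w\<in>V c. lin_on (V b) (\<lambda>v. f u v w)) \<and>
     (\<forall>u\<in>V a. \<forall>v\<in>V b. lin_on (V c) (\<lambda>w. f u v w)) \<and>
     (\<exists>K. \<forall>u\<in>V a. \<forall>v\<in>V b. \<forall>w\<in>V c. \<bar>f u v w\<bar> \<le> K * nrm a u * nrm b v * nrm c w)"

text \<open>
  \<open>A0\<close>, \<open>M\<close>, \<open>N\<close> denote the operators on the smooth sections together with their extensions.
  Likewise \<open>b0\<close> denotes the trilinear form on the smooth sections together with its extensions: it is
  prescribed only on smooth sections, and \<open>bounded_trilinear V nrm a b c b0\<close> says that it extends
  boundedly to \<open>V a \<times> V b \<times> V c\<close>.  By density, extensions to different products agree where both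
  are defined, so one function can carry all of them.
\<close>

locale flow_model = sobolev_scale Om C G om vol Eb h VV emb V nrm pr Lam
  for Om :: "'p::t2_space set"
    and C :: "('p, 'f::real_vector, 'n::finite, 'r::finite) bchart set"
    and G om vol Eb h VV
    and emb :: "('p \<Rightarrow> 'f) \<Rightarrow> 'd::real_vector"
    and V nrm pr Lam +
  fixes \<theta>1 \<theta>2 :: real
    and A0 M N :: "'d \<Rightarrow> 'd"
    and Bbar :: "'d \<Rightarrow> 'd \<Rightarrow> 'd"
    and b0 :: "'d \<Rightarrow> 'd \<Rightarrow> 'd \<Rightarrow> real"
  assumes A0_VV: "A0 ` emb ` VV \<subseteq> emb ` VV"
    and M_VV: "M ` emb ` VV \<subseteq> emb ` VV"
    and N_VV: "N ` emb ` VV \<subseteq> emb ` VV"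
    and A0_bounded: "bounded_op V nrm s s A0"
    and M_bounded: "bounded_op V nrm s (s + 2 * \<theta>1) M"
    and N_bounded: "bounded_op V nrm s (s + 2 * \<theta>2) N"
    and A0_self_adjoint: "\<lbrakk>u \<in> V s; v \<in> V (- s)\<rbrakk> \<Longrightarrow> pr (A0 u) v = pr u (A0 v)"
    and N_self_adjoint: "\<lbrakk>u \<in> V s; v \<in> V (- s - 2 * \<theta>2)\<rbrakk> \<Longrightarrow> pr (N u) v = pr u (N v)"
    and N_coercive: "\<exists>cN>0. \<forall>v\<in>V (- \<theta>2). cN * (nrm (- \<theta>2) v)\<^sup>2 \<le> pr (N v) v"
    and Bbar_maps: "\<lbrakk>v \<in> emb ` VV; w \<in> emb ` VV\<rbrakk> \<Longrightarrow> Bbar v w \<in> emb ` VV"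
    and Bbar_lin1: "w \<in> emb ` VV \<Longrightarrow> lin_on (emb ` VV) (\<lambda>v. Bbar v w)"
    and Bbar_lin2: "v \<in> emb ` VV \<Longrightarrow> lin_on (emb ` VV) (\<lambda>w. Bbar v w)"
    and b0_VV: "\<lbrakk>u \<in> emb ` VV; v \<in> emb ` VV; w \<in> emb ` VV\<rbrakk> \<Longrightarrow>
          b0 u v w = pr (Bbar (M u) (N v)) w"


section \<open>Weak solutions\<close>

text \<open>
  The spaces are separable, so Borel measurability of a function on \<open>(0, T)\<close> is
  the same as strong measurability.
\<close>

definition vmeasurable ::
  "(real \<Rightarrow> 'd::real_vector set) \<Rightarrow> (real \<Rightarrow> 'd \<Rightarrow> real) \<Rightarrow> real \<Rightarrow> real \<Rightarrow> (real \<Rightarrow> 'd) \<Rightarrow> bool" where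
  "vmeasurable V nrm T s u \<longleftrightarrow> u ` {0<..<T} \<subseteq> V s \<and>
     (\<forall>U. openin (scale_top V nrm s) U \<longrightarrow> {t \<in> {0<..<T}. u t \<in> U} \<in> sets lebesgue)"

definition in_Linf ::
  "(real \<Rightarrow> 'd::real_vector set) \<Rightarrow> (real \<Rightarrow> 'd \<Rightarrow> real) \<Rightarrow> real \<Rightarrow> real \<Rightarrow> (real \<Rightarrow> 'd) \<Rightarrow> bool" where
  "in_Linf V nrm T s u \<longleftrightarrow> vmeasurable V nrm T s u \<and>
     (\<exists>K. AE t in lebesgue_on {0<..<T}. nrm s (u t) \<le> K)"

definition in_Lp ::
  "(real \<Rightarrow> 'd::real_vector set) \<Rightarrow> (real \<Rightarrow> 'd \<Rightarrow> real) \<Rightarrow> real \<Rightarrow> real \<Rightarrow> real \<Rightarrow> (real \<Rightarrow> 'd) \<Rightarrow> bool" where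
  "in_Lp V nrm T p s u \<longleftrightarrow> vmeasurable V nrm T s u \<and>
     integrable (lebesgue_on {0<..<T}) (\<lambda>t. nrm s (u t) powr p)"

text \<open>
  Test functions on \<open>(0, T)\<close> with values in the smooth sections \<open>D\<close>: \<open>W k\<close> is the \<open>k\<close>-th
  derivative of the test function \<open>W 0\<close>.  Derivatives are taken in all the norms \<open>nrm s\<close>, which, by
  Sobolev embedding, generate the topology induced from the space of all smooth sections.
\<close>

definition test_function ::
  "(real \<Rightarrow> 'd::real_vector \<Rightarrow> real) \<Rightarrow> 'd set \<Rightarrow> real \<Rightarrow> (nat \<Rightarrow> real \<Rightarrow> 'd) \<Rightarrow> bool" where
  "test_function nrm D T W \<longleftrightarrow>
     (\<forall>k t. W k t \<in> D) \<and>
     (\<exists>a b. 0 < a \<and> b < T \<and> (\<forall>k t. t \<notin> {a..b} \<longrightarrow> W k t = 0)) \<and>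
     (\<forall>k s t. ((\<lambda>\<tau>. nrm s ((W k (t + \<tau>) - W k t) /\<^sub>R \<tau> - W (Suc k) t)) \<longlongrightarrow> 0) (at 0))"

definition weak_derivative ::
  "(real \<Rightarrow> 'd::real_vector \<Rightarrow> real) \<Rightarrow> ('d \<Rightarrow> 'd \<Rightarrow> real) \<Rightarrow> 'd set \<Rightarrow> real \<Rightarrow>
     (real \<Rightarrow> 'd) \<Rightarrow> (real \<Rightarrow> 'd) \<Rightarrow> bool" where
  "weak_derivative nrm pr D T u u' \<longleftrightarrow> (\<forall>W. test_function nrm D T W \<longrightarrow>
     (LINT t|lebesgue_on {0<..<T}. pr (u t) (W 1 t)) =
     - (LINT t|lebesgue_on {0<..<T}. pr (u' t) (W 0 t)))"

text \<open>
  A function in \<open>L\<^sup>\<infinity>(0, T; V (- \<theta>2))\<close> with derivative in \<open>L\<^sup>p(0, T; V (- \<gamma>))\<close> has a representative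
  that is continuous into the larger of \<open>V (- \<theta>2)\<close> and \<open>V (- \<gamma>)\<close>.  The initial condition refers
  to this representative, and weak solutions are taken to be given by it.
\<close>

definition weak_solution ::
  "(real \<Rightarrow> 'd::real_vector set) \<Rightarrow> (real \<Rightarrow> 'd \<Rightarrow> real) \<Rightarrow> ('d \<Rightarrow> 'd \<Rightarrow> real) \<Rightarrow> 'd set \<Rightarrow> real \<Rightarrow>
     ('d \<Rightarrow> 'd) \<Rightarrow> ('d \<Rightarrow> 'd \<Rightarrow> 'd \<Rightarrow> real) \<Rightarrow> 'd \<Rightarrow> real \<Rightarrow> 'd \<Rightarrow> (real \<Rightarrow> 'd) \<Rightarrow> bool" where
  "weak_solution V nrm pr D \<theta>2 A0 b0 g T u0 u \<longleftrightarrow>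
     u0 \<in> V (- \<theta>2) \<and>
     in_Linf V nrm T (- \<theta>2) u \<and>
     (\<exists>p>1. \<exists>\<gamma>\<ge>0. \<exists>u'. in_Lp V nrm T p (- \<gamma>) u' \<and> weak_derivative nrm pr D T u u' \<and>
        continuous_map (top_of_set {0..T}) (scale_top V nrm (- max \<theta>2 \<gamma>)) u) \<and>
     u 0 = u0 \<and>
     (\<forall>W. test_function nrm D T W \<longrightarrow>
        (LINT t|lebesgue_on {0<..<T}.
           - pr (u t) (W 1 t) + pr (A0 (u t)) (W 0 t) + b0 (u t) (u t) (W 0 t)) =
        (LINT t|lebesgue_on {0<..<T}. pr g (W 0 t)))"

text \<open>
  Uniqueness of weak solutions, which makes \<open>S\<close> the only such semigroup, is not part of the definition.
\<close>

definition solution_semigroup ::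
  "(real \<Rightarrow> 'd::real_vector set) \<Rightarrow> (real \<Rightarrow> 'd \<Rightarrow> real) \<Rightarrow> ('d \<Rightarrow> 'd \<Rightarrow> real) \<Rightarrow> 'd set \<Rightarrow> real \<Rightarrow>
     ('d \<Rightarrow> 'd) \<Rightarrow> ('d \<Rightarrow> 'd \<Rightarrow> 'd \<Rightarrow> real) \<Rightarrow> 'd \<Rightarrow> (real \<Rightarrow> 'd \<Rightarrow> 'd) \<Rightarrow> bool" where
  "solution_semigroup V nrm pr D \<theta>2 A0 b0 g S \<longleftrightarrow>
     (\<forall>x\<in>V (- \<theta>2). S 0 x = x) \<and>
     (\<forall>s\<ge>0. \<forall>t\<ge>0. \<forall>x\<in>V (- \<theta>2). S (s + t) x = S s (S t x)) \<and>
     (\<forall>t\<ge>0. continuous_map (scale_top V nrm (- \<theta>2)) (scale_top V nrm (- \<theta>2)) (S t)) \<and>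
     (\<forall>x\<in>V (- \<theta>2). continuous_map (top_of_set {0..}) (scale_top V nrm (- \<theta>2)) (\<lambda>t. S t x)) \<and>
     (\<forall>x\<in>V (- \<theta>2). \<forall>T>0. weak_solution V nrm pr D \<theta>2 A0 b0 g T x (\<lambda>t. S t x))"


section \<open>Attractors and fractal dimension\<close>

definition bounded_in ::
  "(real \<Rightarrow> 'd::real_vector set) \<Rightarrow> (real \<Rightarrow> 'd \<Rightarrow> real) \<Rightarrow> real \<Rightarrow> 'd set \<Rightarrow> bool" where
  "bounded_in V nrm s B \<longleftrightarrow> B \<subseteq> V s \<and> (\<exists>R. \<forall>x\<in>B. nrm s x \<le> R)"

definition global_attractor ::
  "(real \<Rightarrow> 'd::real_vector set) \<Rightarrow> (real \<Rightarrow> 'd \<Rightarrow> real) \<Rightarrow> real \<Rightarrow> (real \<Rightarrow> 'd \<Rightarrow> 'd) \<Rightarrow> 'd set \<Rightarrow> bool" where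
  "global_attractor V nrm s S A \<longleftrightarrow>
     compactin (scale_top V nrm s) A \<and>
     (\<forall>t\<ge>0. S t ` A = A) \<and>
     (\<forall>B. bounded_in V nrm s B \<longrightarrow>
        (\<forall>\<epsilon>>0. \<exists>t0\<ge>0. \<forall>t\<ge>t0. \<forall>x\<in>B. \<exists>a\<in>A. nrm s (S t x - a) < \<epsilon>))"

definition finite_ball_cover ::
  "(real \<Rightarrow> 'd::real_vector set) \<Rightarrow> (real \<Rightarrow> 'd \<Rightarrow> real) \<Rightarrow> real \<Rightarrow> 'd set \<Rightarrow> real \<Rightarrow> nat \<Rightarrow> bool" where
  "finite_ball_cover V nrm s A \<epsilon> m \<longleftrightarrow>
     (\<exists>F \<subseteq> V s. finite F \<and> card F = m \<and> (\<forall>x\<in>A. \<exists>y\<in>F. nrm s (x - y) \<le> \<epsilon>))"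

text \<open>
  The fractal (upper box-counting) dimension in \<open>V s\<close>, that is, the limit superior of
  \<open>ln N(\<epsilon>) / ln (1/\<epsilon>)\<close> as \<open>\<epsilon>\<close> tends to \<open>0\<close>, where \<open>N(\<epsilon>)\<close> is the least number of balls of radius
  \<open>\<epsilon>\<close> needed to cover \<open>A\<close>.
\<close>

definition fractal_dim ::
  "(real \<Rightarrow> 'd::real_vector set) \<Rightarrow> (real \<Rightarrow> 'd \<Rightarrow> real) \<Rightarrow> real \<Rightarrow> 'd set \<Rightarrow> ereal" where
  "fractal_dim V nrm s A = Limsup (at_right 0) (\<lambda>\<epsilon>.
     if \<exists>m. finite_ball_cover V nrm s A \<epsilon> m
     then ereal (ln (real (LEAST m. finite_ball_cover V nrm s A \<epsilon> m)) / ln (1 / \<epsilon>))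
     else \<infinity>)"

end

theory Submission
  imports Defs
begin

text \<open>
  Write \<open>\<alpha> = - \<theta>2\<close>.  Since \<open>b0\<close> is bounded on \<open>V \<alpha> \<times> V \<alpha> \<times> V (- \<beta>)\<close>, the
  Riesz theorem turns the nonlinearity into a locally Lipschitz map \<open>V \<alpha> \<rightarrow> V \<beta>\<close>, and so is
  \<open>F u = g - B(u, u)\<close> (\<open>forcing\<close>).  As \<open>A0\<close> is bounded on every \<open>V s\<close>, the equation is
  the ordinary differential equation \<open>u' = - A0 u + F u\<close> in \<open>V \<alpha>\<close>, whose forcing is better by
  \<open>\<beta> - \<alpha>\<close> derivatives than its solution.  Coercivity of \<open>A0\<close> makes \<open>exp (- t A0)\<close>
  decay exponentially on \<open>V \<alpha>\<close> (in the norm \<open>sqrt \<langle>N v, v\<rangle>\<close>) and on \<open>V \<beta>\<close>, so in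
  Duhamel's formula
  \<open>u T = exp (- T A0) (u 0) + \<integral> exp (- (T - s) A0) (F (u s)) ds\<close>
  the first term is small in \<open>V \<alpha>\<close> for large \<open>T\<close>, and the second is bounded in
  \<open>V \<beta>\<close> independently of \<open>T\<close>.  This is the content of \<open>splitting\<close>.

  Every point of the attractor is \<open>S T y\<close> with \<open>y\<close> in the attractor and \<open>T\<close> arbitrarily
  large.  By \<open>splitting\<close> it is a limit in \<open>V \<alpha>\<close> of points of a fixed ball of \<open>V \<beta>\<close>, and such
  a ball is closed in \<open>V \<alpha>\<close> by duality (\<open>in_V_if_dual_bound\<close>).  So the attractor
  is bounded in \<open>V \<beta>\<close>.

  The difference \<open>w\<close> of two trajectories on the attractor solves the same linear
  equation with forcing \<open>F u - F v\<close>, of size at most a constant times \<open>w\<close>.  Hence, for a suitable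
  \<open>T\<close> and a constant \<open>K\<close>, the difference \<open>S T x - S T y\<close> is the sum of a part of size at most
  \<open>\<parallel>x - y\<parallel> / 8\<close> in \<open>V \<alpha>\<close> and a part of size at most \<open>K \<parallel>x - y\<parallel>\<close> in \<open>V \<beta>\<close>
  (\<open>smoothing_difference\<close>).  The unit ball of
  \<open>V \<beta>\<close> is totally bounded in \<open>V \<alpha>\<close> (\<open>unit_ball_net\<close>).  So \<open>S T\<close> maps the
  intersection of the attractor with a ball of radius \<open>r\<close> into boundedly many balls of
  radius \<open>r/2\<close>; as \<open>S T\<close> maps the attractor onto itself, iteration bounds its box-counting
  dimension (\<open>fractal_dim_finite_if_smoothing\<close>).

  Vector-valued integrals and operator exponentials are avoided throughout: equations are tested
  against \<open>D\<close>, integrals of elements of \<open>V \<beta>\<close> are obtained from the Riesz theorem, and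
  \<open>exp (- t A0)\<close> is replaced by the Euler powers \<open>(1 - \<delta> A0)\<^sup>k\<close>.
\<close>


section \<open>Semi-inner products on a subspace\<close>

locale semi_inner =
  fixes X :: "'a::real_vector set" and ip :: "'a \<Rightarrow> 'a \<Rightarrow> real"
  assumes sub: "subspace X"
    and sym: "\<lbrakk>x \<in> X; y \<in> X\<rbrakk> \<Longrightarrow> ip x y = ip y x"
    and lin: "y \<in> X \<Longrightarrow> lin_on X (\<lambda>x. ip x y)"
    and nonneg: "x \<in> X \<Longrightarrow> 0 \<le> ip x x"
begin

lemma add: "\<lbrakk>x \<in> X; y \<in> X; z \<in> X\<rbrakk> \<Longrightarrow> ip (x + y) z = ip x z + ip y z"
  using lin[of z] by (auto simp: lin_on_def)

lemma scale: "\<lbrakk>x \<in> X; z \<in> X\<rbrakk> \<Longrightarrow> ip (a *\<^sub>R x) z = a * ip x z"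
  using lin[of z] by (auto simp: lin_on_def)

lemma in_X: "\<lbrakk>x \<in> X; y \<in> X\<rbrakk> \<Longrightarrow> x + a *\<^sub>R y \<in> X"
  by (simp add: sub subspace_add subspace_scale)

lemma square_expand:
  assumes "x \<in> X" "y \<in> X"
  shows "ip (x + a *\<^sub>R y) (x + a *\<^sub>R y) = ip x x + 2 * a * ip x y + a\<^sup>2 * ip y y"
proof -
  have ay: "a *\<^sub>R y \<in> X" and s: "x + a *\<^sub>R y \<in> X"
    using assms by (auto simp: sub subspace_scale in_X)
  have "ip (x + a *\<^sub>R y) (x + a *\<^sub>R y) = ip x (x + a *\<^sub>R y) + a * ip y (x + a *\<^sub>R y)"
    using add[OF assms(1) ay s] scale[OF assms(2) s] by simp
  also have "ip x (x + a *\<^sub>R y) = ip x x + a * ip y x"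
    using sym[OF assms(1) s] add[OF assms(1) ay assms(1)] scale[OF assms(2) assms(1)] by simp
  also have "ip y (x + a *\<^sub>R y) = ip x y + a * ip y y"
    using sym[OF assms(2) s] add[OF assms(1) ay assms(2)] scale[OF assms(2) assms(2)] by simp
  finally show ?thesis using sym[OF assms] by (simp add: power2_eq_square algebra_simps)
qed

lemma Cauchy_Schwarz:
  assumes "x \<in> X" "y \<in> X"
  shows "\<bar>ip x y\<bar> \<le> sqrt (ip x x) * sqrt (ip y y)"
proof -
  have q: "0 \<le> ip x x + 2 * a * ip x y + a\<^sup>2 * ip y y" for a
    using square_expand[OF assms, of a] nonneg[OF in_X[OF assms], of a] by simp
  have "(ip x y)\<^sup>2 \<le> ip x x * ip y y"
  proof (cases "ip y y = 0")
    case False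
    then have p: "ip y y > 0" using nonneg[OF assms(2)] by simp
    have "0 \<le> ip x x - (ip x y)\<^sup>2 / ip y y"
      using q[of "- ip x y / ip y y"] p by (simp add: field_simps power2_eq_square)
    then show ?thesis using p by (simp add: field_simps)
  next
    case True
    \<comment> \<open>a nonnegative affine function of \<open>a\<close> has slope zero\<close>
    have "ip x y = 0"
    proof (rule ccontr)
      assume "ip x y \<noteq> 0"
      then show False
        using q[of "- (ip x x + 1) / (2 * ip x y)"] True by (simp add: field_simps)
    qed
    then show ?thesis by (simp add: True)
  qed
  then have "sqrt ((ip x y)\<^sup>2) \<le> sqrt (ip x x * ip y y)" by (rule real_sqrt_le_mono)
  then show ?thesis by (simp add: real_sqrt_mult)
qed

lemma sqrt_triangle:
  assumes "x \<in> X" "y \<in> X"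
  shows "sqrt (ip (x + y) (x + y)) \<le> sqrt (ip x x) + sqrt (ip y y)"
proof (rule real_le_lsqrt)
  have "ip (x + y) (x + y) = ip x x + 2 * ip x y + ip y y"
    using square_expand[OF assms, of 1] by simp
  also have "\<dots> \<le> ip x x + 2 * (sqrt (ip x x) * sqrt (ip y y)) + ip y y"
    using Cauchy_Schwarz[OF assms] by linarith
  also have "\<dots> = (sqrt (ip x x) + sqrt (ip y y))\<^sup>2"
    using nonneg assms by (simp add: power2_sum)
  finally show "ip (x + y) (x + y) \<le> (sqrt (ip x x) + sqrt (ip y y))\<^sup>2" .
qed (use nonneg assms in auto)

text \<open>
  An explicit Euler step for \<open>x' = - A x\<close> decreases the form at the rate that coercivity gives to the
  exact flow, up to the quadratic term \<open>h\<^sup>2 ip (A x) (A x)\<close>; boundedness of \<open>A\<close> lets a small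
  \<open>h\<close> absorb that term into half of the gain.
\<close>

lemma Euler_contraction:
  assumes "\<And>x. x \<in> X \<Longrightarrow> A x \<in> X"
    and "c > 0" and co: "\<And>x. x \<in> X \<Longrightarrow> c * ip x x \<le> ip x (A x)"
    and bd: "\<And>x. x \<in> X \<Longrightarrow> ip (A x) (A x) \<le> K * ip x x"
  shows "\<exists>h0>0. \<forall>h. 0 < h \<and> h \<le> h0 \<longrightarrow> h * c \<le> 1 \<and>
    (\<forall>x\<in>X. sqrt (ip (x - h *\<^sub>R A x) (x - h *\<^sub>R A x)) \<le> (1 - h * (c / 2)) * sqrt (ip x x))"
proof (intro exI[of _ "min (1 / c) (c / (\<bar>K\<bar> + 1))"] conjI allI impI ballI)
  show "0 < min (1 / c) (c / (\<bar>K\<bar> + 1))" using assms(2) by simp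
next
  fix h assume h: "0 < h \<and> h \<le> min (1 / c) (c / (\<bar>K\<bar> + 1))"
  then show hc: "h * c \<le> 1" using assms(2) by (simp add: field_simps)
  have hK: "h * K \<le> c"
  proof -
    have "h * (\<bar>K\<bar> + 1) \<le> c" using h by (simp add: field_simps)
    moreover have "h * K \<le> h * (\<bar>K\<bar> + 1)" using h by (intro mult_left_mono) auto
    ultimately show ?thesis by simp
  qed
  fix x assume x: "x \<in> X"
  let ?q = "ip x x"
  have q: "?q \<ge> 0" using nonneg x by simp
  have "ip (x - h *\<^sub>R A x) (x - h *\<^sub>R A x) = ?q - 2 * h * ip x (A x) + h\<^sup>2 * ip (A x) (A x)"
    using square_expand[OF x assms(1)[OF x], of "- h"] by simp
  also have "\<dots> \<le> ?q - 2 * h * (c * ?q) + h\<^sup>2 * (K * ?q)"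
    using h co[OF x] bd[OF x] by (intro add_mono diff_mono mult_left_mono) auto
  also have "\<dots> = ?q - 2 * h * (c * ?q) + (h * K) * (h * ?q)"
    by (simp add: power2_eq_square)
  also have "\<dots> \<le> ?q - 2 * h * (c * ?q) + c * (h * ?q)"
    using hK h q by (intro add_mono mult_right_mono) auto
  also have "\<dots> = (1 - h * c) * ?q" by (simp add: algebra_simps)
  \<comment> \<open>\<open>1 - h c \<le> (1 - h c / 2)\<^sup>2\<close>, so that the square root can be taken\<close>
  also have "\<dots> \<le> (1 - h * (c / 2))\<^sup>2 * ?q"
    using q h assms(2) by (intro mult_right_mono) (auto simp: power2_eq_square algebra_simps)
  finally have "sqrt (ip (x - h *\<^sub>R A x) (x - h *\<^sub>R A x)) \<le> sqrt ((1 - h * (c / 2))\<^sup>2 * ?q)"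
    by (rule real_sqrt_le_mono)
  moreover have "0 \<le> 1 - h * (c / 2)" using hc h assms(2) by (simp add: field_simps)
  ultimately show "sqrt (ip (x - h *\<^sub>R A x) (x - h *\<^sub>R A x)) \<le> (1 - h * (c / 2)) * sqrt ?q"
    by (simp add: real_sqrt_mult)
qed

end


section \<open>Norms and the duality pairing\<close>

context sobolev_scale
begin

abbreviation D :: "'d set" where "D \<equiv> emb ` VV"

lemma D_add: "\<lbrakk>x \<in> D; y \<in> D\<rbrakk> \<Longrightarrow> x + y \<in> D"
  using VV_add emb_add by (auto simp: image_iff) metis

lemma D_scale: "x \<in> D \<Longrightarrow> a *\<^sub>R x \<in> D"
  using VV_scale emb_scale by (auto simp: image_iff) metis

lemma subspace_D: "subspace D"
proof (rule subspaceI)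
  have "emb (\<lambda>p. 0) \<in> D" using VV_zero by blast
  then show "0 \<in> D" using D_scale[of _ 0] by force
qed (auto intro: D_add D_scale)

lemma D_in_V: "x \<in> D \<Longrightarrow> x \<in> V s"
  using VV_in_V by blast

lemma V_add: "\<lbrakk>x \<in> V s; y \<in> V s\<rbrakk> \<Longrightarrow> x + y \<in> V s"
  and V_diff: "\<lbrakk>x \<in> V s; y \<in> V s\<rbrakk> \<Longrightarrow> x - y \<in> V s"
  and V_scale: "x \<in> V s \<Longrightarrow> a *\<^sub>R x \<in> V s"
  and V_0: "0 \<in> V s"
  using V_subspace[of s] by (simp_all add: subspace_add subspace_diff subspace_scale subspace_0)

lemma nrm_ge_0: "0 \<le> nrm s x"
  by (cases "x \<in> V s") (auto simp: nrm_nonneg nrm_outside)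

lemma nrm_0: "nrm s 0 = 0"
  using nrm_zero[OF V_0] by simp

lemma nrm_minus_commute: "nrm s (x - y) = nrm s (y - x)"
  using Metric_space.commute[OF metric_V] .

lemma nrm_le_add: "\<lbrakk>x \<in> V s; y \<in> V s\<rbrakk> \<Longrightarrow> nrm s x \<le> nrm s y + nrm s (x - y)"
  using nrm_triangle[of y s "x - y"] by (simp add: V_diff)

lemma nrm_diff_le: "\<lbrakk>x \<in> V s; y \<in> V s\<rbrakk> \<Longrightarrow> nrm s (x - y) \<le> nrm s x + nrm s y"
  using nrm_triangle[of x s "- y"] nrm_scale[of y s "-1"] V_scale[of y s "-1"] by simp

lemma nrm_diff_triangle:
  "\<lbrakk>x \<in> V s; y \<in> V s; z \<in> V s\<rbrakk> \<Longrightarrow> nrm s (x - z) \<le> nrm s (x - y) + nrm s (y - z)"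
  using Metric_space.triangle[OF metric_V] .

lemma approx_D:
  assumes "x \<in> V s" "e > 0"
  shows "\<exists>d\<in>D. nrm s (x - d) < e"
proof -
  interpret Metric_space "V s" "\<lambda>x y. nrm s (x - y)" by (rule metric_V)
  have "x \<in> mtopology closure_of D" using VV_dense assms by simp
  then obtain y where "y \<in> D" "y \<in> mball x e"
    unfolding metric_closure_of using assms by blast
  then show ?thesis by (auto simp: in_mball)
qed

lemma pr_add_left: "\<lbrakk>x \<in> V s; x' \<in> V s; y \<in> V (- s)\<rbrakk> \<Longrightarrow> pr (x + x') y = pr x y + pr x' y"
  using pr_lin1[of y s] by (auto simp: lin_on_def)

lemma pr_scale_left: "\<lbrakk>x \<in> V s; y \<in> V (- s)\<rbrakk> \<Longrightarrow> pr (a *\<^sub>R x) y = a * pr x y"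
  using pr_lin1[of y s] by (auto simp: lin_on_def)

lemma pr_diff_left: "\<lbrakk>x \<in> V s; x' \<in> V s; y \<in> V (- s)\<rbrakk> \<Longrightarrow> pr (x - x') y = pr x y - pr x' y"
  using pr_add_left[of "x - x'" s x' y] by (simp add: V_diff)

lemma pr_add_right: "\<lbrakk>x \<in> V s; y \<in> V (- s); y' \<in> V (- s)\<rbrakk> \<Longrightarrow> pr x (y + y') = pr x y + pr x y'"
  using pr_lin2[of x s] by (auto simp: lin_on_def)

lemma pr_scale_right: "\<lbrakk>x \<in> V s; y \<in> V (- s)\<rbrakk> \<Longrightarrow> pr x (a *\<^sub>R y) = a * pr x y"
  using pr_lin2[of x s] by (auto simp: lin_on_def)

lemma pr_diff_right: "\<lbrakk>x \<in> V s; y \<in> V (- s); y' \<in> V (- s)\<rbrakk> \<Longrightarrow> pr x (y - y') = pr x y - pr x y'"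
  using pr_add_right[of x s "y - y'" y'] by (simp add: V_diff)

text \<open>
  A provisional constant for the pairing, which makes it continuous.  Continuity is what transfers
  identities from \<open>D\<close> to the whole scale, and these in turn yield the constant \<open>1\<close> in \<open>pr_le\<close>.
\<close>

lemma pr_const: obtains K where "K \<ge> 0" "\<And>u v. \<lbrakk>u \<in> V s; v \<in> V (- s)\<rbrakk> \<Longrightarrow> \<bar>pr u v\<bar> \<le> K * nrm s u * nrm (- s) v"
proof -
  obtain K where K: "\<forall>u\<in>V s. \<forall>v\<in>V (- s). \<bar>pr u v\<bar> \<le> K * nrm s u * nrm (- s) v"
    using pr_bound[of s] by blast
  show ?thesis
  proof (rule that[of "\<bar>K\<bar>"])
    fix u v assume uv: "u \<in> V s" "v \<in> V (- s)"
    have "K * (nrm s u * nrm (- s) v) \<le> \<bar>K\<bar> * (nrm s u * nrm (- s) v)"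
      by (intro mult_right_mono mult_nonneg_nonneg nrm_ge_0) auto
    then show "\<bar>pr u v\<bar> \<le> \<bar>K\<bar> * nrm s u * nrm (- s) v" using K uv by (fastforce simp: mult.assoc)
  qed simp
qed

lemma approx_seq:
  assumes "x \<in> V s"
  obtains d where "\<And>n. d n \<in> D" "(\<lambda>n. nrm s (x - d n)) \<longlonglongrightarrow> 0"
proof -
  have "\<exists>d. \<forall>n. d n \<in> D \<and> nrm s (x - d n) < inverse (real (Suc n))"
    using approx_D[OF assms] by (intro choice) (metis inverse_positive_iff_positive of_nat_0_less_iff zero_less_Suc)
  then obtain d where d: "\<And>n. d n \<in> D" "\<And>n. nrm s (x - d n) < inverse (real (Suc n))" by blast
  have "(\<lambda>n. nrm s (x - d n)) \<longlonglongrightarrow> 0"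
    by (rule tendsto_sandwich[OF _ _ tendsto_const LIMSEQ_inverse_real_of_nat])
       (use d nrm_ge_0 in \<open>auto intro!: always_eventually less_imp_le\<close>)
  then show ?thesis using that d by blast
qed

lemma nrm_tendsto:
  assumes "x \<in> V s" "\<And>n. d n \<in> V s" "(\<lambda>n. nrm s (x - d n)) \<longlonglongrightarrow> 0"
  shows "(\<lambda>n. nrm s (d n)) \<longlonglongrightarrow> nrm s x"
proof (rule LIM_zero_cancel, rule Lim_null_comparison[OF _ assms(3)], rule always_eventually, rule allI)
  fix n
  show "norm (nrm s (d n) - nrm s x) \<le> nrm s (x - d n)"
    using nrm_le_add[OF assms(1,2), of n] nrm_le_add[OF assms(2,1), of n] nrm_minus_commute[of s x "d n"]
    by (simp add: abs_le_iff)
qed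

lemma pr_tendsto:
  assumes x: "x \<in> V s" "\<And>n. d n \<in> V s" "(\<lambda>n. nrm s (x - d n)) \<longlonglongrightarrow> 0"
    and y: "y \<in> V (- s)" "\<And>n. e n \<in> V (- s)" "(\<lambda>n. nrm (- s) (y - e n)) \<longlonglongrightarrow> 0"
  shows "(\<lambda>n. pr (d n) (e n)) \<longlonglongrightarrow> pr x y"
proof -
  obtain K where K: "K \<ge> 0" "\<And>u v. \<lbrakk>u \<in> V s; v \<in> V (- s)\<rbrakk> \<Longrightarrow> \<bar>pr u v\<bar> \<le> K * nrm s u * nrm (- s) v"
    using pr_const by blast
  have "(\<lambda>n. K * nrm s (x - d n) * nrm (- s) (e n) + K * nrm s x * nrm (- s) (y - e n)) \<longlonglongrightarrow>
      K * 0 * nrm (- s) y + K * nrm s x * 0"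
    by (intro tendsto_intros x y nrm_tendsto)
  then have l: "(\<lambda>n. K * nrm s (x - d n) * nrm (- s) (e n) + K * nrm s x * nrm (- s) (y - e n)) \<longlonglongrightarrow> 0"
    by simp
  show ?thesis
  proof (rule LIM_zero_cancel, rule Lim_null_comparison[OF _ l], rule always_eventually, rule allI)
    fix n
    have "pr x y - pr (d n) (e n) = pr (x - d n) (e n) + pr x (y - e n)"
      using x y by (simp add: pr_diff_left pr_diff_right)
    then show "norm (pr (d n) (e n) - pr x y)
        \<le> K * nrm s (x - d n) * nrm (- s) (e n) + K * nrm s x * nrm (- s) (y - e n)"
      using K(2)[of "x - d n" "e n"] K(2)[of x "y - e n"] x y by (simp add: V_diff)
  qed
qed

lemma space_vol: "space vol = Om"
  using sets_eq_imp_space_eq[OF sets_vol] by (simp add: space_restrict_space)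

lemma pr_sym:
  assumes "x \<in> V s" "y \<in> V (- s)"
  shows "pr x y = pr y x"
proof -
  obtain d where d: "\<And>n. d n \<in> D" "(\<lambda>n. nrm s (x - d n)) \<longlonglongrightarrow> 0" using approx_seq assms by blast
  obtain e where e: "\<And>n. e n \<in> D" "(\<lambda>n. nrm (- s) (y - e n)) \<longlonglongrightarrow> 0" using approx_seq assms by blast
  have D: "pr a b = pr b a" if ab: "a \<in> D" "b \<in> D" for a b
  proof -
    obtain u v where uv: "u \<in> VV" "v \<in> VV" "a = emb u" "b = emb v" using ab by blast
    have "(LINT p|vol. h p (u p) (v p)) = (LINT p|vol. h p (v p) (u p))"
      using uv VV_sections by (intro Bochner_Integration.integral_cong) (auto simp: space_vol smooth_sections_def intro!: h_sym)
    then show ?thesis by (simp add: uv pr_L2)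
  qed
  have "(\<lambda>n. pr (d n) (e n)) \<longlonglongrightarrow> pr x y"
    by (intro pr_tendsto[where s=s] assms d e D_in_V)
  moreover have "(\<lambda>n. pr (e n) (d n)) \<longlonglongrightarrow> pr y x"
    by (intro pr_tendsto[where s="-s"]) (use assms d e D_in_V in auto)
  ultimately show ?thesis using D d e by (simp add: LIMSEQ_unique)
qed

lemma pr_self: assumes "x \<in> V 0" shows "pr x x = (nrm 0 x)\<^sup>2"
proof -
  obtain d where d: "\<And>n. d n \<in> D" "(\<lambda>n. nrm 0 (x - d n)) \<longlonglongrightarrow> 0" using approx_seq assms by blast
  have "(\<lambda>n. pr (d n) (d n)) \<longlonglongrightarrow> pr x x"
    by (intro pr_tendsto[where s=0]) (use assms d D_in_V in auto)
  moreover have "(\<lambda>n. (nrm 0 (d n))\<^sup>2) \<longlonglongrightarrow> (nrm 0 x)\<^sup>2"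
    by (intro tendsto_intros nrm_tendsto) (use assms d D_in_V in auto)
  moreover have "pr (d n) (d n) = (nrm 0 (d n))\<^sup>2" for n
    using d(1)[of n] nrm_L2 by auto
  ultimately show ?thesis by (simp add: LIMSEQ_unique)
qed

lemma semi_inner_L2: "semi_inner (V 0) pr"
proof
  show "lin_on (V 0) (\<lambda>x. pr x y)" if "y \<in> V 0" for y using pr_lin1[of y 0] that by simp
qed (use V_subspace pr_sym[of _ 0] in \<open>auto simp: pr_self\<close>)

lemma Lam_in: "x \<in> V t \<Longrightarrow> t - s = r \<Longrightarrow> Lam s x \<in> V r"
  using Lam_maps by blast

lemma Lam_comp: "x \<in> V t \<Longrightarrow> Lam r (Lam s x) = Lam (r + s) x"
  using Lam_add by simp

lemma nrm_Lam: assumes "x \<in> V t" shows "nrm (t - s) (Lam s x) = nrm t x"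
proof -
  have "nrm (t - s) (Lam s x) = nrm 0 (Lam (t - s) (Lam s x))"
    by (rule Lam_isometry[symmetric]) (rule Lam_maps[OF assms])
  also have "\<dots> = nrm t x" using Lam_comp[OF assms] Lam_isometry[OF assms] by simp
  finally show ?thesis .
qed

lemma Lam_diff: "\<lbrakk>x \<in> V t; y \<in> V t\<rbrakk> \<Longrightarrow> Lam s (x - y) = Lam s x - Lam s y"
proof -
  assume a: "x \<in> V t" "y \<in> V t"
  have "Lam s ((x - y) + y) = Lam s (x - y) + Lam s y"
    using Lam_lin[of t s] a V_diff[OF a] unfolding lin_on_def by blast
  then show ?thesis by simp
qed

lemma pr_Lam_Lam:
  assumes "x \<in> V s" "y \<in> V t"
  shows "pr (Lam s x) (Lam t y) = pr x (Lam (s + t) y)"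
proof -
  have "pr (Lam s x) (Lam t y) = pr x (Lam s (Lam t y))"
    by (rule Lam_self_adjoint[OF assms(1)]) (rule Lam_in[OF assms(2)], simp)
  then show ?thesis using Lam_comp[OF assms(2)] by simp
qed

lemma pr_le: assumes "x \<in> V s" "y \<in> V (- s)" shows "\<bar>pr x y\<bar> \<le> nrm s x * nrm (- s) y"
proof -
  have "pr x y = pr (Lam s x) (Lam (- s) y)"
    using pr_Lam_Lam[OF assms] Lam_zero[OF assms(2)] by simp
  moreover have "\<bar>pr (Lam s x) (Lam (- s) y)\<bar> \<le> nrm 0 (Lam s x) * nrm 0 (Lam (- s) y)"
    using semi_inner.Cauchy_Schwarz[OF semi_inner_L2, of "Lam s x" "Lam (- s) y"]
      Lam_in[OF assms(1), of s 0] Lam_in[OF assms(2), of "- s" 0] by (simp add: pr_self nrm_ge_0)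
  ultimately show ?thesis using assms by (simp add: Lam_isometry)
qed

lemma nrm_sq: assumes "x \<in> V s" shows "(nrm s x)\<^sup>2 = pr x (Lam (2 * s) x)"
  using pr_self[OF Lam_in[OF assms, of s]] pr_Lam_Lam[OF assms assms] Lam_isometry[OF assms] by simp

text \<open>
  The inner product of \<open>\<Lambda>\<^sup>s x\<close> and \<open>\<Lambda>\<^sup>s y\<close> in \<open>L\<^sup>2\<close>, with both powers of \<open>\<Lambda>\<close> moved to \<open>y\<close>.
  It makes \<open>V s\<close> a Hilbert space.
\<close>

lemma semi_inner_V: "semi_inner (V s) (\<lambda>x y. pr x (Lam (2 * s) y))"
proof
  show "pr x (Lam (2 * s) y) = pr y (Lam (2 * s) x)" if "x \<in> V s" "y \<in> V s" for x y
    using pr_Lam_Lam[OF that] pr_Lam_Lam[OF that(2,1)] pr_sym[of "Lam s x" 0 "Lam s y"] that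
    by (simp add: Lam_in)
  show "lin_on (V s) (\<lambda>x. pr x (Lam (2 * s) y))" if "y \<in> V s" for y
    by (rule pr_lin1) (rule Lam_in[OF that], simp)
qed (auto simp: V_subspace nrm_sq[symmetric])

text \<open>
  The norm of \<open>V s\<close> is the dual norm of \<open>V (- s)\<close>, attained at \<open>\<Lambda>\<^sup>2\<^sup>s z\<close>, and by density
  the test elements may be taken from \<open>D\<close>.
\<close>

lemma nrm_le_dual:
  assumes "z \<in> V s" "R \<ge> 0" and bd: "\<And>d. d \<in> D \<Longrightarrow> \<bar>pr z d\<bar> \<le> R * nrm (- s) d"
  shows "nrm s z \<le> R"
proof -
  let ?y = "Lam (2 * s) z"
  have y: "?y \<in> V (- s)" by (rule Lam_in[OF assms(1)]) simp
  obtain e where e: "\<And>n. e n \<in> D" "(\<lambda>n. nrm (- s) (?y - e n)) \<longlonglongrightarrow> 0" using approx_seq y by blast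
  have "(\<lambda>n. \<bar>pr z (e n)\<bar>) \<longlonglongrightarrow> \<bar>pr z ?y\<bar>"
    by (intro tendsto_intros pr_tendsto[where s=s]) (use assms e y D_in_V nrm_0 in auto)
  moreover have "(\<lambda>n. R * nrm (- s) (e n)) \<longlonglongrightarrow> R * nrm (- s) ?y"
    by (intro tendsto_intros nrm_tendsto y e D_in_V)
  ultimately have "\<bar>pr z ?y\<bar> \<le> R * nrm (- s) ?y"
    by (rule LIMSEQ_le) (use bd e in auto)
  then have "(nrm s z)\<^sup>2 \<le> R * nrm s z"
    using nrm_sq[OF assms(1)] nrm_Lam[OF assms(1), of "2 * s"] by simp
  then show ?thesis using nrm_ge_0[of s z] assms(2)
    by (cases "nrm s z = 0") (auto simp: power2_eq_square)
qed

lemma pr_separates: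
  assumes "x \<in> V s" "y \<in> V s" "\<And>d. d \<in> D \<Longrightarrow> pr x d = pr y d"
  shows "x = y"
proof -
  have "nrm s (x - y) \<le> 0"
    by (rule nrm_le_dual) (use assms V_diff D_in_V pr_diff_left in auto)
  then show ?thesis using nrm_zero[OF V_diff[OF assms(1,2)]] nrm_ge_0[of s "x - y"] by simp
qed


section \<open>The Riesz representation theorem\<close>

lemma parallelogram:
  assumes "x \<in> V s" "y \<in> V s"
  shows "(nrm s (x - y))\<^sup>2 = 2 * (nrm s x)\<^sup>2 + 2 * (nrm s y)\<^sup>2 - 4 * (nrm s ((1/2) *\<^sub>R (x + y)))\<^sup>2"
proof -
  interpret I: semi_inner "V s" "\<lambda>x y. pr x (Lam (2 * s) y)" by (rule semi_inner_V)
  have "(nrm s ((1/2) *\<^sub>R (x + y)))\<^sup>2 = (nrm s (x + y))\<^sup>2 / 4"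
    using assms by (simp add: nrm_scale V_add power_divide)
  moreover have "(nrm s (x + y))\<^sup>2 + (nrm s (x - y))\<^sup>2 = 2 * (nrm s x)\<^sup>2 + 2 * (nrm s y)\<^sup>2"
    using I.square_expand[OF assms, of 1] I.square_expand[OF assms, of "-1"] assms
    by (simp add: nrm_sq V_add V_diff)
  ultimately show ?thesis by simp
qed

text \<open>
  The functional is given only on the dense subspace \<open>D\<close> of \<open>V (- s)\<close>, which is where the trilinear
  form and the weak formulation are tested.  A minimizing sequence in \<open>D\<close> of the quadratic functional
  \<open>\<parallel>d\<parallel>\<^sup>2 - 2 f d\<close> is Cauchy by the parallelogram law; its limit \<open>y\<close> in \<open>V (- s)\<close>
  represents \<open>f\<close> for the inner product of \<open>V (- s)\<close>, and \<open>\<Lambda>\<close> to the power \<open>- 2 s\<close>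
  takes \<open>y\<close> to the representing element of \<open>V s\<close> for the \<open>L\<^sup>2\<close> pairing.
\<close>

theorem Riesz_representation:
  assumes lin: "lin_on D f" and R: "R \<ge> 0" and bd: "\<And>d. d \<in> D \<Longrightarrow> \<bar>f d\<bar> \<le> R * nrm (- s) d"
  obtains z where "z \<in> V s" "\<And>d. d \<in> D \<Longrightarrow> pr z d = f d" "nrm s z \<le> R"
proof -
  let ?n = "nrm (- s)"
  define J where "J d = (?n d)\<^sup>2 - 2 * f d" for d
  define m where "m = Inf (J ` D)"
  have f_add: "\<lbrakk>x \<in> D; y \<in> D\<rbrakk> \<Longrightarrow> f (x + y) = f x + f y"
    and f_scale: "x \<in> D \<Longrightarrow> f (a *\<^sub>R x) = a * f x" for x y a
    using lin by (auto simp: lin_on_def)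
  have "- R\<^sup>2 \<le> J d" if "d \<in> D" for d
  proof -
    have "0 \<le> (?n d - R)\<^sup>2" by simp
    then show ?thesis using bd[OF that] by (auto simp: J_def power2_eq_square algebra_simps abs_le_iff)
  qed
  then have bdd: "bdd_below (J ` D)" by (intro bdd_belowI2)
  have m_le: "m \<le> J d" if "d \<in> D" for d
    unfolding m_def using that bdd by (intro cInf_lower) auto
  have "\<exists>x\<in>D. J x < m + e" if "e > 0" for e
    using cInf_lessD[of "J ` D" "m + e"] that subspace_0[OF subspace_D] by (auto simp: m_def)
  then have "\<exists>d. \<forall>n. d n \<in> D \<and> J (d n) < m + inverse (real (Suc n))"
    by (intro choice) (metis inverse_positive_iff_positive of_nat_0_less_iff zero_less_Suc)
  then obtain d where d: "\<And>n. d n \<in> D" "\<And>n. J (d n) < m + inverse (real (Suc n))" by blast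
  have dV: "d n \<in> V (- s)" for n using d D_in_V by blast
  \<comment> \<open>both \<open>J x\<close> and \<open>J y\<close> being close to the infimum forces \<open>x\<close> and \<open>y\<close> together, since their
    midpoint cannot do better than the infimum\<close>
  have close: "(?n (x - y))\<^sup>2 \<le> 2 * (J x - m) + 2 * (J y - m)" if xy: "x \<in> D" "y \<in> D" for x y
  proof -
    let ?h = "(1/2) *\<^sub>R (x + y)"
    have hD: "?h \<in> D" by (rule D_scale[OF D_add[OF xy]])
    define jh where "jh = J ?h"
    have "(?n (x - y))\<^sup>2 = 2 * J x + 2 * J y - 4 * jh"
      using parallelogram[OF D_in_V[OF xy(1), of "- s"] D_in_V[OF xy(2)]]
        f_scale[OF D_add[OF xy], of "1/2"] f_add[OF xy] unfolding J_def jh_def by (simp only:) (simp add: field_simps)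
    then show ?thesis using m_le[OF hD] unfolding jh_def[symmetric] by simp
  qed
  interpret M: Metric_space "V (- s)" "\<lambda>x y. ?n (x - y)" by (rule metric_V)
  have "M.MCauchy d"
    unfolding M.MCauchy_def
  proof (intro conjI allI impI)
    show "range d \<subseteq> V (- s)" using dV by blast
    fix e :: real assume e: "e > 0"
    obtain N where N: "inverse (real (Suc N)) < e\<^sup>2 / 4"
      using reals_Archimedean[of "e\<^sup>2 / 4"] e by auto
    have J: "J (d n) - m < e\<^sup>2 / 4" if "n \<ge> N" for n
    proof -
      have "inverse (real (Suc n)) \<le> inverse (real (Suc N))" using that by (simp add: field_simps)
      then show ?thesis using d(2)[of n] N by linarith
    qed
    have "?n (d n - d n') < e" if "N \<le> n" "N \<le> n'" for n n'
    proof -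
      have "(?n (d n - d n'))\<^sup>2 < e\<^sup>2"
        using close[OF d(1) d(1), of n n'] J[OF that(1)] J[OF that(2)] by argo
      then show ?thesis using e by (simp add: power2_less_imp_less)
    qed
    then show "\<exists>N. \<forall>n n'. N \<le> n \<longrightarrow> N \<le> n' \<longrightarrow> ?n (d n - d n') < e" by blast
  qed
  then obtain y where "limitin M.mtopology d y sequentially"
    using V_complete[of "- s"] unfolding M.mcomplete_def by blast
  then have y: "y \<in> V (- s)" and lim: "(\<lambda>n. ?n (d n - y)) \<longlonglongrightarrow> 0"
    by (auto simp: M.limitin_metric_dist_null)
  have lim': "(\<lambda>n. ?n (y - d n)) \<longlonglongrightarrow> 0" using lim by (simp add: nrm_minus_commute)
  let ?z = "Lam (2 * (- s)) y"
  have z: "?z \<in> V s" by (rule Lam_in[OF y]) simp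
  \<comment> \<open>\<open>y\<close> need not lie in \<open>D\<close>, so the first variation of \<open>J\<close> is computed along the sequence
    and vanishes in the limit\<close>
  have rep: "pr ?z x = f x" if x: "x \<in> D" for x
  proof -
    have xV: "x \<in> V t" for t using x by (rule D_in_V)
    interpret I: semi_inner "V (- s)" "\<lambda>x y. pr x (Lam (2 * (- s)) y)" by (rule semi_inner_V)
    define g where "g = pr y (Lam (2 * (- s)) x) - f x"
    have lim_ip: "(\<lambda>n. pr (d n) (Lam (2 * (- s)) x)) \<longlonglongrightarrow> pr y (Lam (2 * (- s)) x)"
      by (intro pr_tendsto[where s="- s"] y dV lim') (use Lam_in[OF xV[of "- s"], of "- (2 * s)" s] nrm_0 in auto)
    have q: "0 \<le> 2 * a * g + a\<^sup>2 * (?n x)\<^sup>2" for a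
    proof (rule LIMSEQ_le)
      show "(\<lambda>n. - inverse (real (Suc n))) \<longlonglongrightarrow> 0" using tendsto_minus[OF LIMSEQ_inverse_real_of_nat] by simp
      show "(\<lambda>n. 2 * a * (pr (d n) (Lam (2 * (- s)) x) - f x) + a\<^sup>2 * (?n x)\<^sup>2)
          \<longlonglongrightarrow> 2 * a * g + a\<^sup>2 * (?n x)\<^sup>2"
        unfolding g_def by (intro tendsto_intros lim_ip)
      have "- inverse (real (Suc n)) \<le> 2 * a * (pr (d n) (Lam (2 * (- s)) x) - f x) + a\<^sup>2 * (?n x)\<^sup>2" for n
      proof -
        have ax: "a *\<^sub>R x \<in> D" using x by (rule D_scale)
        have "J (d n + a *\<^sub>R x) = J (d n) + 2 * a * (pr (d n) (Lam (2 * (- s)) x) - f x) + a\<^sup>2 * (?n x)\<^sup>2"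
          using I.square_expand[OF dV[of n] xV, of a] nrm_sq[OF dV[of n]] nrm_sq[OF xV[of "- s"]]
            nrm_sq[OF V_add[OF dV[of n] V_scale[OF xV[of "- s"], of a]]] f_add[OF d(1) ax] f_scale[OF x]
          by (simp add: J_def algebra_simps)
        then show ?thesis using m_le[OF D_add[OF d(1)[of n] ax]] d(2)[of n] by linarith
      qed
      then show "\<exists>N. \<forall>n\<ge>N. - inverse (real (Suc n))
          \<le> 2 * a * (pr (d n) (Lam (2 * (- s)) x) - f x) + a\<^sup>2 * (?n x)\<^sup>2" by blast
    qed
    \<comment> \<open>a quadratic polynomial in \<open>a\<close> without constant term is nonnegative everywhere only if its linear term vanishes\<close>
    have "g = 0"
    proof -
      let ?q = "(?n x)\<^sup>2 + 1"
      have q0: "?q > 0" by (simp add: add_nonneg_pos)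
      have "0 \<le> 2 * (- g / ?q) * g + (- g / ?q)\<^sup>2 * (?n x)\<^sup>2" by (rule q)
      also have "\<dots> \<le> 2 * (- g / ?q) * g + (- g / ?q)\<^sup>2 * ?q" by (intro add_left_mono mult_left_mono) auto
      also have "\<dots> = - (g\<^sup>2 / ?q)" using q0 by (simp add: power_divide power2_eq_square)
      finally show ?thesis using q0 by (auto simp: field_simps)
    qed
    moreover have "pr ?z x = pr y (Lam (2 * (- s)) x)"
      by (rule Lam_self_adjoint[OF y]) (rule xV)
    ultimately show ?thesis by (simp add: g_def)
  qed
  show ?thesis
    by (rule that[OF z rep nrm_le_dual[OF z R]]) (use rep bd in auto)
qed

text \<open>
  Regularity is detected by duality.  In particular, closed balls of \<open>V t\<close> are closed in \<open>V s\<close>,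
  because the bound on the right passes to limits in \<open>V s\<close>.
\<close>

lemma in_V_if_dual_bound:
  assumes "x \<in> V s" "s \<le> t" "R \<ge> 0" "\<And>d. d \<in> D \<Longrightarrow> \<bar>pr x d\<bar> \<le> R * nrm (- t) d"
  shows "x \<in> V t \<and> nrm t x \<le> R"
proof -
  have "lin_on D (pr x)"
    using pr_lin2[OF assms(1)] D_in_V by (auto simp: lin_on_def)
  from Riesz_representation[OF this assms(3,4)]
  obtain z where z: "z \<in> V t" "\<And>d. d \<in> D \<Longrightarrow> pr z d = pr x d" "nrm t z \<le> R" by blast
  have "z = x"
    by (rule pr_separates[where s=s]) (use z V_mono[OF assms(2)] assms(1) in auto)
  then show ?thesis using z by simp
qed


section \<open>Compactness of the embeddings\<close>

lemma interpolation:
  assumes "x \<in> V t" "s \<le> t"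
  shows "(nrm ((s + t) / 2) x)\<^sup>2 \<le> nrm s x * nrm t x"
proof -
  let ?r = "(s + t) / 2"
  have xs: "x \<in> V s" "x \<in> V ?r" using V_mono[of s t] V_mono[of ?r t] assms by (auto simp: field_simps)
  have "(nrm ?r x)\<^sup>2 = pr x (Lam (s + t) x)"
  proof -
    have "2 * ?r = s + t" by simp
    then show ?thesis using nrm_sq[OF xs(2)] by metis
  qed
  also have "\<dots> \<le> nrm s x * nrm (- s) (Lam (s + t) x)"
    using pr_le[OF xs(1) Lam_in[OF assms(1), of "s + t"]] by simp
  also have "nrm (- s) (Lam (s + t) x) = nrm t x" using nrm_Lam[OF assms(1), of "s + t"] by simp
  finally show ?thesis .
qed

lemma unit_ball_net_1:
  assumes "e > 0"
  shows "\<exists>F. finite F \<and> F \<subseteq> {x \<in> V 1. nrm 1 x \<le> 1} \<and>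
    (\<forall>x\<in>V 1. nrm 1 x \<le> 1 \<longrightarrow> (\<exists>y\<in>F. nrm 0 (x - y) < e))"
proof -
  interpret M: Metric_space "V 0" "\<lambda>x y. nrm 0 (x - y)" by (rule metric_V)
  let ?S = "Lam (- 1) ` {u \<in> V 0. nrm 0 u \<le> 1}"
  have "?S \<subseteq> {x \<in> V 1. nrm 1 x \<le> 1}"
    using Lam_in[of _ 0 "-1" 1] nrm_Lam[of _ 0 "-1"] by auto
  moreover have "{x \<in> V 1. nrm 1 x \<le> 1} \<subseteq> ?S"
  proof safe
    fix x assume x: "x \<in> V 1" "nrm 1 x \<le> 1"
    have "x = Lam (- 1) (Lam 1 x)" using Lam_comp[OF x(1), of "-1" 1] Lam_zero[OF x(1)] by simp
    moreover have "Lam 1 x \<in> V 0" "nrm 0 (Lam 1 x) \<le> 1"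
      using Lam_in[OF x(1), of 1 0] Lam_isometry[OF x(1)] x(2) by auto
    ultimately show "x \<in> ?S" by blast
  qed
  ultimately have S: "?S = {x \<in> V 1. nrm 1 x \<le> 1}" by blast
  have S0: "?S \<subseteq> V 0" unfolding S using V_mono[of 0 1] by auto
  have "M.mtotally_bounded (M.mtopology closure_of ?S)"
    by (rule M.compactin_imp_mtotally_bounded[OF Lam_inverse_compact])
  then have "M.mtotally_bounded ?S"
    by (rule M.mtotally_bounded_subset) (rule closure_of_subset, simp add: S0)
  then have "\<exists>F. finite F \<and> F \<subseteq> ?S \<and> ?S \<subseteq> (\<Union>x\<in>F. M.mball x e)"
    using assms by (simp add: M.mtotally_bounded_def)
  then obtain F where F: "finite F" "F \<subseteq> ?S" "?S \<subseteq> (\<Union>x\<in>F. M.mball x e)"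
    by (elim exE conjE)
  have "\<exists>y\<in>F. nrm 0 (x - y) < e" if "x \<in> V 1" "nrm 1 x \<le> 1" for x
  proof -
    have "x \<in> (\<Union>x\<in>F. M.mball x e)" using that by (intro subsetD[OF F(3)[unfolded S]]) simp
    then show ?thesis using nrm_minus_commute[of 0 x] by (auto simp: M.in_mball)
  qed
  then show ?thesis using F(1,2)[unfolded S] by (intro exI[of _ F]) auto
qed

text \<open>
  Interpolation between \<open>V 0\<close> and \<open>V \<delta>\<close> turns a fine net in \<open>V 0\<close> of the unit ball of \<open>V \<delta>\<close>
  into a net of the same ball in \<open>V (\<delta> / 2)\<close>; the isometry \<open>\<Lambda>\<close> to the power \<open>\<delta> / 2\<close> shifts this to
  a net in \<open>V 0\<close> of the unit ball of \<open>V (\<delta> / 2)\<close>.  The centres stay in the ball, because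
  interpolation needs a bound on the differences in \<open>V \<delta>\<close>.
\<close>

lemma unit_ball_net_halve:
  assumes net: "\<And>e. e > 0 \<Longrightarrow> \<exists>F. finite F \<and> F \<subseteq> {x \<in> V \<delta>. nrm \<delta> x \<le> 1} \<and>
      (\<forall>x\<in>V \<delta>. nrm \<delta> x \<le> 1 \<longrightarrow> (\<exists>y\<in>F. nrm 0 (x - y) < e))"
    and \<delta>: "\<delta> > 0" and e: "e > 0"
  shows "\<exists>F. finite F \<and> F \<subseteq> {x \<in> V (\<delta> / 2). nrm (\<delta> / 2) x \<le> 1} \<and>
      (\<forall>x\<in>V (\<delta> / 2). nrm (\<delta> / 2) x \<le> 1 \<longrightarrow> (\<exists>y\<in>F. nrm 0 (x - y) < e))"
proof -
  let ?L = "Lam (\<delta> / 2)" and ?L' = "Lam (- (\<delta> / 2))"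
  obtain F where F: "finite F" "F \<subseteq> {x \<in> V \<delta>. nrm \<delta> x \<le> 1}"
    "\<And>x. \<lbrakk>x \<in> V \<delta>; nrm \<delta> x \<le> 1\<rbrakk> \<Longrightarrow> \<exists>y\<in>F. nrm 0 (x - y) < e\<^sup>2 / 2"
    using net[of "e\<^sup>2 / 2"] e by auto
  have "\<exists>y\<in>?L ` F. nrm 0 (x - y) < e" if x: "x \<in> V (\<delta> / 2)" "nrm (\<delta> / 2) x \<le> 1" for x
  proof -
    have z: "?L' x \<in> V \<delta>" by (rule Lam_in[OF x(1)]) simp
    have nz: "nrm \<delta> (?L' x) \<le> 1" using nrm_Lam[OF x(1), of "- (\<delta> / 2)"] x(2) by simp
    obtain y where y: "y \<in> F" "nrm 0 (?L' x - y) < e\<^sup>2 / 2" using F(3)[OF z nz] by blast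
    have yV: "y \<in> V \<delta>" "nrm \<delta> y \<le> 1" using y F(2) by auto
    let ?w = "?L' x - y"
    have w: "?w \<in> V \<delta>" "?w \<in> V (\<delta> / 2)" using V_diff[OF z yV(1)] V_mono[of "\<delta> / 2" \<delta>] \<delta> by auto
    have "x - ?L y = ?L ?w"
      using Lam_diff[OF z yV(1), of "\<delta> / 2"] Lam_comp[OF x(1), of "\<delta> / 2" "- (\<delta> / 2)"] Lam_zero[OF x(1)] by simp
    then have "(nrm 0 (x - ?L y))\<^sup>2 = (nrm ((0 + \<delta>) / 2) ?w)\<^sup>2" using Lam_isometry[OF w(2)] by simp
    also have "\<dots> \<le> nrm 0 ?w * nrm \<delta> ?w" using interpolation[OF w(1), of 0] \<delta> by simp
    also have "\<dots> \<le> nrm 0 ?w * 2"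
      using nrm_diff_le[OF z yV(1)] nz yV(2) by (intro mult_left_mono nrm_ge_0) auto
    also have "\<dots> < e\<^sup>2" using y(2) by simp
    finally have "nrm 0 (x - ?L y) < e" using e by (simp add: power2_less_imp_less)
    then show ?thesis using y(1) by blast
  qed
  moreover have "?L ` F \<subseteq> {x \<in> V (\<delta> / 2). nrm (\<delta> / 2) x \<le> 1}"
    using F(2) Lam_in[of _ \<delta> "\<delta> / 2" "\<delta> / 2"] nrm_Lam[of _ \<delta> "\<delta> / 2"] by auto
  ultimately show ?thesis using F(1) by (intro exI[of _ "?L ` F"]) auto
qed

text \<open>
  Compactness of \<open>\<Lambda>\<close> to the power \<open>- 1\<close> gives the case of a gain of one derivative; halving the gain
  repeatedly reaches one below \<open>t - s\<close>, and \<open>\<Lambda>\<close> to the power \<open>s\<close> shifts from \<open>V 0\<close> to \<open>V s\<close>.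
\<close>

lemma unit_ball_net:
  assumes "s < t" "e > 0"
  obtains F where "finite F" "F \<subseteq> V s" "\<And>x. \<lbrakk>x \<in> V t; nrm t x \<le> 1\<rbrakk> \<Longrightarrow> \<exists>y\<in>F. nrm s (x - y) < e"
proof -
  have dyadic: "\<exists>F. finite F \<and> F \<subseteq> {x \<in> V (1 / 2 ^ k). nrm (1 / 2 ^ k) x \<le> 1} \<and>
      (\<forall>x\<in>V (1 / 2 ^ k). nrm (1 / 2 ^ k) x \<le> 1 \<longrightarrow> (\<exists>y\<in>F. nrm 0 (x - y) < e'))" if "e' > 0" for k e'
    using that
  proof (induction k arbitrary: e')
    case 0
    then show ?case using unit_ball_net_1 by simp
  next
    case (Suc k)
    then show ?case using unit_ball_net_halve[of "1 / 2 ^ k" e'] by (simp add: field_simps)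
  qed
  obtain k where k: "1 / 2 ^ k < t - s"
    using real_arch_pow_inv[of "t - s" "1/2"] assms(1) by (auto simp: power_one_over)
  let ?r = "1 / 2 ^ k :: real"
  obtain K where K: "\<forall>x\<in>V (t - s). nrm ?r x \<le> K * nrm (t - s) x"
    using V_mono_bound[of ?r "t - s"] k by auto
  define K' where "K' = \<bar>K\<bar> + 1"
  have K': "K' > 0" by (simp add: K'_def)
  obtain F where F: "finite F" "F \<subseteq> {x \<in> V ?r. nrm ?r x \<le> 1}"
      "\<And>x. \<lbrakk>x \<in> V ?r; nrm ?r x \<le> 1\<rbrakk> \<Longrightarrow> \<exists>y\<in>F. nrm 0 (x - y) < e / K'"
    using dyadic[of "e / K'" k] assms(2) K' by auto
  let ?F = "(\<lambda>y. K' *\<^sub>R Lam (- s) y) ` F"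
  have FV: "y \<in> V 0" if "y \<in> F" for y using that F(2) V_mono[of 0 ?r] by auto
  show ?thesis
  proof (rule that[of ?F])
    show "finite ?F" using F by simp
    show "?F \<subseteq> V s" using FV Lam_in[of _ 0 "- s" s] V_scale by auto
    fix x assume x: "x \<in> V t" "nrm t x \<le> 1"
    have x0: "x \<in> V s" using x V_mono[of s t] assms by auto
    let ?z = "(1 / K') *\<^sub>R Lam s x"
    have Lx: "Lam s x \<in> V (t - s)" by (rule Lam_maps[OF x(1)])
    have Lxr: "Lam s x \<in> V ?r" using Lx V_mono[of ?r "t - s"] k by auto
    have "nrm ?r (Lam s x) \<le> K * nrm t x" using K Lx nrm_Lam[OF x(1), of s] by auto
    also have "\<dots> \<le> \<bar>K\<bar> * 1" using x(2) nrm_ge_0[of t x] by (intro mult_mono) auto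
    also have "\<dots> \<le> K'" by (simp add: K'_def)
    finally have "nrm ?r ?z \<le> 1" using K' Lxr by (simp add: nrm_scale)
    then obtain y where y: "y \<in> F" "nrm 0 (?z - y) < e / K'" using F(3) Lxr V_scale by blast
    have Ly: "Lam (- s) y \<in> V s" using Lam_in[OF FV[OF y(1)], of "- s" s] by simp
    have y': "y = Lam s (Lam (- s) y)"
      using Lam_comp[OF FV[OF y(1)], of s "- s"] Lam_zero[OF FV[OF y(1)]] by simp
    have "nrm s (x - K' *\<^sub>R Lam (- s) y) = nrm 0 (Lam s (x - K' *\<^sub>R Lam (- s) y))"
      by (rule Lam_isometry[symmetric]) (intro V_diff V_scale x0 Ly)
    also have "Lam s (x - K' *\<^sub>R Lam (- s) y) = Lam s x - K' *\<^sub>R y"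
      using Lam_diff[OF x0 V_scale[OF Ly]] Lam_lin[of s s] Ly y' unfolding lin_on_def by metis
    also have "\<dots> = K' *\<^sub>R (?z - y)" using K' by (simp add: scaleR_diff_right)
    also have "nrm 0 (K' *\<^sub>R (?z - y)) = K' * nrm 0 (?z - y)"
      using K' V_diff[OF V_scale[OF Lam_in[OF x0, of s 0]] FV[OF y(1)]] by (simp add: nrm_scale)
    also have "\<dots> < e" using y(2) K' by (simp add: field_simps)
    finally show "\<exists>y\<in>?F. nrm s (x - y) < e" using y(1) by blast
  qed
qed

end


section \<open>Bump functions and the lemma of du Bois-Reymond\<close>

text \<open>
  A class of functions that vanish where the polynomial \<open>q\<close> is not positive and are closed under
  differentiation.  With \<open>q = (x - a) (b - x)\<close> it contains the standard bump function on \<open>(a, b)\<close>,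
  together with all its derivatives.
\<close>

definition flat :: "real poly \<Rightarrow> real poly \<Rightarrow> nat \<Rightarrow> real \<Rightarrow> real" where
  "flat q p n x = (if 0 < poly q x then poly p x / poly q x ^ n * exp (- 1 / poly q x) else 0)"

lemma power_div_fact_le_exp:
  fixes x :: real
  assumes "x \<ge> 0"
  shows "x ^ n / fact n \<le> exp x"
proof -
  have "(\<Sum>k\<in>{n}. x ^ k /\<^sub>R fact k) \<le> (\<Sum>k. x ^ k /\<^sub>R fact k)"
    by (rule sum_le_suminf) (use assms summable_exp[of x] in auto)
  then show ?thesis by (simp add: exp_def divide_inverse mult.commute)
qed

lemma exp_recip_le:
  fixes t :: real
  assumes "t > 0"
  shows "exp (- 1 / t) / t ^ n \<le> fact (n + 2) * t\<^sup>2"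
proof -
  have "(1 / t) ^ (n + 2) / fact (n + 2) \<le> exp (1 / t)"
    by (rule power_div_fact_le_exp) (use assms in simp)
  then have "exp (- (1 / t)) \<le> fact (n + 2) * t ^ (n + 2)"
    using assms by (simp add: exp_minus field_simps del: fact_Suc)
  then show ?thesis using assms by (simp add: field_simps power_add power2_eq_square del: fact_Suc)
qed

lemma flat_derivative:
  "(flat q p n has_real_derivative
     flat q (pderiv p * q\<^sup>2 - of_nat n * p * pderiv q * q + p * pderiv q) (n + 2) x) (at x)"
proof (cases "0 < poly q x")
  case True
  let ?f = "\<lambda>x. poly p x / poly q x ^ n * exp (- 1 / poly q x)"
  let ?d = "flat q (pderiv p * q\<^sup>2 - of_nat n * p * pderiv q * q + p * pderiv q) (n + 2) x"
  have op: "open {y. 0 < poly q y}" by (intro open_Collect_less continuous_intros)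
  have "(?f has_real_derivative ?d) (at x)"
    using True
    apply (auto intro!: derivative_eq_intros simp: flat_def)
    apply (cases n)
     apply (simp_all add: field_simps power2_eq_square)
    done
  then show ?thesis
    by (rule has_field_derivative_transform_within_open[OF _ op]) (use True in \<open>auto simp: flat_def\<close>)
next
  case False
  let ?C = "\<lambda>y. \<bar>poly p y\<bar> * fact (n + 2)"
  \<comment> \<open>at \<open>x\<close> the function vanishes, and nearby it is at most quadratic in the increment of \<open>q\<close>, so
    the difference quotient tends to zero\<close>
  have bd: "\<bar>flat q p n y\<bar> \<le> ?C y * (poly q y - poly q x)\<^sup>2" for y
  proof (cases "0 < poly q y")
    case True
    have "\<bar>flat q p n y\<bar> = \<bar>poly p y\<bar> * (exp (- 1 / poly q y) / poly q y ^ n)"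
      using True by (simp add: flat_def abs_mult)
    also have "\<dots> \<le> \<bar>poly p y\<bar> * (fact (n + 2) * (poly q y)\<^sup>2)"
      by (intro mult_left_mono exp_recip_le True) simp
    also have "\<dots> \<le> \<bar>poly p y\<bar> * (fact (n + 2) * (poly q y - poly q x)\<^sup>2)"
      using True False by (intro mult_left_mono power_mono) auto
    finally show ?thesis by (simp add: mult.assoc)
  qed (simp add: flat_def)
  have "(\<lambda>y. (poly q y - poly q x) / (y - x)) \<midarrow>x\<rightarrow> poly (pderiv q) x"
    using poly_DERIV[of q x] by (simp add: has_field_derivative_iff)
  then have "(\<lambda>y. ?C y * (\<bar>(poly q y - poly q x) / (y - x)\<bar> * \<bar>poly q y - poly q x\<bar>))
      \<midarrow>x\<rightarrow> ?C x * (\<bar>poly (pderiv q) x\<bar> * \<bar>poly q x - poly q x\<bar>)"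
    by (intro tendsto_intros isContD[OF poly_isCont])
  then have lim: "(\<lambda>y. ?C y * (\<bar>(poly q y - poly q x) / (y - x)\<bar> * \<bar>poly q y - poly q x\<bar>)) \<midarrow>x\<rightarrow> 0"
    by simp
  have "(\<lambda>y. (flat q p n y - flat q p n x) / (y - x)) \<midarrow>x\<rightarrow> 0"
  proof (rule Lim_null_comparison[OF _ lim], rule always_eventually, rule allI)
    fix y
    have "flat q p n x = 0" using False by (simp add: flat_def)
    then have "norm ((flat q p n y - flat q p n x) / (y - x)) = \<bar>flat q p n y\<bar> / \<bar>y - x\<bar>"
      by (simp add: abs_divide)
    also have "\<dots> \<le> (?C y * (poly q y - poly q x)\<^sup>2) / \<bar>y - x\<bar>"
      by (intro divide_right_mono bd) simp
    also have "\<dots> = ?C y * (\<bar>(poly q y - poly q x) / (y - x)\<bar> * \<bar>poly q y - poly q x\<bar>)"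
      by (simp add: power2_eq_square abs_divide flip: abs_mult)
    finally show "norm ((flat q p n y - flat q p n x) / (y - x))
        \<le> ?C y * (\<bar>(poly q y - poly q x) / (y - x)\<bar> * \<bar>poly q y - poly q x\<bar>)" .
  qed
  then show ?thesis using False by (simp add: has_field_derivative_iff flat_def)
qed

lemma bump_exists:
  fixes a b :: real
  obtains \<psi> where "\<And>k t. (\<psi> k has_real_derivative \<psi> (Suc k) t) (at t)"
    "\<And>k t. t \<notin> {a<..<b} \<Longrightarrow> \<psi> k t = (0 :: real)" "\<And>t. t \<in> {a<..<b} \<Longrightarrow> \<psi> (0::nat) t > 0"
proof (cases "a < b")
  case ab: True
  let ?q = "[:- a, 1:] * [:b, - 1:] :: real poly"
  have pos: "0 < poly ?q t \<longleftrightarrow> t \<in> {a<..<b}" for t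
  proof -
    have "poly ?q t = (t - a) * (b - t)" by (simp add: algebra_simps)
    then show ?thesis using ab by (auto simp only: zero_less_mult_iff) auto
  qed
  define P where "P = rec_nat (1 :: real poly, 0 :: nat)
    (\<lambda>_ (p, n). (pderiv p * ?q\<^sup>2 - of_nat n * p * pderiv ?q * ?q + p * pderiv ?q, n + 2))"
  define \<psi> where "\<psi> k = flat ?q (fst (P k)) (snd (P k))" for k
  have P0: "P 0 = (1, 0)" by (simp add: P_def)
  have PS: "P (Suc k) = (pderiv (fst (P k)) * ?q\<^sup>2 - of_nat (snd (P k)) * fst (P k) * pderiv ?q * ?q
      + fst (P k) * pderiv ?q, snd (P k) + 2)" for k
    by (simp add: P_def case_prod_unfold)
  show ?thesis
  proof (rule that[of \<psi>])
    show "(\<psi> k has_real_derivative \<psi> (Suc k) t) (at t)" for k t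
      unfolding \<psi>_def PS fst_conv snd_conv by (rule flat_derivative)
    show "\<psi> k t = 0" if "t \<notin> {a<..<b}" for k t
      using pos[of t] that by (simp only: \<psi>_def flat_def if_False)
    show "\<psi> 0 t > 0" if "t \<in> {a<..<b}" for t
      using pos[of t] that by (simp only: \<psi>_def flat_def P0 if_True) simp
  qed
qed (rule that[of "\<lambda>_ _. 0"], auto)

lemma antiderivative_on_reals:
  fixes f :: "real \<Rightarrow> real"
  assumes "\<And>x. isCont f x"
  obtains F where "\<And>x. (F has_real_derivative f x) (at x)"
proof
  fix x :: real
  have "((\<lambda>u. LBINT y=0..u. f y) has_vector_derivative f x) (at x within {- (\<bar>x\<bar> + 1)..\<bar>x\<bar> + 1})"
    unfolding zero_ereal_def
    by (rule interval_integral_FTC2) (use assms in \<open>auto intro: continuous_at_imp_continuous_on\<close>)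
  then show "((\<lambda>u. LBINT y=0..u. f y) has_real_derivative f x) (at x)"
    by (subst (asm) at_within_interior) (auto simp: has_real_derivative_iff_has_vector_derivative)
qed

text \<open>
  Subtracting a primitive \<open>K\<close> of \<open>H\<close> reduces the claim to: a continuous \<open>J\<close> that is orthogonal to
  the derivatives of all test functions is constant.  The test function used is the primitive
  of the difference of two narrow bumps \<open>\<eta>\<close> around \<open>t1\<close> and \<open>t2\<close>, which has compact
  support because both bumps have the same integral \<open>I\<close>.  Orthogonality then says that the averages of
  \<open>J\<close> near \<open>t1\<close> and near \<open>t2\<close> agree.
\<close>

theorem du_Bois_Reymond:
  fixes G H :: "real \<Rightarrow> real"
  assumes cG: "continuous_on {0..T} G" and cH: "continuous_on {0..T} H"
    and test: "\<And>\<psi> a b. \<lbrakk>0 < a; b < T; \<And>k t. (\<psi> k has_real_derivative \<psi> (Suc k) t) (at t);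
        \<And>k t. t \<notin> {a..b} \<Longrightarrow> \<psi> k t = 0\<rbrakk> \<Longrightarrow>
        integral {0..T} (\<lambda>t. G t * \<psi> 1 t + H t * \<psi> (0::nat) t) = 0"
    and T: "0 < T" and st: "0 \<le> s" "s \<le> t" "t \<le> T"
  shows "(H has_integral (G t - G s)) {s..t}"
proof -
  define K where "K t = integral {0..t} H" for t
  define J where "J t = G t - K t" for t
  have dK: "(K has_real_derivative H t) (at t within {0..T})" if "t \<in> {0..T}" for t
    unfolding K_def by (rule integral_has_real_derivative[OF cH that])
  have cK: "continuous_on {0..T} K" by (rule DERIV_continuous_on[OF dK])
  have cJ: "continuous_on {0..T} J" unfolding J_def by (intro continuous_intros cG cK)
  have orth: "((\<lambda>t. J t * \<psi> 1 t) has_integral 0) {0..T}"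
    if ab: "0 < a" "b < T" and d: "\<And>k t. (\<psi> k has_real_derivative \<psi> (Suc k) t) (at t)"
      and sup: "\<And>k t. t \<notin> {a..b} \<Longrightarrow> \<psi> k t = 0" for \<psi> :: "nat \<Rightarrow> real \<Rightarrow> real" and a b
  proof -
    have c: "continuous_on {0..T} (\<psi> k)" for k
      using d DERIV_isCont by (blast intro: continuous_at_imp_continuous_on)
    have "((\<lambda>t. K t * \<psi> 1 t + H t * \<psi> 0 t) has_integral (K T * \<psi> 0 T - K 0 * \<psi> 0 0)) {0..T}"
    proof (rule fundamental_theorem_of_calculus)
      fix x assume x: "x \<in> {0..T}"
      show "((\<lambda>t. K t * \<psi> 0 t) has_vector_derivative (K x * \<psi> 1 x + H x * \<psi> 0 x)) (at x within {0..T})"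
        using DERIV_mult[OF dK[OF x] has_field_derivative_at_within[OF d[of 0 x]]]
        by (simp add: has_real_derivative_iff_has_vector_derivative algebra_simps)
    qed (use T in simp)
    moreover have "\<psi> 0 T = 0" "\<psi> 0 0 = 0" using sup[of T 0] sup[of 0 0] ab by auto
    ultimately have hK: "((\<lambda>t. K t * \<psi> 1 t + H t * \<psi> 0 t) has_integral 0) {0..T}" by simp
    have "(\<lambda>t. G t * \<psi> 1 t + H t * \<psi> 0 t) integrable_on {0..T}"
      by (intro integrable_continuous_interval continuous_intros cG cH c)
    then have "((\<lambda>t. G t * \<psi> 1 t + H t * \<psi> 0 t) has_integral 0) {0..T}"
      using test[of a b \<psi>, OF ab d sup] by (simp add: has_integral_integrable_integral)
    from has_integral_diff[OF this hK] show ?thesis by (simp add: J_def algebra_simps)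
  qed
  have J_const: "J t1 = J t2" if t12: "t1 \<in> {0<..<T}" "t2 \<in> {0<..<T}" for t1 t2
  proof -
    have close: "\<bar>J t1 - J t2\<bar> \<le> 2 * e" if e: "e > 0" for e
    proof -
      have "\<exists>r>0. \<forall>y\<in>{0..T}. \<bar>y - x\<bar> \<le> r \<longrightarrow> \<bar>J y - J x\<bar> \<le> e" if x: "x \<in> {0<..<T}" for x
      proof -
        have "x \<in> {0..T}" using x by auto
        then obtain d where "d > 0" "\<forall>y\<in>{0..T}. dist y x < d \<longrightarrow> dist (J y) (J x) < e"
          using cJ e unfolding continuous_on_iff by blast
        then show ?thesis by (intro exI[of _ "d / 2"]) (force simp: dist_real_def)
      qed
      then obtain r1 r2 where r: "r1 > 0" "r2 > 0"
        "\<And>y. \<lbrakk>y \<in> {0..T}; \<bar>y - t1\<bar> \<le> r1\<rbrakk> \<Longrightarrow> \<bar>J y - J t1\<bar> \<le> e"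
        "\<And>y. \<lbrakk>y \<in> {0..T}; \<bar>y - t2\<bar> \<le> r2\<rbrakk> \<Longrightarrow> \<bar>J y - J t2\<bar> \<le> e" using t12 by meson
      define r where "r = Min {r1, r2, t1 / 2, t2 / 2, (T - t1) / 2, (T - t2) / 2}"
      have r0: "r > 0" using r(1,2) t12 by (auto simp: r_def)
      have rle: "r \<le> r1" "r \<le> r2" "r < t1" "r < t2" "t1 + r < T" "t2 + r < T"
      proof -
        have le: "r \<le> r1" "r \<le> r2" "r \<le> t1 / 2" "r \<le> t2 / 2" "r \<le> (T - t1) / 2" "r \<le> (T - t2) / 2"
          unfolding r_def by (rule Min_le; simp)+
        then show "r \<le> r1" "r \<le> r2" by blast+
        show "r < t1" "r < t2" "t1 + r < T" "t2 + r < T" using le(3-6) t12 by (auto simp: field_simps)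
      qed
      obtain \<eta> where \<eta>: "\<And>k t. (\<eta> k has_real_derivative \<eta> (Suc k) t) (at t)"
          "\<And>k t. t \<notin> {- r<..<r} \<Longrightarrow> \<eta> k t = (0 :: real)" "\<And>t. t \<in> {- r<..<r} \<Longrightarrow> \<eta> (0::nat) t > 0"
        using bump_exists[of "- r" r] by blast
      obtain E where E: "\<And>x. (E has_real_derivative \<eta> 0 x) (at x)"
        using antiderivative_on_reals[of "\<eta> 0"] \<eta>(1) DERIV_isCont by blast
      have cE: "continuous_on S E" and c\<eta>: "continuous_on S (\<eta> k)" for S k
        using E \<eta>(1) DERIV_isCont by (blast intro: continuous_at_imp_continuous_on)+
      have E0: "(E has_real_derivative 0) (at x)" if "x \<notin> {- r<..<r}" for x
        using E[of x] \<eta>(2)[OF that, of 0] by simp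
      have Elo: "E x = E (- r)" if "x \<le> - r" for x
      proof (cases "x = - r")
        case False
        show ?thesis
          by (rule DERIV_isconst_end[symmetric, OF _ cE E0]) (use False that in auto)
      qed simp
      have Ehi: "E x = E r" if "x \<ge> r" for x
      proof (cases "x = r")
        case False
        show ?thesis
          by (rule DERIV_isconst_end[OF _ cE E0]) (use False that r0 in auto)
      qed simp
      define I where "I = E r - E (- r)"
      have I: "I > 0"
      proof -
        have "\<exists>y. (E has_real_derivative y) (at x) \<and> y > 0" if "- r < x" "x < r" for x
          using E[of x] \<eta>(3)[of x] that by auto
        from DERIV_pos_imp_increasing_open[OF _ this cE] r0 show ?thesis by (simp add: I_def)
      qed
      have eta0: "\<eta> 0 t \<ge> 0" for t
        using \<eta>(2,3)[of t] by (cases "t \<in> {- r<..<r}") (auto intro: less_imp_le)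
      define \<psi> where "\<psi> k t = (case k of 0 \<Rightarrow> E (t - t1) - E (t - t2) | Suc j \<Rightarrow> \<eta> j (t - t1) - \<eta> j (t - t2))"
        for k :: nat and t
      have psi0: "((\<lambda>t. J t * \<psi> 1 t) has_integral 0) {0..T}"
      proof (rule orth)
        show "0 < min t1 t2 - r" "max t1 t2 + r < T" using rle by auto
        show "(\<psi> k has_real_derivative \<psi> (Suc k) t) (at t)" for k t
          by (cases k) (auto simp: \<psi>_def[abs_def] intro!: derivative_eq_intros
              DERIV_chain2[OF E] DERIV_chain2[OF \<eta>(1)])
        show "\<psi> k t = 0" if "t \<notin> {min t1 t2 - r..max t1 t2 + r}" for k t
        proof -
          have "(t - t1 \<le> - r \<and> t - t2 \<le> - r) \<or> (t - t1 \<ge> r \<and> t - t2 \<ge> r)" using that by auto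
          then show ?thesis
            using Elo[of "t - t1"] Elo[of "t - t2"] Ehi[of "t - t1"] Ehi[of "t - t2"]
              \<eta>(2)[of "t - t1"] \<eta>(2)[of "t - t2"] by (auto simp: \<psi>_def split: nat.split)
        qed
      qed
      have avg: "\<exists>A. ((\<lambda>t. J t * \<eta> 0 (t - x)) has_integral A) {0..T} \<and> \<bar>A - J x * I\<bar> \<le> e * I"
        if x: "r < x" "x + r < T" and near: "\<And>y. \<lbrakk>y \<in> {0..T}; \<bar>y - x\<bar> \<le> r\<rbrakk> \<Longrightarrow> \<bar>J y - J x\<bar> \<le> e" for x
      proof -
        have "((\<lambda>t. \<eta> 0 (t - x)) has_integral (E (T - x) - E (0 - x))) {0..T}"
        proof (rule fundamental_theorem_of_calculus)
          fix t
          have "((\<lambda>t. t - x) has_real_derivative 1) (at t)" by (auto intro!: derivative_eq_intros)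
          from has_field_derivative_at_within[OF DERIV_chain2[OF E this]]
          show "((\<lambda>t. E (t - x)) has_vector_derivative \<eta> 0 (t - x)) (at t within {0..T})"
            by (simp add: has_real_derivative_iff_has_vector_derivative)
        qed (use T in simp)
        moreover have "E (T - x) - E (0 - x) = I"
          using Ehi[of "T - x"] Elo[of "0 - x"] x by (simp add: I_def)
        ultimately have hI: "((\<lambda>t. \<eta> 0 (t - x)) has_integral I) {0..T}" by simp
        have "(\<lambda>t. J t * \<eta> 0 (t - x)) integrable_on {0..T}"
          by (intro integrable_continuous_interval continuous_intros cJ continuous_on_compose2[OF c\<eta>[of UNIV 0]]) auto
        then obtain A where A: "((\<lambda>t. J t * \<eta> 0 (t - x)) has_integral A) {0..T}" by blast
        have d: "((\<lambda>t. J t * \<eta> 0 (t - x) - J x * \<eta> 0 (t - x)) has_integral (A - J x * I)) {0..T}"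
          by (intro has_integral_diff A has_integral_mult_right hI)
        have "norm (integral {0..T} (\<lambda>t. J t * \<eta> 0 (t - x) - J x * \<eta> 0 (t - x)))
            \<le> integral {0..T} (\<lambda>t. e * \<eta> 0 (t - x))"
        proof (rule integral_norm_bound_integral)
          fix y assume y: "y \<in> {0..T}"
          show "norm (J y * \<eta> 0 (y - x) - J x * \<eta> 0 (y - x)) \<le> e * \<eta> 0 (y - x)"
          proof (cases "\<bar>y - x\<bar> < r")
            case True
            then have "\<bar>J y - J x\<bar> * \<eta> 0 (y - x) \<le> e * \<eta> 0 (y - x)"
              using near[OF y] eta0 by (intro mult_right_mono) auto
            then show ?thesis using eta0[of "y - x"] by (simp add: abs_mult flip: left_diff_distrib)
          next
            case False
            then have "\<eta> 0 (y - x) = 0" by (intro \<eta>(2)) auto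
            then show ?thesis by simp
          qed
        qed (use d has_integral_mult_right[OF hI, of e] in blast)+
        also have "\<dots> = e * I" using has_integral_mult_right[OF hI, of e] by blast
        finally have "\<bar>A - J x * I\<bar> \<le> e * I" using integral_unique[OF d] by simp
        then show ?thesis using A by blast
      qed
      obtain A1 where A1: "((\<lambda>t. J t * \<eta> 0 (t - t1)) has_integral A1) {0..T}" "\<bar>A1 - J t1 * I\<bar> \<le> e * I"
        using avg[of t1] rle r(3) by force
      obtain A2 where A2: "((\<lambda>t. J t * \<eta> 0 (t - t2)) has_integral A2) {0..T}" "\<bar>A2 - J t2 * I\<bar> \<le> e * I"
        using avg[of t2] rle r(4) by force
      have "((\<lambda>t. J t * \<psi> 1 t) has_integral (A1 - A2)) {0..T}"
        using has_integral_diff[OF A1(1) A2(1)] by (simp add: \<psi>_def algebra_simps)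
      then have "A1 = A2" using has_integral_unique[OF psi0] by fastforce
      then have "\<bar>J t1 * I - J t2 * I\<bar> \<le> 2 * e * I" using A1(2) A2(2) by (simp add: abs_le_iff)
      then have "\<bar>J t1 - J t2\<bar> * I \<le> 2 * e * I" using I by (simp add: abs_mult flip: left_diff_distrib)
      then show ?thesis using I by simp
    qed
    show ?thesis
    proof (rule ccontr)
      assume "J t1 \<noteq> J t2"
      then show False using close[of "\<bar>J t1 - J t2\<bar> / 4"] by simp
    qed
  qed
  have cJ': "continuous_on (closure {0<..<T}) J" using cJ T by simp
  have "J x = J (T / 2)" if "x \<in> {0..T}" for x
    by (rule continuous_constant_on_closure[OF cJ' J_const]) (use T that in auto)
  moreover have "s \<in> {0..T}" "t \<in> {0..T}" using st by auto
  ultimately have "J t = J s" by metis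
  then have GK: "G t - G s = K t - K s" by (simp add: J_def)
  have "(H has_integral (K t - K s)) {s..t}"
  proof (rule fundamental_theorem_of_calculus[OF st(2)])
    fix x assume "x \<in> {s..t}"
    then have "(K has_real_derivative H x) (at x within {s..t})"
      using st by (intro DERIV_subset[OF dK]) auto
    then show "(K has_vector_derivative H x) (at x within {s..t})"
      by (simp add: has_real_derivative_iff_has_vector_derivative)
  qed
  then show ?thesis using GK by simp
qed


section \<open>Curves in the scale\<close>

context sobolev_scale
begin

definition cont_into :: "real \<Rightarrow> real set \<Rightarrow> (real \<Rightarrow> 'd) \<Rightarrow> bool" where
  "cont_into s S u \<longleftrightarrow> (\<forall>t\<in>S. u t \<in> V s \<and> ((\<lambda>\<tau>. nrm s (u \<tau> - u t)) \<longlongrightarrow> 0) (at t within S))"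

lemma cont_intoD: "cont_into s S u \<Longrightarrow> t \<in> S \<Longrightarrow> u t \<in> V s"
  by (simp add: cont_into_def)

lemma cont_into_subset: "cont_into s S u \<Longrightarrow> S' \<subseteq> S \<Longrightarrow> cont_into s S' u"
  unfolding cont_into_def by (meson subset_iff tendsto_within_subset)

lemma cont_into_if_continuous_map:
  assumes "continuous_map (top_of_set S) (scale_top V nrm s) u"
  shows "cont_into s S u"
proof -
  interpret M: Metric_space "V s" "\<lambda>x y. nrm s (x - y)" by (rule metric_V)
  have u: "t \<in> S \<Longrightarrow> u t \<in> V s" for t
    using continuous_map_image_subset_topspace[OF assms] by auto
  have "((\<lambda>\<tau>. nrm s (u \<tau> - u t)) \<longlongrightarrow> 0) (at t within S)" if t: "t \<in> S" for t
  proof (rule tendstoI)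
    fix e :: real assume e: "e > 0"
    have "\<exists>U. openin (top_of_set S) U \<and> t \<in> U \<and> (\<forall>y\<in>U. u y \<in> M.mball (u t) e)"
      using assms t e unfolding M.continuous_map_to_metric by simp
    then obtain U where U: "openin (top_of_set S) U" "t \<in> U" "\<forall>y\<in>U. u y \<in> M.mball (u t) e"
      by blast
    then obtain W where W: "open W" "U = S \<inter> W" by (auto simp: openin_open)
    then have "\<forall>\<^sub>F \<tau> in at t within S. \<tau> \<in> U"
      using U(2) eventually_at_topological by fastforce
    then show "\<forall>\<^sub>F \<tau> in at t within S. dist (nrm s (u \<tau> - u t)) 0 < e"
      by eventually_elim (use U(3) in \<open>auto simp: M.in_mball nrm_ge_0 nrm_minus_commute\<close>)
  qed
  then show ?thesis using u by (simp add: cont_into_def)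
qed

text \<open>
  The growth factor \<open>nrm s x + nrm s y + 1\<close> covers both linear and quadratic functions of \<open>x\<close>.
\<close>

lemma continuous_on_locally_Lipschitz:
  assumes u: "cont_into s S u"
    and L: "\<And>x y. \<lbrakk>x \<in> V s; y \<in> V s\<rbrakk> \<Longrightarrow> \<bar>f x - f y\<bar> \<le> K * (nrm s x + nrm s y + 1) * nrm s (x - y)"
  shows "continuous_on S (\<lambda>t. f (u t) :: real)"
  unfolding continuous_on_def
proof
  fix t assume t: "t \<in> S"
  let ?n = "\<lambda>\<tau>. nrm s (u \<tau> - u t)"
  have lim: "(?n \<longlongrightarrow> 0) (at t within S)" using u t by (simp add: cont_into_def)
  have "((\<lambda>\<tau>. \<bar>K\<bar> * (?n \<tau> + nrm s (u t) + nrm s (u t) + 1) * ?n \<tau>) \<longlongrightarrow>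
      \<bar>K\<bar> * (0 + nrm s (u t) + nrm s (u t) + 1) * 0) (at t within S)"
    by (intro tendsto_intros lim)
  then have l: "((\<lambda>\<tau>. \<bar>K\<bar> * (?n \<tau> + nrm s (u t) + nrm s (u t) + 1) * ?n \<tau>) \<longlongrightarrow> 0) (at t within S)" by simp
  have "\<forall>\<^sub>F \<tau> in at t within S. norm (f (u \<tau>) - f (u t)) \<le> \<bar>K\<bar> * (?n \<tau> + nrm s (u t) + nrm s (u t) + 1) * ?n \<tau>"
    unfolding eventually_at_filter
  proof (rule always_eventually, safe)
    fix \<tau> assume "\<tau> \<in> S"
    then have V: "u \<tau> \<in> V s" "u t \<in> V s" using u t by (auto simp: cont_into_def)
    have "\<bar>f (u \<tau>) - f (u t)\<bar> \<le> K * (nrm s (u \<tau>) + nrm s (u t) + 1) * ?n \<tau>" by (rule L[OF V])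
    also have "\<dots> \<le> \<bar>K\<bar> * (nrm s (u \<tau>) + nrm s (u t) + 1) * ?n \<tau>"
      using nrm_ge_0[of s "u \<tau>"] nrm_ge_0[of s "u t"] by (intro mult_right_mono nrm_ge_0) auto
    also have "\<dots> \<le> \<bar>K\<bar> * (?n \<tau> + nrm s (u t) + nrm s (u t) + 1) * ?n \<tau>"
      using nrm_le_add[OF V] by (intro mult_right_mono mult_left_mono nrm_ge_0) auto
    finally show "norm (f (u \<tau>) - f (u t)) \<le> \<bar>K\<bar> * (?n \<tau> + nrm s (u t) + nrm s (u t) + 1) * ?n \<tau>" by simp
  qed
  then show "((\<lambda>\<tau>. f (u \<tau>)) \<longlongrightarrow> f (u t)) (at t within S)"
    by (rule LIM_zero_cancel[OF Lim_null_comparison[OF _ l]])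
qed

lemma continuous_on_pr:
  assumes "cont_into s S u" "d \<in> V (- s)"
  shows "continuous_on S (\<lambda>t. pr (u t) d)"
proof (rule continuous_on_locally_Lipschitz[OF assms(1), where f = "\<lambda>x. pr x d" and K = "nrm (- s) d"])
  fix x y assume xy: "x \<in> V s" "y \<in> V s"
  have "\<bar>pr x d - pr y d\<bar> \<le> nrm (- s) d * 1 * nrm s (x - y)"
    using pr_le[OF V_diff[OF xy] assms(2)] pr_diff_left[OF xy assms(2)] by (simp add: mult.commute)
  also have "\<dots> \<le> nrm (- s) d * (nrm s x + nrm s y + 1) * nrm s (x - y)"
    by (intro mult_right_mono mult_left_mono nrm_ge_0) (simp add: nrm_ge_0)
  finally show "\<bar>pr x d - pr y d\<bar> \<le> nrm (- s) d * (nrm s x + nrm s y + 1) * nrm s (x - y)" .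
qed

lemma embedding_const:
  assumes "s \<le> t"
  obtains K where "K > 0" "\<And>x. x \<in> V t \<Longrightarrow> nrm s x \<le> K * nrm t x"
proof -
  obtain K where K: "\<forall>x\<in>V t. nrm s x \<le> K * nrm t x" using V_mono_bound[OF assms] by blast
  have "nrm s x \<le> (\<bar>K\<bar> + 1) * nrm t x" if "x \<in> V t" for x
  proof -
    have "K * nrm t x \<le> (\<bar>K\<bar> + 1) * nrm t x" by (intro mult_right_mono nrm_ge_0) simp
    then show ?thesis using K that by fastforce
  qed
  then show ?thesis by (intro that[of "\<bar>K\<bar> + 1"]) auto
qed

lemma bounded_opD:
  assumes "bounded_op V nrm s t L"
  shows "x \<in> V s \<Longrightarrow> L x \<in> V t" "\<lbrakk>x \<in> V s; y \<in> V s\<rbrakk> \<Longrightarrow> L (x + y) = L x + L y"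
    "x \<in> V s \<Longrightarrow> L (a *\<^sub>R x) = a *\<^sub>R L x" "\<lbrakk>x \<in> V s; y \<in> V s\<rbrakk> \<Longrightarrow> L (x - y) = L x - L y"
proof -
  show 1: "\<lbrakk>x \<in> V s; y \<in> V s\<rbrakk> \<Longrightarrow> L (x + y) = L x + L y" for x y
    using assms by (auto simp: bounded_op_def lin_on_def)
  show "\<lbrakk>x \<in> V s; y \<in> V s\<rbrakk> \<Longrightarrow> L (x - y) = L x - L y"
    using 1[of "x - y" y] by (simp add: V_diff)
qed (use assms in \<open>auto simp: bounded_op_def lin_on_def\<close>)

lemma bounded_op_const:
  assumes "bounded_op V nrm s t L"
  obtains K where "K > 0" "\<And>x. x \<in> V s \<Longrightarrow> nrm t (L x) \<le> K * nrm s x"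
proof -
  obtain K where K: "\<forall>x\<in>V s. nrm t (L x) \<le> K * nrm s x" using assms by (auto simp: bounded_op_def)
  have "nrm t (L x) \<le> (\<bar>K\<bar> + 1) * nrm s x" if "x \<in> V s" for x
  proof -
    have "K * nrm s x \<le> (\<bar>K\<bar> + 1) * nrm s x" by (intro mult_right_mono nrm_ge_0) simp
    then show ?thesis using K that by fastforce
  qed
  then show ?thesis by (intro that[of "\<bar>K\<bar> + 1"]) auto
qed

end


section \<open>The forcing and the linear equation it drives\<close>

locale damped_flow = flow_model Om C G om vol Eb h VV emb V nrm pr Lam \<theta>1 \<theta>2 A0 M N Bbar b0
  for Om :: "'p::t2_space set"
    and C :: "('p, 'f::real_vector, 'n::finite, 'r::finite) bchart set"
    and G om vol Eb h VV
    and emb :: "('p \<Rightarrow> 'f) \<Rightarrow> 'd::real_vector"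
    and V nrm pr Lam \<theta>1 \<theta>2 A0 M N Bbar b0 +
  fixes \<beta> :: real and g
  assumes \<beta>: "- \<theta>2 < \<beta>"
    and coercive_N: "\<exists>c>0. \<forall>v\<in>V (- \<theta>2). pr (A0 v) (N v) \<ge> c * (nrm (- \<theta>2) v)\<^sup>2"
    and coercive_\<beta>: "\<exists>c>0. \<forall>v\<in>V \<beta>. pr (A0 v) (Lam (2 * \<beta>) v) \<ge> c * (nrm \<beta> v)\<^sup>2"
    and b0_bounded: "bounded_trilinear V nrm (- \<theta>2) (- \<theta>2) (- \<beta>) b0"
    and g: "g \<in> V \<beta>"
begin

abbreviation \<alpha> :: real where "\<alpha> \<equiv> - \<theta>2"

lemma V\<beta>_V\<alpha>: "x \<in> V \<beta> \<Longrightarrow> x \<in> V \<alpha>"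
  using V_mono[of \<alpha> \<beta>] \<beta> by auto

lemmas A0_simps = bounded_opD[OF A0_bounded]

lemma b0_linear:
  assumes "u \<in> V \<alpha>" "v \<in> V \<alpha>" "w \<in> V (- \<beta>)"
  shows "u' \<in> V \<alpha> \<Longrightarrow> b0 (u - u') v w = b0 u v w - b0 u' v w"
    and "v' \<in> V \<alpha> \<Longrightarrow> b0 u (v - v') w = b0 u v w - b0 u v' w"
    and "w' \<in> V (- \<beta>) \<Longrightarrow> b0 u v (w + w') = b0 u v w + b0 u v w'"
    and "b0 u v (a *\<^sub>R w) = a * b0 u v w"
proof -
  have l: "lin_on (V \<alpha>) (\<lambda>u. b0 u v w)" "lin_on (V \<alpha>) (\<lambda>v. b0 u v w)" "lin_on (V (- \<beta>)) (\<lambda>w. b0 u v w)"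
    using b0_bounded assms by (auto simp: bounded_trilinear_def)
  show "b0 (u - u') v w = b0 u v w - b0 u' v w" if u': "u' \<in> V \<alpha>"
  proof -
    have "b0 ((u - u') + u') v w = b0 (u - u') v w + b0 u' v w"
      using l(1) V_diff[OF assms(1) u'] u' unfolding lin_on_def by blast
    then show ?thesis by simp
  qed
  show "b0 u (v - v') w = b0 u v w - b0 u v' w" if v': "v' \<in> V \<alpha>"
  proof -
    have "b0 u ((v - v') + v') w = b0 u (v - v') w + b0 u v' w"
      using l(2) V_diff[OF assms(2) v'] v' unfolding lin_on_def by blast
    then show ?thesis by simp
  qed
qed (use b0_bounded assms in \<open>auto simp: bounded_trilinear_def lin_on_def\<close>)

lemma b0_const:
  obtains K where "K > 0"
    "\<And>u v w. \<lbrakk>u \<in> V \<alpha>; v \<in> V \<alpha>; w \<in> V (- \<beta>)\<rbrakk> \<Longrightarrow> \<bar>b0 u v w\<bar> \<le> K * nrm \<alpha> u * nrm \<alpha> v * nrm (- \<beta>) w"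
proof -
  obtain K where K: "\<forall>u\<in>V \<alpha>. \<forall>v\<in>V \<alpha>. \<forall>w\<in>V (- \<beta>). \<bar>b0 u v w\<bar> \<le> K * nrm \<alpha> u * nrm \<alpha> v * nrm (- \<beta>) w"
    using b0_bounded unfolding bounded_trilinear_def by blast
  have "\<bar>b0 u v w\<bar> \<le> (\<bar>K\<bar> + 1) * nrm \<alpha> u * nrm \<alpha> v * nrm (- \<beta>) w"
    if "u \<in> V \<alpha>" "v \<in> V \<alpha>" "w \<in> V (- \<beta>)" for u v w
  proof -
    have "K * nrm \<alpha> u * nrm \<alpha> v * nrm (- \<beta>) w \<le> (\<bar>K\<bar> + 1) * nrm \<alpha> u * nrm \<alpha> v * nrm (- \<beta>) w"
      by (intro mult_right_mono nrm_ge_0) simp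
    then show ?thesis using K that by fastforce
  qed
  then show ?thesis by (intro that[of "\<bar>K\<bar> + 1"]) auto
qed

lemma b0_diff_le:
  assumes K: "\<And>u v w. \<lbrakk>u \<in> V \<alpha>; v \<in> V \<alpha>; w \<in> V (- \<beta>)\<rbrakk> \<Longrightarrow> \<bar>b0 u v w\<bar> \<le> K * nrm \<alpha> u * nrm \<alpha> v * nrm (- \<beta>) w"
    and x: "x \<in> V \<alpha>" and y: "y \<in> V \<alpha>" and w: "w \<in> V (- \<beta>)"
  shows "\<bar>b0 x x w - b0 y y w\<bar> \<le> K * (nrm \<alpha> x + nrm \<alpha> y) * nrm \<alpha> (x - y) * nrm (- \<beta>) w"
proof -
  have "b0 x x w - b0 y y w = b0 x (x - y) w + b0 (x - y) y w"
    using x y w by (simp add: b0_linear)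
  then show ?thesis
    using K[OF x V_diff[OF x y] w] K[OF V_diff[OF x y] y w] by (simp add: algebra_simps)
qed

text \<open>
  The right-hand side \<open>g - B(x, x)\<close> as an element of \<open>V \<beta>\<close>.  On \<open>V \<alpha>\<close>, where the Riesz theorem
  applies to \<open>b0 x x\<close>, the choice is unique by \<open>pr_separates\<close>.
\<close>

definition forcing :: "'d \<Rightarrow> 'd" where
  "forcing x = (SOME z. z \<in> V \<beta> \<and> (\<forall>d\<in>D. pr z d = pr g d - b0 x x d))"

lemma forcing:
  assumes x: "x \<in> V \<alpha>"
  shows "forcing x \<in> V \<beta>" and "d \<in> D \<Longrightarrow> pr (forcing x) d = pr g d - b0 x x d"
proof -
  obtain K where K: "K > 0"
    "\<And>u v w. \<lbrakk>u \<in> V \<alpha>; v \<in> V \<alpha>; w \<in> V (- \<beta>)\<rbrakk> \<Longrightarrow> \<bar>b0 u v w\<bar> \<le> K * nrm \<alpha> u * nrm \<alpha> v * nrm (- \<beta>) w"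
    using b0_const by blast
  have "lin_on D (b0 x x)" using x D_in_V by (auto simp: lin_on_def b0_linear)
  moreover have "0 \<le> K * nrm \<alpha> x * nrm \<alpha> x" using K(1) nrm_ge_0 by simp
  moreover have "\<bar>b0 x x d\<bar> \<le> (K * nrm \<alpha> x * nrm \<alpha> x) * nrm (- \<beta>) d" if "d \<in> D" for d
    using K(2)[OF x x D_in_V[OF that]] .
  ultimately obtain z where z: "z \<in> V \<beta>" "\<And>d. d \<in> D \<Longrightarrow> pr z d = b0 x x d"
    using Riesz_representation[where s = \<beta>] by metis
  have "g - z \<in> V \<beta> \<and> (\<forall>d\<in>D. pr (g - z) d = pr g d - b0 x x d)"
    using z g by (auto simp: V_diff pr_diff_left[OF g z(1) D_in_V])
  then have "forcing x \<in> V \<beta> \<and> (\<forall>d\<in>D. pr (forcing x) d = pr g d - b0 x x d)"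
    unfolding forcing_def by (rule someI)
  then show "forcing x \<in> V \<beta>" "d \<in> D \<Longrightarrow> pr (forcing x) d = pr g d - b0 x x d" by auto
qed

lemma forcing_Lipschitz:
  obtains K where "K > 0"
    "\<And>x y. \<lbrakk>x \<in> V \<alpha>; y \<in> V \<alpha>\<rbrakk> \<Longrightarrow>
      nrm \<beta> (forcing x - forcing y) \<le> K * (nrm \<alpha> x + nrm \<alpha> y) * nrm \<alpha> (x - y)"
proof -
  obtain K where K: "K > 0"
    "\<And>u v w. \<lbrakk>u \<in> V \<alpha>; v \<in> V \<alpha>; w \<in> V (- \<beta>)\<rbrakk> \<Longrightarrow> \<bar>b0 u v w\<bar> \<le> K * nrm \<alpha> u * nrm \<alpha> v * nrm (- \<beta>) w"
    using b0_const by blast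
  show ?thesis
  proof (rule that[OF K(1)])
    fix x y assume x: "x \<in> V \<alpha>" and y: "y \<in> V \<alpha>"
    show "nrm \<beta> (forcing x - forcing y) \<le> K * (nrm \<alpha> x + nrm \<alpha> y) * nrm \<alpha> (x - y)"
    proof (rule nrm_le_dual[OF V_diff[OF forcing(1)[OF x] forcing(1)[OF y]]])
      show "0 \<le> K * (nrm \<alpha> x + nrm \<alpha> y) * nrm \<alpha> (x - y)" using K(1) nrm_ge_0 by simp
      fix d assume d: "d \<in> D"
      have "pr (forcing x - forcing y) d = b0 y y d - b0 x x d"
        using pr_diff_left[OF forcing(1)[OF x] forcing(1)[OF y] D_in_V[OF d]] forcing(2)[OF x d] forcing(2)[OF y d]
        by simp
      then show "\<bar>pr (forcing x - forcing y) d\<bar> \<le> K * (nrm \<alpha> x + nrm \<alpha> y) * nrm \<alpha> (x - y) * nrm (- \<beta>) d"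
        using b0_diff_le[OF K(2) x y D_in_V[OF d]] by (simp add: abs_minus_commute)
    qed
  qed
qed

text \<open>
  The curve \<open>w\<close> solves \<open>w' + A0 w = P\<close> on \<open>[0, T]\<close>, integrated in time and tested with \<open>D\<close>.  \<open>P\<close> is
  only weakly continuous, which suffices to integrate it against each test element.
\<close>

definition driven :: "real \<Rightarrow> (real \<Rightarrow> 'd) \<Rightarrow> (real \<Rightarrow> 'd) \<Rightarrow> bool" where
  "driven T w P \<longleftrightarrow> (\<forall>t\<in>{0..T}. w t \<in> V \<alpha> \<and> P t \<in> V \<beta>) \<and>
     (\<forall>d\<in>D. continuous_on {0..T} (\<lambda>t. pr (P t) d)) \<and>
     (\<forall>d\<in>D. \<forall>s t. 0 \<le> s \<and> s \<le> t \<and> t \<le> T \<longrightarrow>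
        ((\<lambda>\<tau>. pr (P \<tau>) d - pr (A0 (w \<tau>)) d) has_integral pr (w t - w s) d) {s..t})"

lemma drivenD:
  assumes "driven T w P"
  shows "t \<in> {0..T} \<Longrightarrow> w t \<in> V \<alpha>" "t \<in> {0..T} \<Longrightarrow> P t \<in> V \<beta>"
    "\<lbrakk>d \<in> D; 0 \<le> s; t \<le> T\<rbrakk> \<Longrightarrow> (\<lambda>t. pr (P t) d) integrable_on {s..t}"
    "\<lbrakk>d \<in> D; 0 \<le> s; s \<le> t; t \<le> T\<rbrakk> \<Longrightarrow>
        ((\<lambda>\<tau>. pr (P \<tau>) d - pr (A0 (w \<tau>)) d) has_integral pr (w t - w s) d) {s..t}"
proof -
  show "(\<lambda>t. pr (P t) d) integrable_on {s..t}" if "d \<in> D" "0 \<le> s" "t \<le> T"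
  proof (rule integrable_continuous_interval)
    have "continuous_on {0..T} (\<lambda>t. pr (P t) d)" using assms that(1) unfolding driven_def by blast
    then show "continuous_on {s..t} (\<lambda>t. pr (P t) d)"
      by (rule continuous_on_subset) (use that in simp)
  qed
  show "((\<lambda>\<tau>. pr (P \<tau>) d - pr (A0 (w \<tau>)) d) has_integral pr (w t - w s) d) {s..t}"
    if "d \<in> D" "0 \<le> s" "s \<le> t" "t \<le> T"
    using assms that unfolding driven_def by blast
qed (use assms in \<open>simp_all add: driven_def\<close>)

lemma drift:
  assumes dr: "driven T w P"
    and m: "\<And>t. t \<in> {0..T} \<Longrightarrow> nrm \<alpha> (w t) \<le> m" and p: "\<And>t. t \<in> {0..T} \<Longrightarrow> nrm \<beta> (P t) \<le> p"
    and a: "a > 0" "\<And>x. x \<in> V \<alpha> \<Longrightarrow> nrm \<alpha> (A0 x) \<le> a * nrm \<alpha> x"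
    and \<kappa>: "\<kappa> > 0" "\<And>x. x \<in> V \<beta> \<Longrightarrow> nrm \<alpha> x \<le> \<kappa> * nrm \<beta> x"
    and st: "0 \<le> s" "s \<le> t" "t \<le> T"
  shows "nrm \<alpha> (w t - w s) \<le> (\<kappa> * p + a * m) * (t - s)"
proof -
  have s: "s \<in> {0..T}" and t: "t \<in> {0..T}" using st by auto
  have m0: "0 \<le> m" and p0: "0 \<le> p" using m[OF s] p[OF s] nrm_ge_0[of \<alpha> "w s"] nrm_ge_0[of \<beta> "P s"] by linarith+
  have nn: "0 \<le> \<kappa> * p + a * m" using a \<kappa> m0 p0 by simp
  show ?thesis
  proof (rule nrm_le_dual[OF V_diff[OF drivenD(1)[OF dr t] drivenD(1)[OF dr s]]])
    show "0 \<le> (\<kappa> * p + a * m) * (t - s)" using nn st by simp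
    fix d assume d: "d \<in> D"
    have "\<bar>pr (P \<tau>) d - pr (A0 (w \<tau>)) d\<bar> \<le> (\<kappa> * p + a * m) * nrm (- \<alpha>) d" if \<tau>: "\<tau> \<in> {s..t}" for \<tau>
    proof -
      have \<tau>': "\<tau> \<in> {0..T}" using \<tau> st by auto
      note V = V\<beta>_V\<alpha>[OF drivenD(2)[OF dr \<tau>']] A0_simps(1)[OF drivenD(1)[OF dr \<tau>']]
      have "\<bar>pr (P \<tau>) d\<bar> \<le> nrm \<alpha> (P \<tau>) * nrm (- \<alpha>) d" by (rule pr_le[OF V(1) D_in_V[OF d]])
      also have "\<dots> \<le> (\<kappa> * p) * nrm (- \<alpha>) d"
        using \<kappa>(2)[OF drivenD(2)[OF dr \<tau>']] mult_left_mono[OF p[OF \<tau>'] less_imp_le[OF \<kappa>(1)]]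
        by (intro mult_right_mono nrm_ge_0) (rule order_trans)
      finally have 1: "\<bar>pr (P \<tau>) d\<bar> \<le> (\<kappa> * p) * nrm (- \<alpha>) d" .
      have "\<bar>pr (A0 (w \<tau>)) d\<bar> \<le> nrm \<alpha> (A0 (w \<tau>)) * nrm (- \<alpha>) d" by (rule pr_le[OF V(2) D_in_V[OF d]])
      also have "\<dots> \<le> (a * m) * nrm (- \<alpha>) d"
        using a(2)[OF drivenD(1)[OF dr \<tau>']] mult_left_mono[OF m[OF \<tau>'] less_imp_le[OF a(1)]]
        by (intro mult_right_mono nrm_ge_0) (rule order_trans)
      finally show ?thesis using 1 by (simp add: distrib_right)
    qed
    then have "norm (pr (w t - w s) d) \<le> (\<kappa> * p + a * m) * nrm (- \<alpha>) d * measure lborel {s..t}"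
      using nn nrm_ge_0[of "- \<alpha>" d] by (intro has_integral_bound_real[OF _ finite.emptyI drivenD(4)[OF dr d st]]) auto
    then show "\<bar>pr (w t - w s) d\<bar> \<le> (\<kappa> * p + a * m) * (t - s) * nrm (- \<alpha>) d"
      using st by (simp add: mult_ac)
  qed
qed

text \<open>
  The exact equation compared with one explicit Euler step of length \<open>\<delta>\<close>.  The integral of
  \<open>P\<close> over the step is represented by \<open>y\<close> in \<open>V \<beta>\<close>; replacing \<open>A0 (w \<tau>)\<close> by its value at the
  beginning of the step costs \<open>O(\<delta>\<^sup>2)\<close> in \<open>V \<alpha>\<close>, since \<open>w\<close> is Lipschitz there by \<open>drift\<close>.
\<close>

lemma Euler_step:
  assumes dr: "driven T w P"
    and m: "\<And>t. t \<in> {0..T} \<Longrightarrow> nrm \<alpha> (w t) \<le> m" and p: "\<And>t. t \<in> {0..T} \<Longrightarrow> nrm \<beta> (P t) \<le> p"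
    and a: "a > 0" "\<And>x. x \<in> V \<alpha> \<Longrightarrow> nrm \<alpha> (A0 x) \<le> a * nrm \<alpha> x"
    and \<kappa>: "\<kappa> > 0" "\<And>x. x \<in> V \<beta> \<Longrightarrow> nrm \<alpha> x \<le> \<kappa> * nrm \<beta> x"
    and sh: "0 \<le> s" "0 \<le> \<delta>" "s + \<delta> \<le> T"
  shows "\<exists>y\<in>V \<beta>. nrm \<beta> y \<le> \<delta> * p \<and>
    nrm \<alpha> (w (s + \<delta>) - (w s - \<delta> *\<^sub>R A0 (w s)) - y) \<le> \<delta> * (\<delta> * (a * (\<kappa> * p + a * m)))"
proof -
  have s: "s \<in> {0..T}" and t: "s + \<delta> \<in> {0..T}" using sh by auto
  have m0: "0 \<le> m" and p0: "0 \<le> p" using m[OF s] p[OF s] nrm_ge_0[of \<alpha> "w s"] nrm_ge_0[of \<beta> "P s"] by linarith+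
  have nn: "0 \<le> \<kappa> * p + a * m" using a \<kappa> m0 p0 by simp
  define f where "f d = integral {s..s+\<delta>} (\<lambda>\<tau>. pr (P \<tau>) d)" for d
  have int: "(\<lambda>\<tau>. pr (P \<tau>) d) integrable_on {s..s+\<delta>}" if "d \<in> D" for d
    using drivenD(3)[OF dr that] sh by simp
  have PV: "P \<tau> \<in> V \<beta>" if "\<tau> \<in> {s..s+\<delta>}" for \<tau> using drivenD(2)[OF dr] that sh by simp
  have "f (d + d') = f d + f d'" if d: "d \<in> D" "d' \<in> D" for d d'
  proof -
    have "f (d + d') = integral {s..s+\<delta>} (\<lambda>\<tau>. pr (P \<tau>) d + pr (P \<tau>) d')"
      unfolding f_def by (rule integral_cong) (intro pr_add_right[OF PV D_in_V D_in_V] d)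
    then show ?thesis using int d by (simp add: f_def integral_add)
  qed
  moreover have "f (c *\<^sub>R d) = c * f d" if d: "d \<in> D" for c d
  proof -
    have "f (c *\<^sub>R d) = integral {s..s+\<delta>} (\<lambda>\<tau>. c * pr (P \<tau>) d)"
      unfolding f_def by (rule integral_cong) (intro pr_scale_right[OF PV D_in_V] d)
    then show ?thesis by (simp add: f_def)
  qed
  ultimately have lin: "lin_on D f" by (auto simp: lin_on_def)
  have f_bd: "\<bar>f d\<bar> \<le> (\<delta> * p) * nrm (- \<beta>) d" if d: "d \<in> D" for d
  proof -
    have "\<bar>pr (P \<tau>) d\<bar> \<le> p * nrm (- \<beta>) d" if \<tau>: "\<tau> \<in> {s..s+\<delta>}" for \<tau>
    proof -
      have "\<tau> \<in> {0..T}" using \<tau> sh by auto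
      then have "nrm \<beta> (P \<tau>) * nrm (- \<beta>) d \<le> p * nrm (- \<beta>) d"
        by (intro mult_right_mono nrm_ge_0 p)
      then show ?thesis using pr_le[OF PV[OF \<tau>] D_in_V[OF d]] by linarith
    qed
    then have "norm (f d) \<le> p * nrm (- \<beta>) d * measure lborel {s..s+\<delta>}"
      unfolding f_def using p0 nrm_ge_0[of "- \<beta>" d]
      by (intro has_integral_bound_real[OF _ finite.emptyI integrable_integral[OF int[OF d]]]) auto
    then show ?thesis using sh by (simp add: mult_ac)
  qed
  obtain y where y: "y \<in> V \<beta>" "\<And>d. d \<in> D \<Longrightarrow> pr y d = f d" "nrm \<beta> y \<le> \<delta> * p"
    using Riesz_representation[OF lin _ f_bd] sh p0 by (metis mult_nonneg_nonneg)
  note wV = drivenD(1)[OF dr s] drivenD(1)[OF dr t]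
  note AwV = A0_simps(1)[OF wV(1)]
  note yV = V\<beta>_V\<alpha>[OF y(1)]
  have "nrm \<alpha> (w (s + \<delta>) - (w s - \<delta> *\<^sub>R A0 (w s)) - y) \<le> \<delta> * (\<delta> * (a * (\<kappa> * p + a * m)))"
  proof (rule nrm_le_dual)
    show "w (s + \<delta>) - (w s - \<delta> *\<^sub>R A0 (w s)) - y \<in> V \<alpha>"
      by (intro V_diff V_scale wV AwV yV)
    show "0 \<le> \<delta> * (\<delta> * (a * (\<kappa> * p + a * m)))" using sh a nn by simp
    fix d assume d: "d \<in> D"
    note dV = D_in_V[OF d, of "- \<alpha>"]
    have const: "((\<lambda>\<tau>. pr (A0 (w s)) d) has_integral \<delta> * pr (A0 (w s)) d) {s..s + \<delta>}"
      using has_integral_const_real[of "pr (A0 (w s)) d" s "s + \<delta>"] sh by simp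
    have "((\<lambda>\<tau>. (pr (P \<tau>) d - pr (A0 (w \<tau>)) d) - pr (P \<tau>) d + pr (A0 (w s)) d) has_integral
        (pr (w (s + \<delta>) - w s) d - f d + \<delta> * pr (A0 (w s)) d)) {s..s+\<delta>}"
      unfolding f_def using sh
      by (intro has_integral_add has_integral_diff drivenD(4)[OF dr d] integrable_integral[OF int[OF d]]
          const) auto
    moreover have "pr (w (s + \<delta>) - w s) d - f d + \<delta> * pr (A0 (w s)) d
        = pr (w (s + \<delta>) - (w s - \<delta> *\<^sub>R A0 (w s)) - y) d"
      using wV AwV yV dV y(2)[OF d]
      by (simp add: pr_diff_left[where s = \<alpha>] pr_scale_left[where s = \<alpha>] V_diff V_scale)
    ultimately have I: "((\<lambda>\<tau>. pr (A0 (w s)) d - pr (A0 (w \<tau>)) d) has_integral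
        pr (w (s + \<delta>) - (w s - \<delta> *\<^sub>R A0 (w s)) - y) d) {s..s+\<delta>}"
      by (simp add: algebra_simps)
    have "\<bar>pr (A0 (w s)) d - pr (A0 (w \<tau>)) d\<bar> \<le> a * ((\<kappa> * p + a * m) * \<delta>) * nrm (- \<alpha>) d"
      if \<tau>: "\<tau> \<in> {s..s+\<delta>}" for \<tau>
    proof -
      have w\<tau>: "w \<tau> \<in> V \<alpha>" using drivenD(1)[OF dr] \<tau> sh by simp
      note z = V_diff[OF w\<tau> wV(1)]
      have "pr (A0 (w \<tau>)) d - pr (A0 (w s)) d = pr (A0 (w \<tau> - w s)) d"
        using A0_simps(4)[OF w\<tau> wV(1)] pr_diff_left[OF A0_simps(1)[OF w\<tau>] AwV dV] by simp
      then have "\<bar>pr (A0 (w s)) d - pr (A0 (w \<tau>)) d\<bar> \<le> nrm \<alpha> (A0 (w \<tau> - w s)) * nrm (- \<alpha>) d"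
        using pr_le[OF A0_simps(1)[OF z] dV] by (simp add: abs_minus_commute)
      also have "\<dots> \<le> (a * nrm \<alpha> (w \<tau> - w s)) * nrm (- \<alpha>) d"
        by (intro mult_right_mono nrm_ge_0 a z)
      also have "nrm \<alpha> (w \<tau> - w s) \<le> (\<kappa> * p + a * m) * (\<tau> - s)"
        using \<tau> sh by (intro drift[OF dr m p a \<kappa>]) auto
      also have "\<dots> \<le> (\<kappa> * p + a * m) * \<delta>" using nn \<tau> by (intro mult_left_mono) auto
      finally show ?thesis using a(1) by (simp add: nrm_ge_0 mult_left_mono mult_right_mono)
    qed
    then have "norm (pr (w (s + \<delta>) - (w s - \<delta> *\<^sub>R A0 (w s)) - y) d)
        \<le> a * ((\<kappa> * p + a * m) * \<delta>) * nrm (- \<alpha>) d * measure lborel {s..s+\<delta>}"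
      using nn a sh nrm_ge_0[of "- \<alpha>" d] by (intro has_integral_bound_real[OF _ finite.emptyI I]) auto
    then show "\<bar>pr (w (s + \<delta>) - (w s - \<delta> *\<^sub>R A0 (w s)) - y) d\<bar> \<le> \<delta> * (\<delta> * (a * (\<kappa> * p + a * m))) * nrm (- \<alpha>) d"
      using sh by (simp add: mult_ac)
  qed
  then show ?thesis using y by blast
qed


end


section \<open>Splitting into a decaying and a regular part\<close>

context damped_flow
begin

text \<open>
  Coercivity of \<open>A0\<close> on \<open>V \<alpha>\<close> is assumed against \<open>N v\<close>, so decay there is measured in the
  norm that \<open>N\<close> defines; \<open>N_form_equiv\<close> compares it with \<open>nrm \<alpha>\<close>.
\<close>

lemma semi_inner_N: "semi_inner (V \<alpha>) (\<lambda>x y. pr (N x) y)"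
proof
  note NV = bounded_opD(1)[OF N_bounded[of \<alpha>]]
  show "pr (N x) y = pr (N y) x" if "x \<in> V \<alpha>" "y \<in> V \<alpha>" for x y
    using N_self_adjoint[of x \<alpha> y] pr_sym[of x \<alpha> "N y"] NV that by simp
  show "lin_on (V \<alpha>) (\<lambda>x. pr (N x) y)" if y: "y \<in> V \<alpha>" for y
    using NV y bounded_opD(2,3)[OF N_bounded[of \<alpha>]]
    by (auto simp: lin_on_def pr_add_left[where s = "- \<alpha>"] pr_scale_left[where s = "- \<alpha>"])
  obtain c where "c > 0" "\<forall>v\<in>V \<alpha>. c * (nrm \<alpha> v)\<^sup>2 \<le> pr (N v) v" using N_coercive by blast
  then show "0 \<le> pr (N x) x" if "x \<in> V \<alpha>" for x
    using that by (meson less_imp_le mult_nonneg_nonneg order_trans zero_le_power2)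
qed (rule V_subspace)

lemma N_form_equiv:
  obtains l u where "l > 0" "u > 0"
    "\<And>x. x \<in> V \<alpha> \<Longrightarrow> l * nrm \<alpha> x \<le> sqrt (pr (N x) x)" "\<And>x. x \<in> V \<alpha> \<Longrightarrow> sqrt (pr (N x) x) \<le> u * nrm \<alpha> x"
proof -
  obtain c where c: "c > 0" "\<forall>v\<in>V \<alpha>. c * (nrm \<alpha> v)\<^sup>2 \<le> pr (N v) v" using N_coercive by blast
  obtain K where K: "K > 0" "\<And>x. x \<in> V \<alpha> \<Longrightarrow> nrm (\<alpha> + 2 * \<theta>2) (N x) \<le> K * nrm \<alpha> x"
    using bounded_op_const[OF N_bounded[of \<alpha>]] by blast
  show ?thesis
  proof (rule that[of "sqrt c" "sqrt K"])
    fix x assume x: "x \<in> V \<alpha>"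
    have "sqrt (c * (nrm \<alpha> x)\<^sup>2) \<le> sqrt (pr (N x) x)" using c x by (intro real_sqrt_le_mono) auto
    then show "sqrt c * nrm \<alpha> x \<le> sqrt (pr (N x) x)" by (simp add: real_sqrt_mult nrm_ge_0)
    have NV: "N x \<in> V (- \<alpha>)" using bounded_opD(1)[OF N_bounded[of \<alpha>] x] by simp
    have "pr (N x) x \<le> nrm (- \<alpha>) (N x) * nrm \<alpha> x" using pr_le[OF NV, of x] x by simp
    also have "\<dots> \<le> (K * nrm \<alpha> x) * nrm \<alpha> x" using K(2)[OF x] by (intro mult_right_mono nrm_ge_0) simp
    finally have "sqrt (pr (N x) x) \<le> sqrt (K * (nrm \<alpha> x)\<^sup>2)"
      by (intro real_sqrt_le_mono) (simp add: power2_eq_square mult.assoc)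
    then show "sqrt (pr (N x) x) \<le> sqrt K * nrm \<alpha> x" by (simp add: real_sqrt_mult nrm_ge_0)
  qed (use c K in auto)
qed

lemma Euler_contraction_\<beta>:
  "\<exists>c>0. \<exists>h0>0. \<forall>\<delta>. 0 < \<delta> \<and> \<delta> \<le> h0 \<longrightarrow> \<delta> * c \<le> 1 \<and>
    (\<forall>x\<in>V \<beta>. nrm \<beta> (x - \<delta> *\<^sub>R A0 x) \<le> (1 - \<delta> * (c / 2)) * nrm \<beta> x)"
proof -
  interpret I: semi_inner "V \<beta>" "\<lambda>x y. pr x (Lam (2 * \<beta>) y)" by (rule semi_inner_V)
  obtain c where c: "c > 0" "\<forall>v\<in>V \<beta>. c * (nrm \<beta> v)\<^sup>2 \<le> pr (A0 v) (Lam (2 * \<beta>) v)"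
    using coercive_\<beta> by blast
  obtain a where a: "a > 0" "\<And>x. x \<in> V \<beta> \<Longrightarrow> nrm \<beta> (A0 x) \<le> a * nrm \<beta> x"
    using bounded_op_const[OF A0_bounded] by blast
  have sq: "sqrt (pr x (Lam (2 * \<beta>) x)) = nrm \<beta> x" if "x \<in> V \<beta>" for x
    using nrm_sq[OF that] nrm_ge_0 by (metis real_sqrt_unique)
  have "\<exists>h0>0. \<forall>\<delta>. 0 < \<delta> \<and> \<delta> \<le> h0 \<longrightarrow> \<delta> * c \<le> 1 \<and> (\<forall>x\<in>V \<beta>.
    sqrt (pr (x - \<delta> *\<^sub>R A0 x) (Lam (2 * \<beta>) (x - \<delta> *\<^sub>R A0 x))) \<le> (1 - \<delta> * (c / 2)) * sqrt (pr x (Lam (2 * \<beta>) x)))"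
  proof (rule I.Euler_contraction[where K = "a\<^sup>2"])
    fix x assume x: "x \<in> V \<beta>"
    show Ax: "A0 x \<in> V \<beta>" by (rule A0_simps(1)[OF x])
    show "c * pr x (Lam (2 * \<beta>) x) \<le> pr x (Lam (2 * \<beta>) (A0 x))"
      using bspec[OF c(2) x] unfolding I.sym[OF x Ax] nrm_sq[OF x] .
    have "(nrm \<beta> (A0 x))\<^sup>2 \<le> (a * nrm \<beta> x)\<^sup>2" by (intro power_mono a x nrm_ge_0)
    then show "pr (A0 x) (Lam (2 * \<beta>) (A0 x)) \<le> a\<^sup>2 * pr x (Lam (2 * \<beta>) x)"
      using nrm_sq[OF x] nrm_sq[OF Ax] by (simp add: power_mult_distrib)
  qed (rule c)
  then show ?thesis using c(1) sq by (auto simp: V_diff V_scale A0_simps(1))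
qed

lemma Euler_contraction_N:
  "\<exists>c>0. \<exists>h0>0. \<forall>\<delta>. 0 < \<delta> \<and> \<delta> \<le> h0 \<longrightarrow> \<delta> * c \<le> 1 \<and>
    (\<forall>x\<in>V \<alpha>. sqrt (pr (N (x - \<delta> *\<^sub>R A0 x)) (x - \<delta> *\<^sub>R A0 x)) \<le> (1 - \<delta> * (c / 2)) * sqrt (pr (N x) x))"
proof -
  interpret I: semi_inner "V \<alpha>" "\<lambda>x y. pr (N x) y" by (rule semi_inner_N)
  obtain c where c: "c > 0" "\<forall>v\<in>V \<alpha>. c * (nrm \<alpha> v)\<^sup>2 \<le> pr (A0 v) (N v)"
    using coercive_N by blast
  obtain a where a: "a > 0" "\<And>x. x \<in> V \<alpha> \<Longrightarrow> nrm \<alpha> (A0 x) \<le> a * nrm \<alpha> x"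
    using bounded_op_const[OF A0_bounded] by blast
  obtain l u where lu: "l > 0" "u > 0"
    "\<And>x. x \<in> V \<alpha> \<Longrightarrow> l * nrm \<alpha> x \<le> sqrt (pr (N x) x)" "\<And>x. x \<in> V \<alpha> \<Longrightarrow> sqrt (pr (N x) x) \<le> u * nrm \<alpha> x"
    using N_form_equiv by blast
  have up: "pr (N x) x \<le> u\<^sup>2 * (nrm \<alpha> x)\<^sup>2" if "x \<in> V \<alpha>" for x
    using power_mono[OF lu(4)[OF that], of 2] I.nonneg[OF that] by (simp add: power_mult_distrib)
  have lo: "l\<^sup>2 * (nrm \<alpha> x)\<^sup>2 \<le> pr (N x) x" if "x \<in> V \<alpha>" for x
    using power_mono[OF lu(3)[OF that], of 2] I.nonneg[OF that] lu(1) nrm_ge_0[of \<alpha> x]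
    by (simp add: power_mult_distrib)
  have "\<exists>h0>0. \<forall>\<delta>. 0 < \<delta> \<and> \<delta> \<le> h0 \<longrightarrow> \<delta> * (c / u\<^sup>2) \<le> 1 \<and> (\<forall>x\<in>V \<alpha>.
    sqrt (pr (N (x - \<delta> *\<^sub>R A0 x)) (x - \<delta> *\<^sub>R A0 x)) \<le> (1 - \<delta> * (c / u\<^sup>2 / 2)) * sqrt (pr (N x) x))"
  proof (rule I.Euler_contraction[where K = "u\<^sup>2 * a\<^sup>2 / l\<^sup>2"])
    show "0 < c / u\<^sup>2" using c lu by simp
    fix x assume x: "x \<in> V \<alpha>"
    show Ax: "A0 x \<in> V \<alpha>" by (rule A0_simps(1)[OF x])
    have NV: "N x \<in> V (- \<alpha>)" using bounded_opD(1)[OF N_bounded[of \<alpha>] x] by simp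
    have "c / u\<^sup>2 * pr (N x) x \<le> c / u\<^sup>2 * (u\<^sup>2 * (nrm \<alpha> x)\<^sup>2)"
      using up[OF x] c lu by (intro mult_left_mono) auto
    also have "\<dots> = c * (nrm \<alpha> x)\<^sup>2" using lu by simp
    also have "\<dots> \<le> pr (A0 x) (N x)" using c x by blast
    also have "\<dots> = pr (N x) (A0 x)" by (rule pr_sym[OF Ax NV])
    finally show "c / u\<^sup>2 * pr (N x) x \<le> pr (N x) (A0 x)" .
    have "pr (N (A0 x)) (A0 x) \<le> u\<^sup>2 * (a * nrm \<alpha> x)\<^sup>2"
      using up[OF Ax] a(2)[OF x] power_mono[OF a(2)[OF x] nrm_ge_0, of 2] lu(2)
      by (meson mult_left_mono order_trans zero_le_power2)
    also have "\<dots> = u\<^sup>2 * a\<^sup>2 / l\<^sup>2 * (l\<^sup>2 * (nrm \<alpha> x)\<^sup>2)" using lu(1) by (simp add: power_mult_distrib)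
    also have "\<dots> \<le> u\<^sup>2 * a\<^sup>2 / l\<^sup>2 * pr (N x) x" using lo[OF x] by (intro mult_left_mono) auto
    finally show "pr (N (A0 x)) (A0 x) \<le> u\<^sup>2 * a\<^sup>2 / l\<^sup>2 * pr (N x) x" .
  qed
  moreover have "c / u\<^sup>2 > 0" using c lu by simp
  ultimately show ?thesis by blast
qed

text \<open>
  Duhamel's formula without the integral: along an Euler grid the part \<open>v\<close> driven by \<open>P\<close> from
  \<open>0\<close> stays in \<open>V \<beta>\<close> with the bound \<open>p / c\<close> of a geometric series, independent of \<open>T\<close>, while the remainder
  \<open>w - v\<close> contracts in the norm of \<open>N\<close>.  The local errors are \<open>O(\<delta>\<^sup>2)\<close> and also sum
  up geometrically, to \<open>O(\<delta>)\<close>; \<open>\<epsilon>\<close> absorbs them.  Because \<open>\<epsilon>\<close> is arbitrary and \<open>K\<close> does not depend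
  on it, nothing is lost against the exact formula.
\<close>

theorem splitting:
  "\<exists>c>0. \<exists>K>0. \<forall>T>0. \<forall>w P m p \<epsilon>. driven T w P \<longrightarrow> \<epsilon> > 0 \<longrightarrow>
    (\<forall>t\<in>{0..T}. nrm \<alpha> (w t) \<le> m \<and> nrm \<beta> (P t) \<le> p) \<longrightarrow>
    (\<exists>v\<in>V \<beta>. nrm \<beta> v \<le> K * p \<and> nrm \<alpha> (w T - v) \<le> K * exp (- c * T) * nrm \<alpha> (w 0) + \<epsilon>)"
proof -
  let ?n = "\<lambda>x. sqrt (pr (N x) x)"
  interpret I: semi_inner "V \<alpha>" "\<lambda>x y. pr (N x) y" by (rule semi_inner_N)
  obtain c1 h1 where 1: "c1 > 0" "h1 > 0" "\<And>\<delta>. \<lbrakk>0 < \<delta>; \<delta> \<le> h1\<rbrakk> \<Longrightarrow> \<delta> * c1 \<le> 1"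
    "\<And>\<delta> x. \<lbrakk>0 < \<delta>; \<delta> \<le> h1; x \<in> V \<beta>\<rbrakk> \<Longrightarrow> nrm \<beta> (x - \<delta> *\<^sub>R A0 x) \<le> (1 - \<delta> * (c1 / 2)) * nrm \<beta> x"
    using Euler_contraction_\<beta> by blast
  obtain c2 h2 where 2: "c2 > 0" "h2 > 0" "\<And>\<delta>. \<lbrakk>0 < \<delta>; \<delta> \<le> h2\<rbrakk> \<Longrightarrow> \<delta> * c2 \<le> 1"
    "\<And>\<delta> x. \<lbrakk>0 < \<delta>; \<delta> \<le> h2; x \<in> V \<alpha>\<rbrakk> \<Longrightarrow> ?n (x - \<delta> *\<^sub>R A0 x) \<le> (1 - \<delta> * (c2 / 2)) * ?n x"
    using Euler_contraction_N by blast
  define c where "c = min (c1 / 2) (c2 / 2)"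
  have c: "c > 0" "c \<le> c1 / 2" "c \<le> c2 / 2" using 1(1) 2(1) by (auto simp: c_def)
  define h0 where "h0 = min h1 h2"
  have h0: "h0 > 0" using 1 2 by (simp add: h0_def)
  have con\<beta>: "nrm \<beta> (x - \<delta> *\<^sub>R A0 x) \<le> (1 - \<delta> * c) * nrm \<beta> x" if "0 < \<delta>" "\<delta> \<le> h0" "x \<in> V \<beta>" for \<delta> x
  proof -
    have "nrm \<beta> (x - \<delta> *\<^sub>R A0 x) \<le> (1 - \<delta> * (c1 / 2)) * nrm \<beta> x" using 1(4) that by (simp add: h0_def)
    also have "\<dots> \<le> (1 - \<delta> * c) * nrm \<beta> x" using c that by (intro mult_right_mono nrm_ge_0) auto
    finally show ?thesis .
  qed
  have con\<alpha>: "?n (x - \<delta> *\<^sub>R A0 x) \<le> (1 - \<delta> * c) * ?n x" if "0 < \<delta>" "\<delta> \<le> h0" "x \<in> V \<alpha>" for \<delta> x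
  proof -
    have "?n (x - \<delta> *\<^sub>R A0 x) \<le> (1 - \<delta> * (c2 / 2)) * ?n x" using 2(4) that by (simp add: h0_def)
    also have "\<dots> \<le> (1 - \<delta> * c) * ?n x" using c that I.nonneg by (intro mult_right_mono) auto
    finally show ?thesis .
  qed
  have hc: "0 \<le> 1 - \<delta> * c" if "0 < \<delta>" "\<delta> \<le> h0" for \<delta>
  proof -
    have "\<delta> * c \<le> \<delta> * c1" using c 1(1) that by (intro mult_left_mono) auto
    moreover have "\<delta> * c1 \<le> 1" using 1(3)[of \<delta>] that by (simp add: h0_def)
    ultimately show ?thesis by linarith
  qed
  obtain l u where lu: "l > 0" "u > 0"
    "\<And>x. x \<in> V \<alpha> \<Longrightarrow> l * nrm \<alpha> x \<le> ?n x" "\<And>x. x \<in> V \<alpha> \<Longrightarrow> ?n x \<le> u * nrm \<alpha> x"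
    using N_form_equiv by blast
  obtain a where a: "a > 0" "\<And>x. x \<in> V \<alpha> \<Longrightarrow> nrm \<alpha> (A0 x) \<le> a * nrm \<alpha> x"
    using bounded_op_const[OF A0_bounded] by blast
  obtain \<kappa> where \<kappa>: "\<kappa> > 0" "\<And>x. x \<in> V \<beta> \<Longrightarrow> nrm \<alpha> x \<le> \<kappa> * nrm \<beta> x"
    using embedding_const[of \<alpha> \<beta>] \<beta> by (metis less_imp_le)
  define K where "K = max (1 / c) (u / l)"
  have K: "K > 0" "1 / c \<le> K" "u / l \<le> K" using c lu by (auto simp: K_def max_def)
  have "\<exists>v\<in>V \<beta>. nrm \<beta> v \<le> K * p \<and> nrm \<alpha> (w T - v) \<le> K * exp (- c * T) * nrm \<alpha> (w 0) + \<epsilon>"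
    if T: "T > 0" and dr: "driven T w P" and \<epsilon>: "\<epsilon> > 0"
      and bd: "\<forall>t\<in>{0..T}. nrm \<alpha> (w t) \<le> m \<and> nrm \<beta> (P t) \<le> p" for T w P m p \<epsilon>
  proof -
    have m: "\<And>t. t \<in> {0..T} \<Longrightarrow> nrm \<alpha> (w t) \<le> m" and p: "\<And>t. t \<in> {0..T} \<Longrightarrow> nrm \<beta> (P t) \<le> p"
      using bd by auto
    have mp: "0 \<le> m" "0 \<le> p"
      using m[of 0] p[of 0] T nrm_ge_0[of \<alpha> "w 0"] nrm_ge_0[of \<beta> "P 0"] by auto
    define e where "e = u * (a * (\<kappa> * p + a * m))"
    have e0: "e \<ge> 0" unfolding e_def using a \<kappa> lu mp by simp
    \<comment> \<open>the first summand keeps the step below \<open>h0\<close>, the second makes the accumulated error at most \<open>\<epsilon>\<close>\<close>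
    obtain n :: nat where n: "T / h0 + T * e / (c * l * \<epsilon>) < real n" using reals_Archimedean2 by blast
    define \<delta> where "\<delta> = T / real n"
    have q: "0 < T / h0" "0 \<le> T * e / (c * l * \<epsilon>)" using T h0 e0 c lu \<epsilon> by simp_all
    have n0: "real n > 0" using n q by linarith
    have \<delta>: "0 < \<delta>" "real n * \<delta> = T" using n0 T by (auto simp: \<delta>_def)
    have \<delta>h: "\<delta> \<le> h0"
    proof -
      have "T / h0 < real n" using n q by linarith
      then show ?thesis using h0 n0 by (simp add: \<delta>_def field_simps)
    qed
    have \<delta>e: "\<delta> * e / c \<le> l * \<epsilon>"
    proof -
      have "T * e / (c * l * \<epsilon>) < real n" using n q by linarith
      then have "T * e \<le> real n * (c * l * \<epsilon>)" using c lu \<epsilon> by (simp add: field_simps)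
      then show ?thesis using n0 c by (simp add: \<delta>_def field_simps)
    qed
    define q where "q = 1 - \<delta> * c"
    have q0: "0 \<le> q" unfolding q_def using hc \<delta> \<delta>h by blast
    \<comment> \<open>both \<open>p / c\<close> and \<open>\<delta> * e / c\<close> are fixed points of one step: \<open>q (p / c) + \<delta> p = p / c\<close>\<close>
    have iter: "\<exists>v\<in>V \<beta>. nrm \<beta> v \<le> p / c \<and> ?n (w (real k * \<delta>) - v) \<le> q ^ k * ?n (w 0) + \<delta> * e / c"
      if "k \<le> n" for k
      using that
    proof (induction k)
      case 0
      show ?case using mp c \<delta> e0 by (intro bexI[of _ 0]) (auto simp: V_0 nrm_0)
    next
      case (Suc k)
      then obtain v where v: "v \<in> V \<beta>" "nrm \<beta> v \<le> p / c" "?n (w (real k * \<delta>) - v) \<le> q ^ k * ?n (w 0) + \<delta> * e / c"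
        by auto
      let ?s = "real k * \<delta>"
      have Sk: "real (Suc k) * \<delta> = ?s + \<delta>" by (simp add: algebra_simps)
      have "real (Suc k) * \<delta> \<le> real n * \<delta>" using Suc.prems \<delta> by (intro mult_right_mono) auto
      then have s: "0 \<le> ?s" "0 \<le> \<delta>" "?s + \<delta> \<le> T" using \<delta> Sk by auto
      obtain y where y: "y \<in> V \<beta>" "nrm \<beta> y \<le> \<delta> * p"
        "nrm \<alpha> (w (?s + \<delta>) - (w ?s - \<delta> *\<^sub>R A0 (w ?s)) - y) \<le> \<delta> * (\<delta> * (a * (\<kappa> * p + a * m)))"
        using Euler_step[OF dr m p a \<kappa> s] by blast
      have wV: "w ?s \<in> V \<alpha>" "w (?s + \<delta>) \<in> V \<alpha>" using drivenD(1)[OF dr] s \<delta> by auto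
      let ?L = "\<lambda>x. x - \<delta> *\<^sub>R A0 x"
      have LV: "?L x \<in> V s" if "x \<in> V s" for x s using that by (intro V_diff V_scale A0_simps(1))
      let ?r = "w (?s + \<delta>) - ?L (w ?s) - y"
      have rV: "?r \<in> V \<alpha>" by (intro V_diff LV wV V\<beta>_V\<alpha> y)
      have vV: "w ?s - v \<in> V \<alpha>" by (intro V_diff wV V\<beta>_V\<alpha> v)
      show ?case
      proof (intro bexI[of _ "?L v + y"] conjI)
        show "?L v + y \<in> V \<beta>" by (intro V_add LV v y)
        have "nrm \<beta> (?L v + y) \<le> nrm \<beta> (?L v) + nrm \<beta> y" by (intro nrm_triangle LV v y)
        also have "\<dots> \<le> q * (p / c) + \<delta> * p"
          using con\<beta>[OF \<delta>(1) \<delta>h v(1)] mult_left_mono[OF v(2) q0] y(2) by (simp add: q_def)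
        also have "\<dots> = p / c" using c by (simp add: q_def field_simps)
        finally show "nrm \<beta> (?L v + y) \<le> p / c" .
        have eq: "w (real (Suc k) * \<delta>) - (?L v + y) = ?L (w ?s - v) + ?r"
          using A0_simps(4)[OF wV(1) V\<beta>_V\<alpha>[OF v(1)]] unfolding Sk by (simp add: scaleR_diff_right)
        have "?n (w (real (Suc k) * \<delta>) - (?L v + y)) \<le> ?n (?L (w ?s - v)) + ?n ?r"
          unfolding eq by (rule I.sqrt_triangle[OF LV[OF vV] rV])
        also have "\<dots> \<le> q * (q ^ k * ?n (w 0) + \<delta> * e / c) + \<delta> * (\<delta> * e)"
        proof (rule add_mono)
          show "?n (?L (w ?s - v)) \<le> q * (q ^ k * ?n (w 0) + \<delta> * e / c)"
            using con\<alpha>[OF \<delta>(1) \<delta>h vV] mult_left_mono[OF v(3) q0] by (simp add: q_def)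
          have "?n ?r \<le> u * nrm \<alpha> ?r" by (rule lu(4)[OF rV])
          also have "\<dots> \<le> u * (\<delta> * (\<delta> * (a * (\<kappa> * p + a * m))))" using y(3) lu by (intro mult_left_mono) auto
          finally show "?n ?r \<le> \<delta> * (\<delta> * e)" by (simp add: e_def mult_ac)
        qed
        also have "\<dots> = q ^ Suc k * ?n (w 0) + \<delta> * e / c" using c by (simp add: q_def field_simps)
        finally show "?n (w (real (Suc k) * \<delta>) - (?L v + y)) \<le> q ^ Suc k * ?n (w 0) + \<delta> * e / c" .
      qed
    qed
    obtain v where v: "v \<in> V \<beta>" "nrm \<beta> v \<le> p / c" "?n (w T - v) \<le> q ^ n * ?n (w 0) + \<delta> * e / c"
      using iter[of n] \<delta>(2) by auto
    have wV: "w T \<in> V \<alpha>" "w 0 \<in> V \<alpha>" using drivenD(1)[OF dr] T by auto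
    have "q \<le> exp (- (\<delta> * c))" using exp_ge_add_one_self[of "- (\<delta> * c)"] by (simp add: q_def)
    then have "q ^ n \<le> exp (- (\<delta> * c)) ^ n" using q0 by (rule power_mono)
    also have "\<dots> = exp (- c * T)" using \<delta>(2) by (simp flip: exp_of_nat_mult add: mult_ac)
    finally have qn: "q ^ n \<le> exp (- c * T)" .
    have "l * nrm \<alpha> (w T - v) \<le> ?n (w T - v)" by (rule lu(3)[OF V_diff[OF wV(1) V\<beta>_V\<alpha>[OF v(1)]]])
    also have "\<dots> \<le> exp (- c * T) * (u * nrm \<alpha> (w 0)) + l * \<epsilon>"
      using v(3) \<delta>e mult_mono[OF qn lu(4)[OF wV(2)]] I.nonneg[OF wV(2)] by simp
    finally have "nrm \<alpha> (w T - v) \<le> u / l * (exp (- c * T) * nrm \<alpha> (w 0)) + \<epsilon>"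
      using lu by (simp add: field_simps)
    also have "\<dots> \<le> K * (exp (- c * T) * nrm \<alpha> (w 0)) + \<epsilon>"
      using K by (intro add_right_mono mult_right_mono) (auto simp: nrm_ge_0)
    finally have "nrm \<alpha> (w T - v) \<le> K * exp (- c * T) * nrm \<alpha> (w 0) + \<epsilon>" by (simp add: mult.assoc)
    moreover have "nrm \<beta> v \<le> K * p" using v(2) mult_right_mono[OF K(2) mp(2)] by simp
    ultimately show ?thesis using v(1) by blast
  qed
  then show ?thesis using c(1) K(1) by blast
qed

end


section \<open>Weak solutions as driven curves\<close>

lemma integral_lebesgue_on_open_interval:
  fixes f :: "real \<Rightarrow> real"
  assumes "continuous_on {a..b} f"
  shows "integral\<^sup>L (lebesgue_on {a<..<b}) f = integral {a..b} f"
proof -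
  have "set_integrable lebesgue {a<..<b} f"
    by (rule set_integrable_subset[OF absolutely_integrable_continuous_real[OF assms]]) auto
  then have "(LINT x:{a<..<b}|lebesgue. f x) = integral {a<..<b} f"
    by (rule set_lebesgue_integral_eq_integral)
  then show ?thesis
    by (simp add: integral_restrict_space set_lebesgue_integral_def integral_open_interval_real)
qed

context sobolev_scale
begin

lemma test_function_scaleR:
  assumes d: "d \<in> D" and ab: "0 < a" "b < T"
    and \<psi>: "\<And>k t. (\<psi> k has_real_derivative \<psi> (Suc k) t) (at t)"
      "\<And>k t. t \<notin> {a..b} \<Longrightarrow> \<psi> k t = 0"
  shows "test_function nrm D T (\<lambda>k t. \<psi> k t *\<^sub>R d)"
  unfolding test_function_def
proof (intro conjI allI)
  show "\<psi> k t *\<^sub>R d \<in> D" for k t using d by (rule D_scale)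
  show "\<exists>a b. 0 < a \<and> b < T \<and> (\<forall>k t. t \<notin> {a..b} \<longrightarrow> \<psi> k t *\<^sub>R d = 0)"
    using ab \<psi>(2) by (intro exI[of _ a] exI[of _ b]) auto
  fix k s t
  have "((\<lambda>\<tau>. (\<psi> k (t + \<tau>) - \<psi> k t) / \<tau>) \<longlongrightarrow> \<psi> (Suc k) t) (at 0)"
    using \<psi>(1)[of k t] by (simp add: DERIV_def)
  then have "((\<lambda>\<tau>. \<bar>(\<psi> k (t + \<tau>) - \<psi> k t) / \<tau> - \<psi> (Suc k) t\<bar> * nrm s d) \<longlongrightarrow>
      \<bar>\<psi> (Suc k) t - \<psi> (Suc k) t\<bar> * nrm s d) (at 0)"
    by (intro tendsto_intros)
  moreover have "nrm s ((\<psi> k (t + \<tau>) *\<^sub>R d - \<psi> k t *\<^sub>R d) /\<^sub>R \<tau> - \<psi> (Suc k) t *\<^sub>R d)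
      = \<bar>(\<psi> k (t + \<tau>) - \<psi> k t) / \<tau> - \<psi> (Suc k) t\<bar> * nrm s d" for \<tau>
  proof -
    have "(\<psi> k (t + \<tau>) *\<^sub>R d - \<psi> k t *\<^sub>R d) /\<^sub>R \<tau> - \<psi> (Suc k) t *\<^sub>R d
        = ((\<psi> k (t + \<tau>) - \<psi> k t) / \<tau> - \<psi> (Suc k) t) *\<^sub>R d"
      by (simp add: scaleR_left_diff_distrib divide_inverse mult.commute flip: scaleR_scaleR)
    then show ?thesis using nrm_scale[OF D_in_V[OF d]] by metis
  qed
  ultimately show "((\<lambda>\<tau>. nrm s ((\<psi> k (t + \<tau>) *\<^sub>R d - \<psi> k t *\<^sub>R d) /\<^sub>R \<tau> - \<psi> (Suc k) t *\<^sub>R d)) \<longlongrightarrow> 0) (at 0)"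
    by simp
qed

end

context damped_flow
begin

lemma driven_diff:
  assumes "driven T w P" "driven T w' P'"
  shows "driven T (\<lambda>t. w t - w' t) (\<lambda>t. P t - P' t)"
  unfolding driven_def
proof (intro conjI ballI allI impI)
  note d1 = drivenD[OF assms(1)] and d2 = drivenD[OF assms(2)]
  show "w t - w' t \<in> V \<alpha>" "P t - P' t \<in> V \<beta>" if "t \<in> {0..T}" for t
    using d1(1,2) d2(1,2) that by (auto intro: V_diff)
  fix d assume d: "d \<in> D"
  have P: "pr (P t - P' t) d = pr (P t) d - pr (P' t) d" if "t \<in> {0..T}" for t
    using pr_diff_left[OF d1(2)[OF that] d2(2)[OF that] D_in_V[OF d]] .
  have "continuous_on {0..T} (\<lambda>t. pr (P t) d)" if "driven T w P" for w P
    using that d unfolding driven_def by blast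
  from this[OF assms(1)] this[OF assms(2)] have "continuous_on {0..T} (\<lambda>t. pr (P t) d - pr (P' t) d)"
    by (rule continuous_on_diff)
  then show "continuous_on {0..T} (\<lambda>t. pr (P t - P' t) d)"
    by (rule continuous_on_eq) (simp add: P)
  fix s t assume st: "0 \<le> s \<and> s \<le> t \<and> t \<le> T"
  have "((\<lambda>\<tau>. (pr (P \<tau>) d - pr (A0 (w \<tau>)) d) - (pr (P' \<tau>) d - pr (A0 (w' \<tau>)) d)) has_integral
      (pr (w t - w s) d - pr (w' t - w' s) d)) {s..t}"
    using st by (intro has_integral_diff d1(4) d2(4) d) auto
  moreover have "pr (w t - w s) d - pr (w' t - w' s) d = pr (w t - w' t - (w s - w' s)) d"
  proof -
    have "pr (w t - w s - (w' t - w' s)) d = pr (w t - w s) d - pr (w' t - w' s) d"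
      by (rule pr_diff_left[OF V_diff[OF d1(1) d1(1)] V_diff[OF d2(1) d2(1)] D_in_V[OF d]]) (use st in auto)
    moreover have "w t - w s - (w' t - w' s) = w t - w' t - (w s - w' s)" by simp
    ultimately show ?thesis by metis
  qed
  moreover have "(pr (P \<tau>) d - pr (A0 (w \<tau>)) d) - (pr (P' \<tau>) d - pr (A0 (w' \<tau>)) d)
      = pr (P \<tau> - P' \<tau>) d - pr (A0 (w \<tau> - w' \<tau>)) d" if "\<tau> \<in> {s..t}" for \<tau>
  proof -
    have \<tau>: "\<tau> \<in> {0..T}" using that st by auto
    note w = d1(1)[OF \<tau>] d2(1)[OF \<tau>]
    show ?thesis
      using P[OF \<tau>] A0_simps(4)[OF w] pr_diff_left[OF A0_simps(1)[OF w(1)] A0_simps(1)[OF w(2)] D_in_V[OF d]]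
      by simp
  qed
  ultimately show "((\<lambda>\<tau>. pr (P \<tau> - P' \<tau>) d - pr (A0 (w \<tau> - w' \<tau>)) d) has_integral
      pr (w t - w' t - (w s - w' s)) d) {s..t}"
    by (metis (no_types, lifting) has_integral_eq)
qed

text \<open>
  With test functions \<open>\<psi> d\<close>, where \<open>\<psi>\<close> is scalar and \<open>d\<close> in \<open>D\<close>, the weak formulation says that the
  continuous function \<open>pr (u t) d\<close> has weak derivative \<open>pr (forcing (u t)) d - pr (A0 (u t)) d\<close>.
\<close>

theorem weak_solution_driven:
  assumes cont: "cont_into \<alpha> {0..T} u" and T: "T > 0"
    and weak: "weak_solution V nrm pr D \<theta>2 A0 b0 g T u0 u"
  shows "driven T u (\<lambda>t. forcing (u t))"
  unfolding driven_def
proof (intro conjI ballI allI impI)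
  show uV: "u t \<in> V \<alpha>" if "t \<in> {0..T}" for t by (rule cont_intoD[OF cont that])
  show "forcing (u t) \<in> V \<beta>" if "t \<in> {0..T}" for t by (rule forcing(1)[OF uV[OF that]])
  fix d assume d: "d \<in> D"
  note dV = D_in_V[OF d]
  show cF: "continuous_on {0..T} (\<lambda>t. pr (forcing (u t)) d)"
  proof -
    obtain K where K: "K > 0" "\<And>x y. \<lbrakk>x \<in> V \<alpha>; y \<in> V \<alpha>\<rbrakk> \<Longrightarrow>
        nrm \<beta> (forcing x - forcing y) \<le> K * (nrm \<alpha> x + nrm \<alpha> y) * nrm \<alpha> (x - y)"
      using forcing_Lipschitz by blast
    show ?thesis
    proof (rule continuous_on_locally_Lipschitz[OF cont, where f = "\<lambda>x. pr (forcing x) d" and K = "K * nrm (- \<beta>) d"])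
      fix x y assume xy: "x \<in> V \<alpha>" "y \<in> V \<alpha>"
      note F = forcing(1)[OF xy(1)] forcing(1)[OF xy(2)]
      have "\<bar>pr (forcing x) d - pr (forcing y) d\<bar> \<le> nrm \<beta> (forcing x - forcing y) * nrm (- \<beta>) d"
        using pr_le[OF V_diff[OF F] dV] pr_diff_left[OF F dV] by simp
      also have "\<dots> \<le> (K * (nrm \<alpha> x + nrm \<alpha> y) * nrm \<alpha> (x - y)) * nrm (- \<beta>) d"
        by (intro mult_right_mono nrm_ge_0 K xy)
      also have "\<dots> \<le> (K * (nrm \<alpha> x + nrm \<alpha> y + 1) * nrm \<alpha> (x - y)) * nrm (- \<beta>) d"
        using K(1) by (intro mult_right_mono mult_left_mono nrm_ge_0) auto
      finally show "\<bar>pr (forcing x) d - pr (forcing y) d\<bar>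
          \<le> K * nrm (- \<beta>) d * (nrm \<alpha> x + nrm \<alpha> y + 1) * nrm \<alpha> (x - y)" by (simp add: mult_ac)
    qed
  qed
  have cA: "continuous_on {0..T} (\<lambda>t. pr (A0 (u t)) d)"
  proof -
    have "continuous_on {0..T} (\<lambda>t. pr (u t) (A0 d))"
      by (rule continuous_on_pr[OF cont A0_simps(1)[OF dV]])
    then show ?thesis
      by (rule continuous_on_eq) (use A0_self_adjoint[OF uV dV] in auto)
  qed
  have cG: "continuous_on {0..T} (\<lambda>t. pr (u t) d)" by (rule continuous_on_pr[OF cont dV])
  let ?H = "\<lambda>t. pr (forcing (u t)) d - pr (A0 (u t)) d"
  fix s t assume st: "0 \<le> s \<and> s \<le> t \<and> t \<le> T"
  have "(?H has_integral (pr (u t) d - pr (u s) d)) {s..t}"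
  proof (rule du_Bois_Reymond[OF cG _ _ T])
    show cH: "continuous_on {0..T} ?H" by (intro continuous_intros cF cA)
    fix \<psi> :: "nat \<Rightarrow> real \<Rightarrow> real" and a b :: real
    assume ab: "0 < a" "b < T" and \<psi>: "\<And>k t. (\<psi> k has_real_derivative \<psi> (Suc k) t) (at t)"
        "\<And>k t. t \<notin> {a..b} \<Longrightarrow> \<psi> k t = 0"
    have c\<psi>: "continuous_on {0..T} (\<psi> k)" for k
      using \<psi>(1) DERIV_isCont by (blast intro: continuous_at_imp_continuous_on)
    let ?W = "\<lambda>k t. \<psi> k t *\<^sub>R d"
    let ?L = "\<lambda>t. - pr (u t) d * \<psi> 1 t + (pr (A0 (u t)) d + (pr g d - pr (forcing (u t)) d)) * \<psi> 0 t"
    have "test_function nrm D T ?W" by (rule test_function_scaleR[where \<psi> = \<psi>, OF d ab \<psi>])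
    then have "(LINT t|lebesgue_on {0<..<T}. - pr (u t) (?W 1 t) + pr (A0 (u t)) (?W 0 t) + b0 (u t) (u t) (?W 0 t))
        = (LINT t|lebesgue_on {0<..<T}. pr g (?W 0 t))"
      using weak unfolding weak_solution_def by blast
    moreover have "(LINT t|lebesgue_on {0<..<T}. - pr (u t) (?W 1 t) + pr (A0 (u t)) (?W 0 t) + b0 (u t) (u t) (?W 0 t))
        = (LINT t|lebesgue_on {0<..<T}. ?L t)"
    proof (rule Bochner_Integration.integral_cong[OF refl])
      fix t assume "t \<in> space (lebesgue_on {0<..<T})"
      then have u: "u t \<in> V \<alpha>" by (intro uV) auto
      show "- pr (u t) (?W 1 t) + pr (A0 (u t)) (?W 0 t) + b0 (u t) (u t) (?W 0 t) = ?L t"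
      proof -
        have b: "b0 (u t) (u t) d = pr g d - pr (forcing (u t)) d" using forcing(2)[OF u d] by simp
        show ?thesis
          unfolding pr_scale_right[OF u dV] pr_scale_right[OF A0_simps(1)[OF u] dV] b0_linear(4)[OF u u dV] b
          by (simp add: algebra_simps)
      qed
    qed
    moreover have "(LINT t|lebesgue_on {0<..<T}. pr g (?W 0 t)) = (LINT t|lebesgue_on {0<..<T}. pr g d * \<psi> 0 t)"
      using pr_scale_right[OF g dV] by (simp add: mult.commute)
    moreover have cL: "continuous_on {0..T} ?L" "continuous_on {0..T} (\<lambda>t. pr g d * \<psi> 0 t)"
      by (intro continuous_intros cG cA cF c\<psi>)+
    ultimately have "integral {0..T} ?L = integral {0..T} (\<lambda>t. pr g d * \<psi> 0 t)"
      by (simp only: integral_lebesgue_on_open_interval[OF cL(1)] integral_lebesgue_on_open_interval[OF cL(2)])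
    moreover have "integral {0..T} (\<lambda>t. pr (u t) d * \<psi> 1 t + ?H t * \<psi> 0 t)
        = integral {0..T} (\<lambda>t. pr g d * \<psi> 0 t - ?L t)"
      by (rule integral_cong) (simp add: algebra_simps)
    moreover have "integral {0..T} (\<lambda>t. pr g d * \<psi> 0 t - ?L t)
        = integral {0..T} (\<lambda>t. pr g d * \<psi> 0 t) - integral {0..T} ?L"
      by (intro integral_diff integrable_continuous_interval cL)
    ultimately show "integral {0..T} (\<lambda>t. pr (u t) d * \<psi> 1 t + ?H t * \<psi> 0 t) = 0" by simp
  qed (use st in auto)
  moreover have "pr (u t - u s) d = pr (u t) d - pr (u s) d"
    by (rule pr_diff_left[OF uV uV dV]) (use st in auto)
  ultimately show "(?H has_integral pr (u t - u s) d) {s..t}" by simp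
qed

end


section \<open>Finite dimension from smoothing\<close>

context sobolev_scale
begin

text \<open>
  If \<open>A\<close> is covered by balls of radius \<open>r\<close> around points \<open>y\<close>, then \<open>A = \<Phi> ` A\<close> is covered by
  \<open>m\<close> times as many of radius \<open>r / 4\<close>, around \<open>\<Phi> y\<close> plus a scaled net of the unit ball of \<open>V t\<close>:
  the contracted part and the net each contribute \<open>r / 8\<close>.  These centres may lie outside \<open>A\<close>, where
  smoothing says nothing; moving them into \<open>A\<close> doubles the radius.  So \<open>m\<^sup>n\<close> balls of radius
  \<open>R0 / 2\<^sup>n\<close> suffice.
\<close>

theorem fractal_dim_finite_if_smoothing:
  assumes st: "s < t" and A: "A \<subseteq> V s" "\<forall>x\<in>A. nrm s x \<le> R" and inv: "\<Phi> ` A = A"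
    and K: "K > 0"
    and smoothing: "\<And>x y. \<lbrakk>x \<in> A; y \<in> A\<rbrakk> \<Longrightarrow> \<exists>k\<in>V t. nrm t k \<le> K * nrm s (x - y) \<and>
        nrm s (\<Phi> x - \<Phi> y - k) \<le> nrm s (x - y) / 8"
  shows "fractal_dim V nrm s A < \<infinity>"
proof -
  define R0 where "R0 = 2 * \<bar>R\<bar> + 1"
  have R0: "R0 > 0" by (simp add: R0_def)
  obtain Net where Net: "finite Net" "Net \<subseteq> V s"
      "\<And>x. \<lbrakk>x \<in> V t; nrm t x \<le> 1\<rbrakk> \<Longrightarrow> \<exists>y\<in>Net. nrm s (x - y) < 1 / (8 * K)"
    using unit_ball_net[OF st, of "1 / (8 * K)"] K by auto
  define m where "m = card Net"
  have "Net \<noteq> {}" using Net(3)[OF V_0] by (auto simp: nrm_0)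
  then have m: "m \<ge> 1" using Net(1) by (simp add: m_def Suc_le_eq card_gt_0_iff)
  have cover: "\<exists>F. finite F \<and> F \<subseteq> A \<and> card F \<le> m ^ n \<and> (\<forall>x\<in>A. \<exists>y\<in>F. nrm s (x - y) \<le> R0 / 2 ^ n)" for n
  proof (induction n)
    case 0
    show ?case
    proof (cases "A = {}")
      case False
      then obtain a where a: "a \<in> A" by blast
      have "nrm s (x - a) \<le> R0" if "x \<in> A" for x
        using nrm_diff_le[OF subsetD[OF A(1) that] subsetD[OF A(1) a]] bspec[OF A(2) that] bspec[OF A(2) a]
        by (simp add: R0_def)
      then show ?thesis using a by (intro exI[of _ "{a}"]) auto
    qed auto
  next
    case (Suc n)
    define r where "r = R0 / 2 ^ n"
    have r: "r > 0" using R0 by (simp add: r_def)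
    obtain F where F: "finite F" "F \<subseteq> A" "card F \<le> m ^ n" "\<And>x. x \<in> A \<Longrightarrow> \<exists>y\<in>F. nrm s (x - y) \<le> r"
      using Suc.IH unfolding r_def by blast
    define cell where "cell = (\<lambda>(y, z). {x \<in> A. nrm s (x - (\<Phi> y + (K * r) *\<^sub>R z)) \<le> r / 4})"
    define F' where "F' = (\<lambda>i. SOME x. x \<in> cell i) ` {i \<in> F \<times> Net. cell i \<noteq> {}}"
    have fin: "finite {i \<in> F \<times> Net. cell i \<noteq> {}}" using F Net by simp
    have some: "(SOME x. x \<in> cell i) \<in> cell i" if "cell i \<noteq> {}" for i
      using that by (simp add: some_in_eq)
    have "card F' \<le> card {i \<in> F \<times> Net. cell i \<noteq> {}}" unfolding F'_def by (rule card_image_le[OF fin])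
    also have "\<dots> \<le> card (F \<times> Net)" using F Net by (intro card_mono) auto
    also have "\<dots> \<le> m ^ Suc n" using F(3) by (simp add: card_cartesian_product m_def)
    finally have card: "card F' \<le> m ^ Suc n" .
    have sub: "F' \<subseteq> A"
    proof
      fix x assume "x \<in> F'"
      then obtain i where "cell i \<noteq> {}" "x = (SOME x. x \<in> cell i)" by (auto simp: F'_def)
      then have "x \<in> cell i" using some by simp
      then show "x \<in> A" by (auto simp: cell_def split: prod.splits)
    qed
    have "\<exists>y\<in>F'. nrm s (x - y) \<le> R0 / 2 ^ Suc n" if x: "x \<in> A" for x
    proof -
      obtain x0 where x0: "x0 \<in> A" "x = \<Phi> x0" using inv x by (metis imageE)
      obtain y where y: "y \<in> F" "nrm s (x0 - y) \<le> r" using F(4)[OF x0(1)] by blast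
      have yA: "y \<in> A" using y F by blast
      obtain k where k: "k \<in> V t" "nrm t k \<le> K * nrm s (x0 - y)" "nrm s (\<Phi> x0 - \<Phi> y - k) \<le> nrm s (x0 - y) / 8"
        using smoothing[OF x0(1) yA] by blast
      have Kr: "K * r > 0" using K r by simp
      have "nrm t k \<le> K * r" using k(2) mult_left_mono[OF y(2), of K] K by linarith
      then have "nrm t ((1 / (K * r)) *\<^sub>R k) \<le> 1" using Kr k(1) by (simp add: nrm_scale)
      then obtain z where z: "z \<in> Net" "nrm s ((1 / (K * r)) *\<^sub>R k - z) < 1 / (8 * K)"
        using Net(3)[OF V_scale[OF k(1)]] by blast
      have V: "x \<in> V s" "\<Phi> y \<in> V s" "k \<in> V s" "z \<in> V s"
        using x A(1) inv yA k(1) V_mono[of s t] st z(1) Net(2) by auto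
      have "nrm s (k - (K * r) *\<^sub>R z) = nrm s ((K * r) *\<^sub>R ((1 / (K * r)) *\<^sub>R k - z))"
        using K r by (simp add: scaleR_diff_right)
      also have "\<dots> = (K * r) * nrm s ((1 / (K * r)) *\<^sub>R k - z)"
        using Kr by (subst nrm_scale) (auto intro!: V_diff V_scale V)
      also have "\<dots> \<le> (K * r) * (1 / (8 * K))" using z(2) Kr by (intro mult_left_mono) auto
      also have "\<dots> = r / 8" using K by simp
      finally have kz: "nrm s (k - (K * r) *\<^sub>R z) \<le> r / 8" .
      have "nrm s (x - (\<Phi> y + (K * r) *\<^sub>R z)) = nrm s ((x - \<Phi> y - k) + (k - (K * r) *\<^sub>R z))"
        by (simp add: algebra_simps)
      also have "\<dots> \<le> nrm s (x - \<Phi> y - k) + nrm s (k - (K * r) *\<^sub>R z)"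
        by (intro nrm_triangle V_diff V_scale V)
      also have "\<dots> \<le> r / 4" using kz k(3) y(2) x0(2) by simp
      finally have xc: "x \<in> cell (y, z)" using x by (simp add: cell_def)
      define x' where "x' = (SOME x. x \<in> cell (y, z))"
      have "x' \<in> cell (y, z)" unfolding x'_def using xc by (intro some) auto
      then have x': "x' \<in> A" "nrm s (x' - (\<Phi> y + (K * r) *\<^sub>R z)) \<le> r / 4" by (auto simp: cell_def)
      have "x' \<in> F'" unfolding F'_def x'_def using y(1) z(1) xc by (intro imageI) auto
      moreover have "nrm s (x - x') \<le> nrm s (x - (\<Phi> y + (K * r) *\<^sub>R z)) + nrm s ((\<Phi> y + (K * r) *\<^sub>R z) - x')"
        using x' A(1) by (intro nrm_diff_triangle V_add V_scale V) auto
      then have "nrm s (x - x') \<le> r / 2"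
        using xc x'(2) nrm_minus_commute[of s x' "\<Phi> y + (K * r) *\<^sub>R z"] by (simp add: cell_def)
      ultimately show ?thesis by (auto simp: r_def mult.commute)
    qed
    moreover have "finite F'" unfolding F'_def using fin by simp
    ultimately show ?case using card sub by blast
  qed
  let ?N = "\<lambda>\<epsilon>. LEAST m. finite_ball_cover V nrm s A \<epsilon> m"
  let ?X = "\<lambda>\<epsilon>. if \<exists>m. finite_ball_cover V nrm s A \<epsilon> m then ereal (ln (real (?N \<epsilon>)) / ln (1 / \<epsilon>)) else \<infinity>"
  define B where "B = ((\<bar>ln R0\<bar> + 1) / ln 2 + 1) * ln (real m) + ln (real m)"
  have bound: "?X \<epsilon> \<le> ereal B" if \<epsilon>: "\<epsilon> > 0" "\<epsilon> < exp (- 1)" for \<epsilon>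
  proof -
    let ?l = "ln (1 / \<epsilon>)"
    \<comment> \<open>below \<open>1/e\<close> the denominator is at least \<open>1\<close>, so additive constants can be absorbed into multiples of it\<close>
    have l: "?l \<ge> 1"
      using \<epsilon> ln_less_cancel_iff[of \<epsilon> "exp (- 1)"] by (simp add: ln_div)
    \<comment> \<open>the least generation whose balls have radius at most \<open>\<epsilon>\<close>\<close>
    define n where "n = nat \<lceil>ln (R0 / \<epsilon>) / ln 2\<rceil>"
    have "ln (R0 / \<epsilon>) / ln 2 \<le> real n" unfolding n_def by linarith
    then have "ln (R0 / \<epsilon>) \<le> ln (2 ^ n)" by (simp add: field_simps ln_realpow)
    then have "R0 / \<epsilon> \<le> 2 ^ n" using R0 \<epsilon> by (simp add: ln_le_cancel_iff)
    then have n\<epsilon>: "R0 / 2 ^ n \<le> \<epsilon>" using \<epsilon> by (simp add: field_simps)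
    have "real n \<le> \<bar>ln (R0 / \<epsilon>)\<bar> / ln 2 + 1"
    proof -
      have "ln (R0 / \<epsilon>) / ln 2 \<le> \<bar>ln (R0 / \<epsilon>)\<bar> / ln 2" by (intro divide_right_mono) auto
      moreover have "0 \<le> \<bar>ln (R0 / \<epsilon>)\<bar> / ln 2" by simp
      ultimately show ?thesis unfolding n_def by linarith
    qed
    also have "\<bar>ln (R0 / \<epsilon>)\<bar> \<le> (\<bar>ln R0\<bar> + 1) * ?l"
    proof -
      have "ln (R0 / \<epsilon>) = ln R0 + ?l" using R0 \<epsilon> by (simp add: ln_div)
      moreover have "\<bar>ln R0\<bar> * 1 \<le> \<bar>ln R0\<bar> * ?l" using l by (intro mult_left_mono) auto
      ultimately show ?thesis using l by (simp add: algebra_simps)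
    qed
    also have "(\<bar>ln R0\<bar> + 1) * ?l / ln 2 + 1 \<le> ((\<bar>ln R0\<bar> + 1) / ln 2 + 1) * ?l"
      using l by (simp add: algebra_simps)
    finally have n: "real n \<le> ((\<bar>ln R0\<bar> + 1) / ln 2 + 1) * ?l" by (simp add: divide_right_mono)
    obtain F where F: "finite F" "F \<subseteq> A" "card F \<le> m ^ n" "\<And>x. x \<in> A \<Longrightarrow> \<exists>y\<in>F. nrm s (x - y) \<le> R0 / 2 ^ n"
      using cover[of n] by blast
    have fc: "finite_ball_cover V nrm s A \<epsilon> (card F)"
      unfolding finite_ball_cover_def using F A(1) n\<epsilon> by (intro exI[of _ F]) (metis order_trans)
    have "?N \<epsilon> \<le> card F" using fc by (rule Least_le)
    then have Nm: "?N \<epsilon> \<le> m ^ n" using F(3) by simp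
    have "ln (real (?N \<epsilon>)) \<le> real n * ln (real m)"
    proof (cases "?N \<epsilon> = 0")
      case True
      then show ?thesis using m by simp
    next
      case False
      have "ln (real (?N \<epsilon>)) \<le> ln (real m ^ n)"
        using Nm False m by (subst ln_le_cancel_iff) (auto simp flip: of_nat_power)
      then show ?thesis using m by (simp add: ln_realpow)
    qed
    also have "\<dots> \<le> ((\<bar>ln R0\<bar> + 1) / ln 2 + 1) * ?l * ln (real m)"
      using n m by (intro mult_right_mono) auto
    also have "\<dots> \<le> B * ?l" using l m by (simp add: B_def algebra_simps)
    finally have "ln (real (?N \<epsilon>)) / ?l \<le> B" using l by (simp add: field_simps)
    then show ?thesis using fc by auto
  qed
  have "\<forall>\<^sub>F \<epsilon> in at_right 0. ?X \<epsilon> \<le> ereal B"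
    unfolding eventually_at_right_field using bound by (intro exI[of _ "exp (- 1)"]) auto
  then have "fractal_dim V nrm s A \<le> ereal B"
    unfolding fractal_dim_def by (rule Limsup_bounded)
  then show ?thesis by (rule le_less_trans) simp
qed

end


section \<open>The attractor\<close>

locale attractor_flow = damped_flow Om C G om vol Eb h VV emb V nrm pr Lam \<theta>1 \<theta>2 A0 M N Bbar b0 \<beta> g
  for Om :: "'p::t2_space set"
    and C :: "('p, 'f::real_vector, 'n::finite, 'r::finite) bchart set"
    and G om vol Eb h VV
    and emb :: "('p \<Rightarrow> 'f) \<Rightarrow> 'd::real_vector"
    and V nrm pr Lam \<theta>1 \<theta>2 A0 M N Bbar b0 \<beta> g +
  fixes S :: "real \<Rightarrow> 'd \<Rightarrow> 'd" and A :: "'d set"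
  assumes semigroup: "solution_semigroup V nrm pr (emb ` VV) \<theta>2 A0 b0 g S"
    and attractor: "global_attractor V nrm (- \<theta>2) S A"
begin

lemma A_V: "x \<in> A \<Longrightarrow> x \<in> V \<alpha>"
proof -
  interpret Mt: Metric_space "V \<alpha>" "\<lambda>x y. nrm \<alpha> (x - y)" by (rule metric_V)
  have "compactin (scale_top V nrm \<alpha>) A" using attractor unfolding global_attractor_def by blast
  then show "x \<in> A \<Longrightarrow> x \<in> V \<alpha>" using compactin_subset_topspace by fastforce
qed

lemma A_bounded: obtains R where "R > 0" "\<And>x. x \<in> A \<Longrightarrow> nrm \<alpha> x \<le> R"
proof -
  interpret Mt: Metric_space "V \<alpha>" "\<lambda>x y. nrm \<alpha> (x - y)" by (rule metric_V)
  have "compactin (scale_top V nrm \<alpha>) A" using attractor unfolding global_attractor_def by blast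
  then have "Mt.mbounded A" by (rule Mt.compactin_imp_mbounded)
  then obtain x0 B where B: "A \<subseteq> Mt.mcball x0 B" unfolding Mt.mbounded_def by blast
  have "nrm \<alpha> x \<le> \<bar>nrm \<alpha> x0 + B\<bar> + 1" if "x \<in> A" for x
  proof -
    have "x0 \<in> V \<alpha>" "x \<in> V \<alpha>" "nrm \<alpha> (x0 - x) \<le> B" using B that by (auto simp: Mt.mcball_def)
    then show ?thesis using nrm_le_add[of x \<alpha> x0] nrm_minus_commute[of \<alpha> x x0] by simp
  qed
  then show ?thesis by (intro that[of "\<bar>nrm \<alpha> x0 + B\<bar> + 1"]) auto
qed

lemma S_A: "t \<ge> 0 \<Longrightarrow> S t ` A = A"
  using attractor by (simp add: global_attractor_def)

lemma S_in_A: "\<lbrakk>t \<ge> 0; x \<in> A\<rbrakk> \<Longrightarrow> S t x \<in> A"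
  using S_A by blast

lemma S_0: "x \<in> A \<Longrightarrow> S 0 x = x"
  using semigroup A_V by (simp add: solution_semigroup_def)

lemma S_add: "\<lbrakk>s \<ge> 0; t \<ge> 0; x \<in> A\<rbrakk> \<Longrightarrow> S (s + t) x = S s (S t x)"
  using semigroup A_V by (simp add: solution_semigroup_def)

lemma trajectory_driven:
  assumes "x \<in> A" "T > 0"
  shows "driven T (\<lambda>t. S t x) (\<lambda>t. forcing (S t x))"
proof (rule weak_solution_driven[OF _ assms(2)])
  have "continuous_map (top_of_set {0..}) (scale_top V nrm \<alpha>) (\<lambda>t. S t x)"
    using semigroup A_V[OF assms(1)] unfolding solution_semigroup_def by blast
  then have "cont_into \<alpha> {0..} (\<lambda>t. S t x)" by (rule cont_into_if_continuous_map)
  then show "cont_into \<alpha> {0..T} (\<lambda>t. S t x)" by (rule cont_into_subset) auto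
  show "weak_solution V nrm pr D \<theta>2 A0 b0 g T x (\<lambda>t. S t x)"
    using semigroup A_V[OF assms(1)] assms(2) unfolding solution_semigroup_def by blast
qed

text \<open>
  By invariance the history of a point of \<open>A\<close> can be followed back arbitrarily far within \<open>A\<close>, where the
  forcing is bounded in \<open>V \<beta>\<close>; the decaying part of the splitting then disappears.
\<close>

theorem attractor_bounded: "bounded_in V nrm \<beta> A"
proof -
  obtain R where R: "R > 0" "\<And>x. x \<in> A \<Longrightarrow> nrm \<alpha> x \<le> R" using A_bounded by blast
  obtain L where L: "L > 0" "\<And>x y. \<lbrakk>x \<in> V \<alpha>; y \<in> V \<alpha>\<rbrakk> \<Longrightarrow>
        nrm \<beta> (forcing x - forcing y) \<le> L * (nrm \<alpha> x + nrm \<alpha> y) * nrm \<alpha> (x - y)"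
    using forcing_Lipschitz by blast
  define p where "p = nrm \<beta> (forcing 0) + L * R * R"
  have p: "nrm \<beta> (forcing x) \<le> p" if x: "x \<in> A" for x
  proof -
    have "nrm \<beta> (forcing x) \<le> nrm \<beta> (forcing 0) + nrm \<beta> (forcing x - forcing 0)"
      by (intro nrm_le_add forcing A_V x V_0)
    also have "nrm \<beta> (forcing x - forcing 0) \<le> L * nrm \<alpha> x * nrm \<alpha> x"
      using L(2)[OF A_V[OF x] V_0] by (simp add: nrm_0)
    also have "\<dots> \<le> L * R * R" using L(1) R(2)[OF x] R(1) by (intro mult_mono) (auto simp: nrm_ge_0)
    finally show ?thesis by (simp add: p_def)
  qed
  have p0: "0 \<le> p" using L R nrm_ge_0[of \<beta> "forcing 0"] by (simp add: p_def)
  obtain c K where cK: "c > 0" "K > 0" and split: "\<And>T w P m p \<epsilon>. \<lbrakk>T > 0; driven T w P; \<epsilon> > 0;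
      \<forall>t\<in>{0..T}. nrm \<alpha> (w t) \<le> m \<and> nrm \<beta> (P t) \<le> p\<rbrakk> \<Longrightarrow>
    \<exists>v\<in>V \<beta>. nrm \<beta> v \<le> K * p \<and> nrm \<alpha> (w T - v) \<le> K * exp (- c * T) * nrm \<alpha> (w 0) + \<epsilon>"
    using splitting by metis
  have approx: "\<exists>v\<in>V \<beta>. nrm \<beta> v \<le> K * p \<and> nrm \<alpha> (x - v) \<le> 2 * \<epsilon>" if x: "x \<in> A" and \<epsilon>: "\<epsilon> > 0" for x \<epsilon>
  proof -
    \<comment> \<open>\<open>exp x \<ge> x\<close> suffices to choose \<open>T\<close>, without logarithms\<close>
    obtain T where T: "T > 0" "K * exp (- c * T) * R \<le> \<epsilon>"
    proof
      define T where "T = K * R / (c * \<epsilon>)"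
      show "T > 0" using cK R \<epsilon> by (simp add: T_def)
      have "c * T = K * R / \<epsilon>" using cK \<epsilon> by (simp add: T_def)
      then have "K * R / \<epsilon> \<le> exp (c * T)" using exp_ge_add_one_self[of "c * T"] by linarith
      then show "K * exp (- c * T) * R \<le> \<epsilon>" using \<epsilon> by (simp add: exp_minus field_simps)
    qed
    obtain y where y: "y \<in> A" "x = S T y" using S_A[of T] T x by (metis imageE less_imp_le)
    obtain v where v: "v \<in> V \<beta>" "nrm \<beta> v \<le> K * p"
        "nrm \<alpha> (S T y - v) \<le> K * exp (- c * T) * nrm \<alpha> (S 0 y) + \<epsilon>"
      using split[OF T(1) trajectory_driven[OF y(1) T(1)] \<epsilon>, of R p] R(2) p S_in_A[OF _ y(1)] by auto
    have "K * exp (- c * T) * nrm \<alpha> (S 0 y) \<le> K * exp (- c * T) * R"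
      using cK R(2)[OF S_in_A[OF _ y(1), of 0]] by (intro mult_left_mono) auto
    then show ?thesis using v y T(2) by (intro bexI[of _ v]) auto
  qed
  have "x \<in> V \<beta> \<and> nrm \<beta> x \<le> K * p" if x: "x \<in> A" for x
  proof (rule in_V_if_dual_bound[OF A_V[OF x]])
    fix d assume d: "d \<in> D"
    have "\<bar>pr x d\<bar> \<le> K * p * nrm (- \<beta>) d + e" if e: "e > 0" for e
    proof -
      define \<epsilon> where "\<epsilon> = e / (2 * (nrm (- \<alpha>) d + 1))"
      have nd: "nrm (- \<alpha>) d + 1 > 0" using nrm_ge_0[of "- \<alpha>" d] by linarith
      obtain v where v: "v \<in> V \<beta>" "nrm \<beta> v \<le> K * p" "nrm \<alpha> (x - v) \<le> 2 * \<epsilon>"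
        using approx[OF x, of \<epsilon>] e nd by (auto simp: \<epsilon>_def)
      have xv: "x - v \<in> V \<alpha>" by (intro V_diff A_V x V\<beta>_V\<alpha> v)
      have "pr x d = pr v d + pr (x - v) d"
        using pr_diff_left[OF A_V[OF x] V\<beta>_V\<alpha>[OF v(1)] D_in_V[OF d]] by simp
      moreover have "\<bar>pr v d\<bar> \<le> K * p * nrm (- \<beta>) d"
        using pr_le[OF v(1) D_in_V[OF d]] mult_right_mono[OF v(2) nrm_ge_0[of "- \<beta>" d]] by linarith
      moreover have "\<bar>pr (x - v) d\<bar> \<le> e"
      proof -
        have "\<bar>pr (x - v) d\<bar> \<le> nrm \<alpha> (x - v) * nrm (- \<alpha>) d" by (rule pr_le[OF xv D_in_V[OF d]])
        also have "\<dots> \<le> 2 * \<epsilon> * (nrm (- \<alpha>) d + 1)"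
          using v(3) order_trans[OF nrm_ge_0 v(3)] nrm_ge_0[of "- \<alpha>" d] by (intro mult_mono) auto
        also have "\<dots> = e" using nd by (simp add: \<epsilon>_def field_simps)
        finally show ?thesis .
      qed
      ultimately show ?thesis by linarith
    qed
    then show "\<bar>pr x d\<bar> \<le> K * p * nrm (- \<beta>) d" by (rule field_le_epsilon)
  qed (use \<beta> cK p0 in auto)
  then show ?thesis unfolding bounded_in_def by blast
qed

lemma difference_driven:
  assumes "x \<in> A" "y \<in> A" "T > 0"
  shows "driven T (\<lambda>t. S t x - S t y) (\<lambda>t. forcing (S t x) - forcing (S t y))"
  by (intro driven_diff trajectory_driven assms)

lemma forcing_difference:
  obtains L where "L > 0" "\<And>x y t. \<lbrakk>x \<in> A; y \<in> A; t \<ge> 0\<rbrakk> \<Longrightarrow>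
    nrm \<beta> (forcing (S t x) - forcing (S t y)) \<le> L * nrm \<alpha> (S t x - S t y)"
proof -
  obtain R where R: "R > 0" "\<And>x. x \<in> A \<Longrightarrow> nrm \<alpha> x \<le> R" using A_bounded by blast
  obtain L where L: "L > 0" "\<And>x y. \<lbrakk>x \<in> V \<alpha>; y \<in> V \<alpha>\<rbrakk> \<Longrightarrow>
        nrm \<beta> (forcing x - forcing y) \<le> L * (nrm \<alpha> x + nrm \<alpha> y) * nrm \<alpha> (x - y)"
    using forcing_Lipschitz by blast
  show ?thesis
  proof (rule that[of "L * (R + R)"])
    fix x y t assume "x \<in> A" "y \<in> A" "(t::real) \<ge> 0"
    then have A: "S t x \<in> A" "S t y \<in> A" by (auto intro: S_in_A)
    have "L * (nrm \<alpha> (S t x) + nrm \<alpha> (S t y)) * nrm \<alpha> (S t x - S t y) \<le> L * (R + R) * nrm \<alpha> (S t x - S t y)"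
      using L(1) R(2)[OF A(1)] R(2)[OF A(2)] by (intro mult_right_mono mult_left_mono nrm_ge_0) auto
    then show "nrm \<beta> (forcing (S t x) - forcing (S t y)) \<le> L * (R + R) * nrm \<alpha> (S t x - S t y)"
      using L(2)[OF A_V[OF A(1)] A_V[OF A(2)]] by linarith
  qed (use L R in simp)
qed

text \<open>
  On a time interval of length \<open>1 / (2 q)\<close>, where \<open>q\<close> bounds the speed of \<open>w\<close> relative to its
  supremum \<open>m\<close>, the curve moves by at most \<open>m / 2\<close>; hence \<open>m \<le> \<parallel>w 0\<parallel> + m / 2\<close>.  Iterating
  the resulting doubling replaces Gronwall's inequality, for which the norm of \<open>w\<close> would have to be
  differentiated.
\<close>

lemma short_time_Lipschitz:
  obtains \<tau> where "\<tau> > 0" "\<And>x y t. \<lbrakk>x \<in> A; y \<in> A; 0 \<le> t; t \<le> \<tau>\<rbrakk> \<Longrightarrow>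
    nrm \<alpha> (S t x - S t y) \<le> 2 * nrm \<alpha> (x - y)"
proof -
  obtain R where R: "R > 0" "\<And>x. x \<in> A \<Longrightarrow> nrm \<alpha> x \<le> R" using A_bounded by blast
  obtain L where L: "L > 0" "\<And>x y t. \<lbrakk>x \<in> A; y \<in> A; t \<ge> 0\<rbrakk> \<Longrightarrow>
    nrm \<beta> (forcing (S t x) - forcing (S t y)) \<le> L * nrm \<alpha> (S t x - S t y)"
    using forcing_difference by blast
  obtain a where a: "a > 0" "\<And>x. x \<in> V \<alpha> \<Longrightarrow> nrm \<alpha> (A0 x) \<le> a * nrm \<alpha> x"
    using bounded_op_const[OF A0_bounded] by blast
  obtain \<kappa> where \<kappa>: "\<kappa> > 0" "\<And>x. x \<in> V \<beta> \<Longrightarrow> nrm \<alpha> x \<le> \<kappa> * nrm \<beta> x"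
    using embedding_const[of \<alpha> \<beta>] \<beta> by (metis less_imp_le)
  define q where "q = \<kappa> * L + a"
  have q: "q > 0" using \<kappa> L a by (simp add: q_def add_pos_pos)
  show ?thesis
  proof (rule that[of "1 / (2 * q)"])
    show \<tau>: "1 / (2 * q) > 0" using q by simp
    fix x y t assume xy: "x \<in> A" "y \<in> A" and t: "0 \<le> t" "t \<le> 1 / (2 * q)"
    let ?w = "\<lambda>t. S t x - S t y"
    let ?I = "{0..1 / (2 * q)}"
    define m where "m = (SUP t\<in>?I. nrm \<alpha> (?w t))"
    have "nrm \<alpha> (?w t) \<le> R + R" if "t \<in> ?I" for t
    proof -
      have A: "S t x \<in> A" "S t y \<in> A" using that xy by (auto intro: S_in_A)
      show ?thesis
        using nrm_diff_le[OF A_V[OF A(1)] A_V[OF A(2)]] R(2)[OF A(1)] R(2)[OF A(2)] by linarith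
    qed
    then have bdd: "bdd_above ((\<lambda>t. nrm \<alpha> (?w t)) ` ?I)" by (rule bdd_aboveI2)
    have m: "nrm \<alpha> (?w t) \<le> m" if "t \<in> ?I" for t
      unfolding m_def using that bdd by (rule cSUP_upper)
    have w0: "?w 0 = x - y" using S_0 xy by simp
    have step: "nrm \<alpha> (?w t) \<le> nrm \<alpha> (x - y) + m / 2" if t: "t \<in> ?I" for t
    proof -
      have dr: "driven (1 / (2 * q)) ?w (\<lambda>t. forcing (S t x) - forcing (S t y))"
        by (rule difference_driven[OF xy \<tau>])
      have m0: "0 \<le> m" using m[OF t] nrm_ge_0[of \<alpha> "?w t"] by linarith
      have "nrm \<beta> (forcing (S t x) - forcing (S t y)) \<le> L * m" if "t \<in> ?I" for t
        using L(2)[OF xy, of t] mult_left_mono[OF m[OF that] less_imp_le[OF L(1)]] that by (auto intro: order_trans)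
      then have "nrm \<alpha> (?w t - ?w 0) \<le> (\<kappa> * (L * m) + a * m) * (t - 0)"
        using t by (intro drift[OF dr m _ a \<kappa>]) auto
      also have "\<dots> = q * m * t" by (simp add: q_def algebra_simps)
      also have "\<dots> \<le> q * m * (1 / (2 * q))" using t q m0 by (intro mult_left_mono) auto
      also have "\<dots> = m / 2" using q by simp
      finally have "nrm \<alpha> (?w t - ?w 0) \<le> m / 2" .
      then show ?thesis
        using nrm_le_add[OF drivenD(1)[OF dr t] drivenD(1)[OF dr, of 0]] \<tau> unfolding w0 by simp
    qed
    have "m \<le> nrm \<alpha> (x - y) + m / 2"
    proof -
      have "(SUP t\<in>?I. nrm \<alpha> (?w t)) \<le> nrm \<alpha> (x - y) + m / 2"
        by (rule cSUP_least) (use step \<tau> in auto)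
      then show ?thesis unfolding m_def[symmetric] .
    qed
    then have "m \<le> 2 * nrm \<alpha> (x - y)" by simp
    then show "nrm \<alpha> (?w t) \<le> 2 * nrm \<alpha> (x - y)" using m[of t] t by simp
  qed
qed

lemma finite_time_Lipschitz:
  obtains L where "L > 0" "\<And>x y t. \<lbrakk>x \<in> A; y \<in> A; 0 \<le> t; t \<le> T\<rbrakk> \<Longrightarrow>
    nrm \<alpha> (S t x - S t y) \<le> L * nrm \<alpha> (x - y)"
proof -
  obtain \<tau> where \<tau>: "\<tau> > 0" "\<And>x y t. \<lbrakk>x \<in> A; y \<in> A; 0 \<le> t; t \<le> \<tau>\<rbrakk> \<Longrightarrow>
    nrm \<alpha> (S t x - S t y) \<le> 2 * nrm \<alpha> (x - y)"
    using short_time_Lipschitz by blast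
  have iter: "nrm \<alpha> (S t x - S t y) \<le> 2 ^ n * nrm \<alpha> (x - y)"
    if "x \<in> A" "y \<in> A" "0 \<le> t" "t \<le> real n * \<tau>" for n x y t
    using that
  proof (induction n arbitrary: x y t)
    case 0
    then show ?case using S_0 by simp
  next
    case (Suc n)
    show ?case
    proof (cases "t \<le> \<tau>")
      case True
      have "nrm \<alpha> (S t x - S t y) \<le> 2 * nrm \<alpha> (x - y)" using \<tau>(2) Suc.prems True by blast
      also have "\<dots> \<le> 2 ^ Suc n * nrm \<alpha> (x - y)"
        by (intro mult_right_mono nrm_ge_0) simp
      finally show ?thesis .
    next
      case False
      have "S t x = S (t - \<tau>) (S \<tau> x)" "S t y = S (t - \<tau>) (S \<tau> y)"
        using S_add[of "t - \<tau>" \<tau>] False Suc.prems \<tau>(1) by auto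
      then have "nrm \<alpha> (S t x - S t y) = nrm \<alpha> (S (t - \<tau>) (S \<tau> x) - S (t - \<tau>) (S \<tau> y))" by simp
      also have "\<dots> \<le> 2 ^ n * nrm \<alpha> (S \<tau> x - S \<tau> y)"
        using Suc.prems False \<tau>(1) by (intro Suc.IH S_in_A) (auto simp: algebra_simps)
      also have "\<dots> \<le> 2 ^ n * (2 * nrm \<alpha> (x - y))"
        using Suc.prems \<tau> by (intro mult_left_mono) auto
      also have "\<dots> = 2 ^ Suc n * nrm \<alpha> (x - y)" by simp
      finally show ?thesis .
    qed
  qed
  obtain n :: nat where "T / \<tau> < real n" using reals_Archimedean2 by blast
  then have "T \<le> real n * \<tau>" using \<tau>(1) by (simp add: field_simps)
  then show ?thesis using iter by (intro that[of "2 ^ n"]) auto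
qed

text \<open>
  The difference of two trajectories is a driven curve that starts from \<open>x - y\<close>.  The splitting is
  applied with \<open>T\<close> so large that the decaying part is at most \<open>\<parallel>x - y\<parallel> / 16\<close>, and with an
  error \<open>\<epsilon>\<close> of the same size.
\<close>

lemma smoothing_difference:
  obtains T K where "T > 0" "K > 0" "\<And>x y. \<lbrakk>x \<in> A; y \<in> A\<rbrakk> \<Longrightarrow>
    \<exists>k\<in>V \<beta>. nrm \<beta> k \<le> K * nrm \<alpha> (x - y) \<and> nrm \<alpha> (S T x - S T y - k) \<le> nrm \<alpha> (x - y) / 8"
proof -
  obtain c K where cK: "c > 0" "K > 0" and split: "\<And>T w P m p \<epsilon>. \<lbrakk>T > 0; driven T w P; \<epsilon> > 0;
      \<forall>t\<in>{0..T}. nrm \<alpha> (w t) \<le> m \<and> nrm \<beta> (P t) \<le> p\<rbrakk> \<Longrightarrow>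
    \<exists>v\<in>V \<beta>. nrm \<beta> v \<le> K * p \<and> nrm \<alpha> (w T - v) \<le> K * exp (- c * T) * nrm \<alpha> (w 0) + \<epsilon>"
    using splitting by metis
  obtain L where L: "L > 0" "\<And>x y t. \<lbrakk>x \<in> A; y \<in> A; t \<ge> 0\<rbrakk> \<Longrightarrow>
    nrm \<beta> (forcing (S t x) - forcing (S t y)) \<le> L * nrm \<alpha> (S t x - S t y)"
    using forcing_difference by blast
  \<comment> \<open>\<open>K exp (- c T) \<le> K / (c T) = 1 / 16\<close>\<close>
  define T where "T = 16 * K / c"
  have T: "T > 0" using cK by (simp add: T_def)
  have dec: "K * exp (- c * T) \<le> 1 / 16"
  proof -
    have "c * T = 16 * K" using cK by (simp add: T_def)
    then have "16 * K \<le> exp (c * T)" using exp_ge_add_one_self[of "c * T"] by linarith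
    then show ?thesis by (simp add: exp_minus field_simps)
  qed
  obtain Q where Q: "Q > 0" "\<And>x y t. \<lbrakk>x \<in> A; y \<in> A; 0 \<le> t; t \<le> T\<rbrakk> \<Longrightarrow>
    nrm \<alpha> (S t x - S t y) \<le> Q * nrm \<alpha> (x - y)"
    using finite_time_Lipschitz by blast
  have "\<exists>k\<in>V \<beta>. nrm \<beta> k \<le> K * (L * Q) * nrm \<alpha> (x - y) \<and> nrm \<alpha> (S T x - S T y - k) \<le> nrm \<alpha> (x - y) / 8"
    if xy: "x \<in> A" "y \<in> A" for x y
  proof (cases "x = y")
    case True
    then show ?thesis by (intro bexI[of _ 0]) (auto simp: nrm_0 V_0)
  next
    case False
    let ?r = "nrm \<alpha> (x - y)"
    have "?r \<noteq> 0" using False nrm_zero[OF V_diff[OF A_V A_V]] xy by simp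
    then have r: "?r > 0" using nrm_ge_0[of \<alpha> "x - y"] by simp
    have bd: "\<forall>t\<in>{0..T}. nrm \<alpha> (S t x - S t y) \<le> Q * ?r \<and> nrm \<beta> (forcing (S t x) - forcing (S t y)) \<le> L * (Q * ?r)"
    proof
      fix t assume t: "t \<in> {0..T}"
      have 1: "nrm \<alpha> (S t x - S t y) \<le> Q * ?r" using Q(2) xy t by simp
      moreover have "nrm \<beta> (forcing (S t x) - forcing (S t y)) \<le> L * (Q * ?r)"
        using L(2)[OF xy, of t] mult_left_mono[OF 1 less_imp_le[OF L(1)]] t by (auto intro: order_trans)
      ultimately show "nrm \<alpha> (S t x - S t y) \<le> Q * ?r \<and> nrm \<beta> (forcing (S t x) - forcing (S t y)) \<le> L * (Q * ?r)" ..
    qed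
    have "?r / 16 > 0" using r by simp
    from split[OF T difference_driven[OF xy T] this bd]
    obtain v where v: "v \<in> V \<beta>" "nrm \<beta> v \<le> K * (L * (Q * ?r))"
      "nrm \<alpha> (S T x - S T y - v) \<le> K * exp (- c * T) * nrm \<alpha> (S 0 x - S 0 y) + ?r / 16" by blast
    have "K * exp (- c * T) * nrm \<alpha> (S 0 x - S 0 y) \<le> 1 / 16 * ?r"
      using S_0 xy dec by (simp only: S_0) (intro mult_right_mono nrm_ge_0)
    then show ?thesis using v by (intro bexI[of _ v]) (auto simp: mult.assoc)
  qed
  moreover have "K * (L * Q) > 0" using cK L Q by simp
  ultimately show ?thesis using that[OF T] by blast
qed

theorem attractor_finite_dim: "fractal_dim V nrm \<alpha> A < \<infinity>"
proof -
  obtain R where R: "R > 0" "\<And>x. x \<in> A \<Longrightarrow> nrm \<alpha> x \<le> R" using A_bounded by blast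
  obtain T K where T: "T > 0" and K: "K > 0" and "\<And>x y. \<lbrakk>x \<in> A; y \<in> A\<rbrakk> \<Longrightarrow>
    \<exists>k\<in>V \<beta>. nrm \<beta> k \<le> K * nrm \<alpha> (x - y) \<and> nrm \<alpha> (S T x - S T y - k) \<le> nrm \<alpha> (x - y) / 8"
    using smoothing_difference by blast
  then show ?thesis
    using A_V R(2) S_A[of T] by (intro fractal_dim_finite_if_smoothing[OF \<beta>, of A R "S T" K]) auto
qed

end

theorem corollary6p4:
  fixes Om :: "'p::t2_space set"
    and C :: "('p, 'f::real_vector, 'n::finite, 'r::finite) bchart set"
    and VV :: "('p \<Rightarrow> 'f) set"
    and emb :: "('p \<Rightarrow> 'f) \<Rightarrow> 'd::real_vector"
    and V :: "real \<Rightarrow> 'd set"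
    and nrm :: "real \<Rightarrow> 'd \<Rightarrow> real"
    and \<theta>1 \<theta>2 \<beta> :: real
    and g :: 'd
    and S_NS :: "real \<Rightarrow> 'd \<Rightarrow> 'd"
    and A_reg :: "'d set"
  assumes model: "flow_model Om C G om vol Eb h VV emb V nrm pr Lam \<theta>1 \<theta>2 A0 M N Bbar b0"
    and i: "\<forall>v\<in>V (- \<theta>2). \<forall>w\<in>V (- \<theta>2). b0 w v (N v) = 0"
    and ii: "\<exists>\<sigma>1' \<sigma>2' \<gamma>'. \<sigma>1' < - \<theta>2 \<and> \<sigma>2' < - \<theta>2 \<and> bounded_trilinear V nrm \<sigma>1' \<sigma>2' \<gamma>' b0"
    and iii: "\<exists>\<sigma>1 \<sigma>2. \<sigma>1 \<le> - \<theta>2 \<and> \<sigma>2 \<le> \<theta>2 \<and> \<sigma>1 + \<sigma>2 \<le> 0 \<and>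
                bounded_trilinear V nrm \<sigma>1 (- \<theta>2) \<sigma>2 b0"
    and iv: "\<exists>cA>0. \<forall>v\<in>V (- \<theta>2). pr (A0 v) (N v) \<ge> cA * (nrm (- \<theta>2) v)\<^sup>2"
    and \<beta>: "\<beta> > - \<theta>2"
    and v: "\<exists>cA>0. \<forall>v\<in>V \<beta>. pr (A0 v) (Lam (2 * \<beta>) v) \<ge> cA * (nrm \<beta> v)\<^sup>2"
    and vi: "bounded_trilinear V nrm (- \<theta>2) (- \<theta>2) (- \<beta>) b0"
    and vii: "g \<in> V \<beta>"
    and semigroup: "solution_semigroup V nrm pr (emb ` VV) \<theta>2 A0 b0 g S_NS"
    and attractor: "global_attractor V nrm (- \<theta>2) S_NS A_reg"
  shows "bounded_in V nrm \<beta> A_reg \<and> fractal_dim V nrm (- \<theta>2) A_reg < \<infinity>"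
proof -
  interpret attractor_flow Om C G om vol Eb h VV emb V nrm pr Lam \<theta>1 \<theta>2 A0 M N Bbar b0 \<beta> g S_NS A_reg
    by (intro attractor_flow.intro damped_flow.intro damped_flow_axioms.intro attractor_flow_axioms.intro
        model iv \<beta> v vi vii semigroup attractor)
  show ?thesis using attractor_bounded attractor_finite_dim by blast
qed

end
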